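(* Let $n \ge 1$, let $\Omega \subset \mathbb{R}^n$ be a bounded convex domain and let $f$ be a convex function on $\Omega$ (defined up to the boundary) such that $f|_{\partial\Omega} \geq 0$. Then $$ \frac{1}{|\Omega|} \int_{\Omega} f \, d\mathcal{H}^n \leq \frac{2}{\sqrt{\pi}}\,\frac{n^{n+1}}{|\partial \Omega|} \int_{\partial \Omega} f \, d\mathcal{H}^{n-1}.$$
   Context: A domain is a nonempty connected open set. $\mathcal{H}^k$ is the $k$-dimensional Hausdorff measure; $|\Omega| = \mathcal{H}^n(\Omega)$ and $|\partial\Omega| = \mathcal{H}^{n-1}(\partial\Omega)$. The function $f$ is real-valued and convex on the closure $\overline{\Omega}$, so that its boundary values are defined. *)

theory Defs
  imports "HOL-Analysis.Analysis"
begin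

text \<open>
  Hausdorff measure, normalised so that in dimension \<open>k\<close> a ball of diameter \<open>d\<close> in
  \<open>k\<close>-space gets weight \<open>unit_ball_vol k * (d / 2) ^ k\<close>.  Since \<open>0 ^ 0 = 1\<close>, a singleton has
  weight 1 for \<open>k = 0\<close>, which gives counting measure; the empty set has weight 0 for every \<open>k\<close>.
  Unbounded sets are excluded from the covers because \<open>diameter\<close> is unspecified on them.
\<close>

definition hausdorff_weight :: "nat \<Rightarrow> 'a::metric_space set \<Rightarrow> ennreal" where
  "hausdorff_weight k U =
     (if U = {} then 0 else ennreal (unit_ball_vol (real k) * (diameter U / 2) ^ k))"

definition hausdorff_covers :: "real \<Rightarrow> 'a::metric_space set \<Rightarrow> (nat \<Rightarrow> 'a set) set" where
  "hausdorff_covers \<delta> A =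
     {U. A \<subseteq> (\<Union>i. U i) \<and> (\<forall>i. bounded (U i) \<and> diameter (U i) \<le> \<delta>)}"

definition hausdorff_outer :: "nat \<Rightarrow> 'a::metric_space set \<Rightarrow> ennreal" where
  "hausdorff_outer k A =
     (SUP \<delta>\<in>{0<..}. INF U\<in>hausdorff_covers \<delta> A. (\<Sum>i. hausdorff_weight k (U i)))"

text \<open>
  The outer measure is countably additive on the Borel sets by Caratheodory's criterion for metric
  outer measures, so \<open>measure_of\<close> does not take its default value here.
\<close>

definition hausdorff_measure :: "nat \<Rightarrow> 'a::metric_space measure" where
  "hausdorff_measure k = measure_of UNIV (sets borel) (hausdorff_outer k)"

text \<open>
  The Lebesgue integral over \<open>A\<close> as an extended real, positive part minus negative part.
  It is used instead of the Bochner integral because a real-valued convex function on a compact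
  convex set can be unbounded above and have integral \<open>\<infinity>\<close>, where the Bochner integral would return 0.
  The value is meaningful as soon as one of the two parts is finite.
\<close>

definition ext_integral :: "'a measure \<Rightarrow> 'a set \<Rightarrow> ('a \<Rightarrow> real) \<Rightarrow> ereal" where
  "ext_integral M A f =
     enn2ereal (\<integral>\<^sup>+x\<in>A. ennreal (f x) \<partial>M) - enn2ereal (\<integral>\<^sup>+x\<in>A. ennreal (- f x) \<partial>M)"

end

theory Submission
  imports Defs
begin

text \<open>
  Let \<open>e\<close> be a unit vector, \<open>w\<close> the width of \<open>\<Omega>\<close> in the direction \<open>e\<close>, and \<open>f \<ge> 0\<close>.  On every chord of
  \<open>\<Omega>\<close> parallel to \<open>e\<close>, the one-dimensional Hermite-Hadamard inequality bounds the integral of \<open>f\<close> by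
  half the length of the chord, hence by \<open>w / 2\<close>, times the sum of the values of \<open>f\<close> at the two
  endpoints.  Integrating over all chords, and using that the projection along \<open>e\<close> does not increase
  distances and maps two disjoint parts of the boundary onto the shadow of \<open>\<Omega>\<close>, one gets
  \<open>\<kappa> * (integral of f over \<Omega>) \<le> w / 2 * (integral of f over the boundary)\<close>
  (lemma \<open>nn_integral_convex_le_frontier\<close>), where \<open>\<kappa>\<close> is the Hausdorff measure of the
  \<open>(n - 1)\<close>-dimensional unit cube.

  It remains to find a direction for which \<open>w * area \<le> 2 * n ^ (n + 1) * \<kappa> * volume\<close>.  If \<open>\<Omega>\<close> lies in
  a box \<open>Q\<close>, then the nearest-point map onto the closure of \<open>\<Omega>\<close> carries the boundary of \<open>Q\<close> onto
  that of \<open>\<Omega>\<close> without increasing distances, so the area of the boundary of \<open>\<Omega>\<close> is at most that of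
  \<open>Q\<close> (\<open>hausdorff_outer_frontier_le_brick\<close>).  With \<open>e\<close> parallel to the shortest edge of \<open>Q\<close>, and \<open>w\<close>
  the length of this edge, the area of \<open>Q\<close> is at most \<open>2 * n * \<kappa> * volume of Q / w\<close>.  Finally, there is
  a box with \<open>volume of Q \<le> 2 ^ (n - 1) * n! * volume \<le> n ^ n * volume\<close> (\<open>ex_enclosing_brick\<close>): the box is
  spanned by the Gram-Schmidt basis of an inscribed simplex whose first edge is a diameter and whose
  further vertices are chosen as far as possible from the affine hull of the previous ones.  This
  gives the inequality with the constant \<open>n ^ (n + 1)\<close>, and \<open>1 \<le> 2 / sqrt pi\<close>.

  All these estimates are comparisons of ratios, so the normalisation of Hausdorff measure cancels.
  What enters is that on a coordinate subspace of dimension \<open>k\<close> the \<open>k\<close>-dimensional Hausdorff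
  measure is a positive finite multiple of Lebesgue measure
  (\<open>hausdorff_outer_eq_coord_measure\<close>), which follows from the uniqueness of
  translation-invariant measures.

  The argument along the chords supposes that \<open>f\<close> is continuous on the closure of \<open>\<Omega>\<close>.  In general the
  boundary values of \<open>f\<close> may lie above the limits from inside and may fail to be measurable; lemma
  \<open>mean_bound_convex_nonneg\<close> reduces this case to the continuous one by contracting \<open>\<Omega>\<close> towards an
  interior point.
\<close>

section \<open>Hausdorff measure as a Borel measure\<close>

text \<open>
  The premeasure of mesh \<open>\<delta>\<close>. It increases to the outer measure as
  \<open>\<delta>\<close> tends to 0.
\<close>

definition hausdorff_pre :: "nat \<Rightarrow> real \<Rightarrow> 'a::metric_space set \<Rightarrow> ennreal" where
  "hausdorff_pre k \<delta> A = (INF U\<in>hausdorff_covers \<delta> A. (\<Sum>i. hausdorff_weight k (U i)))"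

lemma hausdorff_coversD:
  "U \<in> hausdorff_covers \<delta> A \<Longrightarrow> x \<in> A \<Longrightarrow> \<exists>i. x \<in> U i"
  by (auto simp: hausdorff_covers_def)

lemma hausdorff_outer_eq_pre: "hausdorff_outer k A = (SUP \<delta>\<in>{0<..}. hausdorff_pre k \<delta> A)"
  by (simp add: hausdorff_outer_def hausdorff_pre_def)

lemma hausdorff_weight_empty [simp]: "hausdorff_weight k {} = 0"
  by (simp add: hausdorff_weight_def)

lemma hausdorff_pre_antimono: "\<delta> \<le> \<epsilon> \<Longrightarrow> hausdorff_pre k \<epsilon> A \<le> hausdorff_pre k \<delta> A"
  unfolding hausdorff_pre_def
  by (rule INF_superset_mono) (auto simp: hausdorff_covers_def intro: order_trans)

lemma hausdorff_pre_le_outer: "0 < \<delta> \<Longrightarrow> hausdorff_pre k \<delta> A \<le> hausdorff_outer k A"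
  unfolding hausdorff_outer_eq_pre by (rule SUP_upper) auto

lemma hausdorff_outer_leI:
  assumes "\<And>\<delta>. 0 < \<delta> \<Longrightarrow> hausdorff_pre k \<delta> A \<le> c"
  shows "hausdorff_outer k A \<le> c"
  unfolding hausdorff_outer_eq_pre using assms by (auto intro: SUP_least)

lemma hausdorff_pre_le_cover:
  "U \<in> hausdorff_covers \<delta> A \<Longrightarrow> hausdorff_pre k \<delta> A \<le> (\<Sum>i. hausdorff_weight k (U i))"
  unfolding hausdorff_pre_def by (rule INF_lower)

lemma hausdorff_pre_mono: "A \<subseteq> B \<Longrightarrow> hausdorff_pre k \<delta> A \<le> hausdorff_pre k \<delta> B"
  unfolding hausdorff_pre_def
  by (rule INF_superset_mono) (auto simp: hausdorff_covers_def)

lemma hausdorff_outer_mono: "A \<subseteq> B \<Longrightarrow> hausdorff_outer k A \<le> hausdorff_outer k B"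
  unfolding hausdorff_outer_eq_pre by (rule SUP_mono) (auto intro: hausdorff_pre_mono)

lemma hausdorff_outer_empty [simp]: "hausdorff_outer k {} = 0"
proof -
  have "hausdorff_pre k \<delta> ({}::'a set) \<le> 0" if "0 < \<delta>" for \<delta>
    using hausdorff_pre_le_cover[of "\<lambda>_. {}::'a set" \<delta> "{}" k] that
    by (auto simp: hausdorff_covers_def diameter_def)
  then show ?thesis by (metis hausdorff_outer_leI le_zero_eq)
qed

text \<open>
  Near-optimal covers of the sets \<open>A n\<close>, with errors \<open>e / 2 ^ (n +
  1)\<close>, are merged into one sequence by a pairing of the indices.
\<close>

lemma hausdorff_pre_countably_subadditive:
  "hausdorff_pre k \<delta> (\<Union>n::nat. A n) \<le> (\<Sum>n. hausdorff_pre k \<delta> (A n))"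
proof (cases "(\<Sum>n. hausdorff_pre k \<delta> (A n)) = \<infinity>")
  case False
  show ?thesis
  proof (rule ennreal_le_epsilon)
    fix e :: real assume "0 < e"
    have "\<exists>U\<in>hausdorff_covers \<delta> (A n).
      (\<Sum>i. hausdorff_weight k (U i)) \<le> hausdorff_pre k \<delta> (A n) + ennreal (e * (1/2) ^ Suc n)" for n
    proof -
      have "hausdorff_pre k \<delta> (A n) \<noteq> \<infinity>"
        using False ennreal_suminf_lessD[of "\<lambda>n. hausdorff_pre k \<delta> (A n)" top n]
        by (simp add: less_top)
      then have "hausdorff_pre k \<delta> (A n) < hausdorff_pre k \<delta> (A n) + ennreal (e * (1/2) ^ Suc n)"
        using \<open>0 < e\<close> ennreal_add_left_cancel_less[of "hausdorff_pre k \<delta> (A n)" 0] by simp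
      then show ?thesis
        unfolding hausdorff_pre_def INF_less_iff by (meson less_imp_le)
    qed
    then obtain U where U: "\<And>n. U n \<in> hausdorff_covers \<delta> (A n)"
      "\<And>n. (\<Sum>i. hausdorff_weight k (U n i)) \<le> hausdorff_pre k \<delta> (A n) + ennreal (e * (1/2) ^ Suc n)"
      by metis
    define V where "V m = (case prod_decode m of (n, i) \<Rightarrow> U n i)" for m
    have "V \<in> hausdorff_covers \<delta> (\<Union>n. A n)"
    proof -
      have "x \<in> (\<Union>m. V m)" if "x \<in> A n" for x n
      proof -
        obtain i where "x \<in> U n i" using hausdorff_coversD[OF U(1) \<open>x \<in> A n\<close>] by blast
        then have "x \<in> V (prod_encode (n, i))" by (simp add: V_def)
        then show ?thesis by blast
      qed
      then show ?thesis
        using U(1) by (auto simp: hausdorff_covers_def V_def split: prod.splits)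
    qed
    then have "hausdorff_pre k \<delta> (\<Union>n. A n) \<le> (\<Sum>m. hausdorff_weight k (V m))"
      by (rule hausdorff_pre_le_cover)
    also have "\<dots> = (\<Sum>m. (\<lambda>(n,i). hausdorff_weight k (U n i)) (prod_decode m))"
      by (simp add: V_def case_prod_beta)
    also have "\<dots> = (\<Sum>n. \<Sum>i. hausdorff_weight k (U n i))"
      by (subst suminf_ennreal_2dimen[where g = "\<lambda>n. \<Sum>i. hausdorff_weight k (U n i)"]) auto
    also have "\<dots> \<le> (\<Sum>n. hausdorff_pre k \<delta> (A n) + ennreal (e * (1/2) ^ Suc n))"
      by (intro suminf_le U) auto
    also have "\<dots> = (\<Sum>n. hausdorff_pre k \<delta> (A n)) + (\<Sum>n. ennreal (e * (1/2) ^ Suc n))"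
      by (rule suminf_add[symmetric]) auto
    also have "(\<Sum>n. ennreal (e * (1/2) ^ Suc n)) = ennreal e"
      using sums_mult[OF power_half_series, of e] \<open>0 < e\<close>
      by (intro suminf_ennreal_eq) auto
    finally show "hausdorff_pre k \<delta> (\<Union>n. A n) \<le> (\<Sum>n. hausdorff_pre k \<delta> (A n)) + ennreal e" .
  qed
qed auto

lemma hausdorff_outer_countably_subadditive:
  "hausdorff_outer k (\<Union>n::nat. A n) \<le> (\<Sum>n. hausdorff_outer k (A n))"
proof (rule hausdorff_outer_leI)
  fix \<delta> :: real assume "0 < \<delta>"
  have "hausdorff_pre k \<delta> (\<Union>n. A n) \<le> (\<Sum>n. hausdorff_pre k \<delta> (A n))"
    by (rule hausdorff_pre_countably_subadditive)
  also have "\<dots> \<le> (\<Sum>n. hausdorff_outer k (A n))"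
    by (intro suminf_le hausdorff_pre_le_outer \<open>0 < \<delta>\<close>) auto
  finally show "hausdorff_pre k \<delta> (\<Union>n. A n) \<le> (\<Sum>n. hausdorff_outer k (A n))" .
qed

lemma outer_measure_space_hausdorff:
  "outer_measure_space (Pow UNIV) (hausdorff_outer k :: 'a::metric_space set \<Rightarrow> ennreal)"
  unfolding outer_measure_space_def positive_def increasing_def countably_subadditive_def
  using hausdorff_outer_mono hausdorff_outer_countably_subadditive by auto

lemma hausdorff_outer_Un_le: "hausdorff_outer k (A \<union> B) \<le> hausdorff_outer k A + hausdorff_outer k B"
proof -
  have "A \<union> B = (\<Union>n. binaryset A B n)" by (simp add: UN_binaryset_eq)
  then show ?thesis
    using hausdorff_outer_countably_subadditive[of k "binaryset A B"]
    by (simp add: suminf_binaryset_eq)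
qed

lemma hausdorff_outer_UN_finite_le:
  "finite I \<Longrightarrow> hausdorff_outer k (\<Union>i\<in>I. A i) \<le> (\<Sum>i\<in>I. hausdorff_outer k (A i))"
  by (induction I rule: finite_induct)
     (auto intro!: order_trans[OF hausdorff_outer_Un_le] add_mono)

text \<open>
  A cover whose mesh is smaller than the distance of the two sets has no member that meets both,
  so it splits into a cover of each. This is the property of metric outer measures on which the
  criterion of Caratheodory rests.
\<close>

lemma hausdorff_outer_add_separated:
  assumes "0 < d" and sep: "\<And>x y. x \<in> A \<Longrightarrow> y \<in> B \<Longrightarrow> d \<le> dist x y"
  shows "hausdorff_outer k A + hausdorff_outer k B \<le> hausdorff_outer k (A \<union> B)"
proof -
  (* The two meshes are independent here, so that the two suprema can be taken one after the other. *)
  have pre: "hausdorff_pre k \<delta> A + hausdorff_pre k \<epsilon> B \<le> hausdorff_outer k (A \<union> B)"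
    if "0 < \<delta>" "0 < \<epsilon>" for \<delta> \<epsilon>
  proof -
    define \<eta> where "\<eta> = min (min \<delta> \<epsilon>) (d / 2)"
    have \<eta>: "0 < \<eta>" "\<eta> \<le> \<delta>" "\<eta> \<le> \<epsilon>" "\<eta> < d" using that \<open>0 < d\<close> by (auto simp: \<eta>_def)
    have "hausdorff_pre k \<eta> A + hausdorff_pre k \<eta> B \<le> hausdorff_pre k \<eta> (A \<union> B)"
      unfolding hausdorff_pre_def[of k \<eta> "A \<union> B"]
    proof (rule INF_greatest)
      fix U assume U: "U \<in> hausdorff_covers \<eta> (A \<union> B)"
      define V where "V S i = (if U i \<inter> S = {} then {} else U i)" for S and i :: nat
      have cov: "V S \<in> hausdorff_covers \<eta> S" if sub: "S \<subseteq> A \<union> B" for S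
      proof -
        have "S \<subseteq> (\<Union>i. V S i)"
        proof
          fix x assume "x \<in> S"
          then obtain i where "x \<in> U i" using hausdorff_coversD[OF U] sub by blast
          with \<open>x \<in> S\<close> have "x \<in> V S i" by (auto simp: V_def)
          then show "x \<in> (\<Union>i. V S i)" by blast
        qed
        moreover have "bounded (V S i) \<and> diameter (V S i) \<le> \<eta>" for i
          using U \<eta>(1) by (cases "U i \<inter> S = {}") (auto simp: hausdorff_covers_def V_def diameter_def[of "{}"])
        ultimately show ?thesis by (simp add: hausdorff_covers_def)
      qed
      have disj: "U i \<inter> A = {} \<or> U i \<inter> B = {}" for i
      proof (rule ccontr)
        assume "\<not> ?thesis"
        then obtain x y where "x \<in> U i" "x \<in> A" "y \<in> U i" "y \<in> B" by blast
        moreover have "bounded (U i)" "diameter (U i) \<le> \<eta>" using U by (auto simp: hausdorff_covers_def)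
        ultimately show False
          using sep[of x y] diameter_bounded_bound[of "U i" x y] \<eta> by force
      qed
      have "hausdorff_pre k \<eta> A + hausdorff_pre k \<eta> B
          \<le> (\<Sum>i. hausdorff_weight k (V A i)) + (\<Sum>i. hausdorff_weight k (V B i))"
        by (intro add_mono hausdorff_pre_le_cover cov) auto
      also have "\<dots> = (\<Sum>i. hausdorff_weight k (V A i) + hausdorff_weight k (V B i))"
        by (rule suminf_add) auto
      also have "\<dots> \<le> (\<Sum>i. hausdorff_weight k (U i))"
      proof (intro suminf_le allI)
        fix i show "hausdorff_weight k (V A i) + hausdorff_weight k (V B i) \<le> hausdorff_weight k (U i)"
          using disj[of i] by (auto simp: V_def)
      qed auto
      finally show "hausdorff_pre k \<eta> A + hausdorff_pre k \<eta> B \<le> (\<Sum>i. hausdorff_weight k (U i))" .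
    qed
    moreover have "hausdorff_pre k \<delta> A \<le> hausdorff_pre k \<eta> A" "hausdorff_pre k \<epsilon> B \<le> hausdorff_pre k \<eta> B"
      using \<eta> by (auto intro: hausdorff_pre_antimono)
    ultimately show ?thesis
      using hausdorff_pre_le_outer[OF \<eta>(1), of k "A \<union> B"] by (meson add_mono order_trans)
  qed
  have ne: "{0::real<..} \<noteq> {}" using zero_less_one by blast
  have "hausdorff_pre k \<delta> A + hausdorff_outer k B \<le> hausdorff_outer k (A \<union> B)" if "0 < \<delta>" for \<delta>
  proof -
    have "hausdorff_pre k \<delta> A + (SUP \<epsilon>\<in>{0<..}. hausdorff_pre k \<epsilon> B)
        = (SUP \<epsilon>\<in>{0<..}. hausdorff_pre k \<delta> A + hausdorff_pre k \<epsilon> B)"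
      by (rule ennreal_SUP_add_right[OF ne])
    also have "\<dots> \<le> hausdorff_outer k (A \<union> B)" using pre that by (auto intro: SUP_least)
    finally show ?thesis by (simp add: hausdorff_outer_eq_pre)
  qed
  moreover have "hausdorff_outer k A + hausdorff_outer k B
        = (SUP \<delta>\<in>{0<..}. hausdorff_pre k \<delta> A + hausdorff_outer k B)"
    unfolding hausdorff_outer_eq_pre[of k A]
    by (rule ennreal_SUP_add_left[OF ne, symmetric])
  ultimately show ?thesis by (auto intro: SUP_least)
qed

text \<open>
  Lipschitz maps with constant 1 carry covers to covers without increasing any diameter. Both
  the comparison of the boundary with its projection and the comparison of two nested convex
  boundaries use this.
\<close>

lemma hausdorff_outer_lipschitz_image:
  assumes "\<And>x y. x \<in> A \<Longrightarrow> y \<in> A \<Longrightarrow> dist (f x) (f y) \<le> dist x y"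
  shows "hausdorff_outer k (f ` A) \<le> hausdorff_outer k A"
proof (rule hausdorff_outer_leI)
  fix \<delta> :: real assume "0 < \<delta>"
  have "hausdorff_pre k \<delta> (f ` A) \<le> hausdorff_pre k \<delta> A"
    unfolding hausdorff_pre_def[of k \<delta> A]
  proof (rule INF_greatest)
    fix U assume U: "U \<in> hausdorff_covers \<delta> A"
    define V where "V i = f ` (U i \<inter> A)" for i
    have V: "bounded (V i) \<and> diameter (V i) \<le> diameter (U i)" for i
    proof -
      have b: "bounded (U i)" using U by (auto simp: hausdorff_covers_def)
      have d: "dist x y \<le> diameter (U i)" if xy: "x \<in> V i" "y \<in> V i" for x y
      proof -
        obtain p q where "p \<in> U i" "p \<in> A" "x = f p" "q \<in> U i" "q \<in> A" "y = f q"
          using xy by (auto simp: V_def)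
        then show ?thesis using assms[of p q] diameter_bounded_bound[OF b, of p q] by simp
      qed
      show ?thesis
      proof (cases "V i = {}")
        case True then show ?thesis using diameter_ge_0[OF b] by (simp add: diameter_def)
      next
        case False
        then obtain x where "x \<in> V i" by blast
        then have "bounded (V i)" using d by (auto simp: bounded_def)
        moreover have "diameter (V i) \<le> diameter (U i)"
          unfolding diameter_def[of "V i"] using d False by (auto intro!: cSUP_least)
        ultimately show ?thesis by simp
      qed
    qed
    have "V \<in> hausdorff_covers \<delta> (f ` A)"
    proof -
      have "f ` A \<subseteq> (\<Union>i. V i)"
      proof (rule image_subsetI)
        fix x assume "x \<in> A"
        then obtain i where "x \<in> U i" using hausdorff_coversD[OF U] by blast
        then have "f x \<in> V i" using \<open>x \<in> A\<close> by (simp add: V_def)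
        then show "f x \<in> (\<Union>i. V i)" by blast
      qed
      then show ?thesis using V U unfolding hausdorff_covers_def by (blast intro: order_trans)
    qed
    then have "hausdorff_pre k \<delta> (f ` A) \<le> (\<Sum>i. hausdorff_weight k (V i))"
      by (rule hausdorff_pre_le_cover)
    also have "\<dots> \<le> (\<Sum>i. hausdorff_weight k (U i))"
    proof (intro suminf_le allI)
      fix i
      have "0 \<le> diameter (V i)" using V diameter_ge_0 by blast
      moreover have "V i = {}" if "U i = {}" using that by (simp add: V_def)
      ultimately show "hausdorff_weight k (V i) \<le> hausdorff_weight k (U i)"
        using V[of i] by (auto simp: hausdorff_weight_def intro!: ennreal_leI mult_left_mono power_mono)
    qed auto
    finally show "hausdorff_pre k \<delta> (f ` A) \<le> (\<Sum>i. hausdorff_weight k (U i))" .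
  qed
  also have "\<dots> \<le> hausdorff_outer k A" by (rule hausdorff_pre_le_outer[OF \<open>0 < \<delta>\<close>])
  finally show "hausdorff_pre k \<delta> (f ` A) \<le> hausdorff_outer k A" .
qed

lemma hausdorff_outer_isometry_image:
  assumes "\<And>x y. x \<in> A \<Longrightarrow> y \<in> A \<Longrightarrow> dist (f x) (f y) = dist x y"
  shows "hausdorff_outer k (f ` A) = hausdorff_outer k A"
proof (rule antisym)
  show "hausdorff_outer k (f ` A) \<le> hausdorff_outer k A"
    by (rule hausdorff_outer_lipschitz_image) (simp add: assms)
  have "inj_on f A" using assms by (metis dist_eq_0_iff inj_onI)
  have "hausdorff_outer k (inv_into A f ` f ` A) \<le> hausdorff_outer k (f ` A)"
    by (rule hausdorff_outer_lipschitz_image) (auto simp: \<open>inj_on f A\<close> assms)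
  then show "hausdorff_outer k A \<le> hausdorff_outer k (f ` A)"
    using \<open>inj_on f A\<close> by (simp add: image_image)
qed

lemma ennreal_suminf_tail_le:
  fixes f :: "nat \<Rightarrow> ennreal"
  assumes "suminf f < \<infinity>" and "0 < e"
  shows "\<exists>n. (\<Sum>i. f (i + n)) \<le> ennreal e"
proof (cases "suminf f = 0")
  case True
  then show ?thesis by (intro exI[of _ 0]) simp
next
  case False
  then have "suminf f - ennreal e < suminf f"
    using assms by (intro ennreal_between) (auto simp: zero_less_iff_neq_zero less_top)
  then have "eventually (\<lambda>n. suminf f - ennreal e < sum f {..<n}) sequentially"
    using summable_LIMSEQ[of f] by (auto dest: order_tendstoD(1))
  then obtain n where "suminf f - ennreal e < sum f {..<n}" by (auto simp: eventually_sequentially)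
  then have "suminf f - ennreal e \<le> sum f {..<n}" by (rule less_imp_le)
  then have "suminf f \<le> sum f {..<n} + ennreal e"
    by (simp add: ennreal_minus_le_iff add.commute)
  moreover have "sum f {..<n} \<noteq> \<infinity>"
    using sum_le_suminf[of f "{..<n}"] assms(1) by (metis finite_lessThan infinity_ennreal_def
      le_less_trans less_irrefl summableI zero_le)
  moreover have "suminf f = sum f {..<n} + (\<Sum>i. f (i + n))"
    using suminf_offset[of f n] by (simp add: add.commute)
  ultimately show ?thesis by (auto simp: ennreal_add_left_cancel_le)
qed

text \<open>
  Caratheodory's criterion. The sets \<open>S n\<close> exhaust \<open>A - F\<close> and each of
  them has positive distance from \<open>F\<close>, so that additivity holds for \<open>A
  \<inter> F\<close> and \<open>S n\<close>. The layers \<open>R n\<close> between consecutive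
  sets \<open>S n\<close> are separated when their indices differ by at least 2; hence the even
  layers and the odd layers each have total measure at most that of \<open>A\<close>, the series
  over all layers converges, and what \<open>S n\<close> misses of \<open>A - F\<close> tends to
  0.
\<close>

lemma hausdorff_outer_Int_Diff_closed:
  fixes F :: "'a::metric_space set"
  assumes "closed F"
  shows "hausdorff_outer k (A \<inter> F) + hausdorff_outer k (A - F) \<le> hausdorff_outer k A"
proof (cases "F = {} \<or> hausdorff_outer k A = \<infinity>")
  case True then show ?thesis by (elim disjE) simp_all
next
  case False
  let ?H = "hausdorff_outer k"
  define S where "S n = {x\<in>A. inverse (real (Suc n)) \<le> infdist x F}" for n
  define R where "R n = S (Suc n) - S n" for n
  have S_le: "?H (A \<inter> F) + ?H (S n) \<le> ?H A" for n
  proof -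
    have "?H (A \<inter> F) + ?H (S n) \<le> ?H (A \<inter> F \<union> S n)"
    proof (rule hausdorff_outer_add_separated)
      fix x y assume "x \<in> A \<inter> F" "y \<in> S n"
      then show "inverse (real (Suc n)) \<le> dist x y"
        using infdist_le[of x F y] by (auto simp: S_def dist_commute)
    qed auto
    also have "\<dots> \<le> ?H A" by (rule hausdorff_outer_mono) (auto simp: S_def)
    finally show ?thesis .
  qed
  have R_sep: "inverse (real (Suc (Suc i))) - inverse (real (Suc j)) \<le> dist x y"
    if "x \<in> R i" "y \<in> R j" for x y i j
  proof -
    have "inverse (real (Suc (Suc i))) \<le> infdist x F" "infdist y F < inverse (real (Suc j))"
      using that by (auto simp: R_def S_def)
    moreover have "infdist x F \<le> infdist y F + dist x y" by (rule infdist_triangle)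
    ultimately show ?thesis by linarith
  qed
  (* c = 0 gives the even layers and c = 1 the odd ones. *)
  have add: "(\<Sum>i<m. ?H (R (2 * i + c))) \<le> ?H (\<Union>i<m. R (2 * i + c))" for m c
  proof (induction m)
    case (Suc m)
    let ?d = "inverse (real (2 * m + c)) - inverse (real (2 * m + c + 1))"
    have "?H (\<Union>i<m. R (2 * i + c)) + ?H (R (2 * m + c)) \<le> ?H ((\<Union>i<m. R (2 * i + c)) \<union> R (2 * m + c))"
    proof (cases "m = 0")
      case False
      show ?thesis
      proof (rule hausdorff_outer_add_separated)
        show "0 < ?d" using False by simp
        fix x y assume "x \<in> (\<Union>i<m. R (2 * i + c))" and y: "y \<in> R (2 * m + c)"
        then obtain i where i: "i < m" "x \<in> R (2 * i + c)" by blast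
        have "inverse (real (2 * m + c)) \<le> inverse (real (Suc (Suc (2 * i + c))))"
          using i(1) by (intro le_imp_inverse_le) auto
        then show "?d \<le> dist x y" using R_sep[OF i(2) y] by simp
      qed
    qed auto
    then have "(\<Sum>i<m. ?H (R (2 * i + c))) + ?H (R (2 * m + c))
        \<le> ?H ((\<Union>i<m. R (2 * i + c)) \<union> R (2 * m + c))"
      using add_right_mono[OF Suc, of "?H (R (2 * m + c))"] by (rule order_trans[rotated])
    then show ?case by (simp add: lessThan_Suc Un_commute add.commute)
  qed auto
  have par: "(\<Sum>i. ?H (R (2 * i + c))) \<le> ?H A" for c
  proof (rule suminf_le_const)
    fix m
    have "(\<Union>i<m. R (2 * i + c)) \<subseteq> A" by (auto simp: R_def S_def)
    then show "(\<Sum>i<m. ?H (R (2 * i + c))) \<le> ?H A"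
      using add[of c m] hausdorff_outer_mono order_trans by blast
  qed auto
  have "(\<Sum>i. ?H (R i)) \<le> (\<Sum>i. ?H (R (2 * i + 0))) + (\<Sum>i. ?H (R (2 * i + 1)))"
  proof (rule suminf_le_const)
    fix m
    have "(\<Sum>i<m. ?H (R i)) \<le> (\<Sum>i<2 * m. ?H (R i))" by (intro sum_mono2) auto
    also have "\<dots> = (\<Sum>i<m. ?H (R (2 * i + 0))) + (\<Sum>i<m. ?H (R (2 * i + 1)))"
      by (induction m) (auto simp: algebra_simps)
    also have "\<dots> \<le> (\<Sum>i. ?H (R (2 * i + 0))) + (\<Sum>i. ?H (R (2 * i + 1)))"
      by (intro add_mono sum_le_suminf) auto
    finally show "(\<Sum>i<m. ?H (R i)) \<le> \<dots>" .
  qed auto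
  also have "\<dots> \<le> ?H A + ?H A" by (intro add_mono par)
  also have "\<dots> < \<infinity>" using False by (simp add: less_top)
  finally have fin: "(\<Sum>i. ?H (R i)) < \<infinity>" .
  have tail: "A - F \<subseteq> S n \<union> (\<Union>i. R (i + n))" for n
  proof
    fix x assume x: "x \<in> A - F"
    then have "0 < infdist x F"
      using assms False by (metis Diff_iff in_closed_iff_infdist_zero infdist_nonneg order_le_less)
    then obtain m where "inverse (real (Suc m)) < infdist x F" using reals_Archimedean by blast
    then have ex: "x \<in> S m" using x by (auto simp: S_def)
    show "x \<in> S n \<union> (\<Union>i. R (i + n))"
    proof (cases "x \<in> S n")
      case False
      have mono: "S i \<subseteq> S j" if "i \<le> j" for i j
      proof -
        have "inverse (real (Suc j)) \<le> inverse (real (Suc i))" using that by (intro le_imp_inverse_le) auto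
        then show ?thesis unfolding S_def by (blast intro: order_trans)
      qed
      define l where "l = (LEAST l. x \<in> S l)"
      have l: "x \<in> S l" "\<And>j. j < l \<Longrightarrow> x \<notin> S j"
        using ex not_less_Least by (auto simp: l_def intro: LeastI)
      have "n < l" using False l(1) mono by (metis not_less subsetD)
      then have "x \<in> R (l - 1 - n + n)" using l by (auto simp: R_def)
      then show ?thesis by blast
    qed auto
  qed
  have "?H (A \<inter> F) + ?H (A - F) \<le> ?H A + ennreal e" if "0 < e" for e
  proof -
    obtain n where n: "(\<Sum>i. ?H (R (i + n))) \<le> ennreal e"
      using ennreal_suminf_tail_le[OF fin \<open>0 < e\<close>] by blast
    have "?H (A - F) \<le> ?H (S n) + ?H (\<Union>i. R (i + n))"
      using hausdorff_outer_mono[OF tail] hausdorff_outer_Un_le order_trans by blast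
    also have "\<dots> \<le> ?H (S n) + ennreal e"
      using n hausdorff_outer_countably_subadditive[of k "\<lambda>i. R (i + n)"]
      by (intro add_left_mono) (rule order_trans)
    finally have "?H (A \<inter> F) + ?H (A - F) \<le> (?H (A \<inter> F) + ?H (S n)) + ennreal e"
      by (metis add.assoc add_left_mono)
    also have "\<dots> \<le> ?H A + ennreal e" by (intro add_right_mono S_le)
    finally show ?thesis .
  qed
  then show ?thesis using ennreal_le_epsilon by blast
qed

text \<open>
  The closed sets belong to the sigma-algebra of Caratheodory-measurable sets, hence so do the
  Borel sets.
\<close>

lemma measure_space_hausdorff:
  "measure_space UNIV (sets borel) (hausdorff_outer k :: 'a::metric_space set \<Rightarrow> ennreal)"
proof -
  let ?H = "hausdorff_outer k :: 'a set \<Rightarrow> ennreal"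
  let ?L = "lambda_system UNIV (Pow UNIV) ?H"
  have ms: "measure_space UNIV ?L ?H"
    by (rule sigma_algebra.caratheodory_lemma[OF sigma_algebra_Pow outer_measure_space_hausdorff])
  have "closed F \<Longrightarrow> F \<in> ?L" for F
  proof -
    assume F: "closed F"
    have "?H (F \<inter> A) + ?H ((UNIV - F) \<inter> A) = ?H A" for A
    proof (rule antisym)
      show "?H (F \<inter> A) + ?H ((UNIV - F) \<inter> A) \<le> ?H A"
        using hausdorff_outer_Int_Diff_closed[OF F, of k A]
        by (simp add: Int_commute Diff_eq)
      have "A = F \<inter> A \<union> (UNIV - F) \<inter> A" by auto
      then show "?H A \<le> ?H (F \<inter> A) + ?H ((UNIV - F) \<inter> A)"
        using hausdorff_outer_Un_le by metis
    qed
    then show ?thesis by (simp add: lambda_system_def)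
  qed
  moreover have "sigma_algebra UNIV ?L" using ms by (simp add: measure_space_def)
  ultimately have "sigma_sets UNIV (Collect closed) \<subseteq> ?L"
    by (intro sigma_algebra.sigma_sets_subset) auto
  then have sub: "sets borel \<subseteq> ?L" by (simp add: borel_eq_closed)
  show ?thesis
    unfolding measure_space_def
  proof (intro conjI)
    show "sigma_algebra UNIV (sets (borel :: 'a measure))"
      using sets.sigma_algebra_axioms[of "borel :: 'a measure"] by simp
    show "positive (sets borel) ?H" by (simp add: positive_def)
    have ca: "countably_additive ?L ?H" using ms by (simp add: measure_space_def)
    show "countably_additive (sets borel) ?H"
      unfolding countably_additive_def
    proof (intro allI impI)
      fix A :: "nat \<Rightarrow> 'a set"
      assume "range A \<subseteq> sets borel" "disjoint_family A" "\<Union> (range A) \<in> sets borel"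
      then show "(\<Sum>i. ?H (A i)) = ?H (\<Union> (range A))"
        using sub by (intro ca[unfolded countably_additive_def, rule_format]) blast+
    qed
  qed
qed

lemma sets_hausdorff_measure [simp, measurable_cong]: "sets (hausdorff_measure k) = sets borel"
  using sets.sigma_sets_eq[of borel] by (simp add: hausdorff_measure_def)

lemma space_hausdorff_measure [simp]: "space (hausdorff_measure k) = UNIV"
  by (simp add: hausdorff_measure_def)

lemma emeasure_hausdorff_measure:
  "A \<in> sets borel \<Longrightarrow> emeasure (hausdorff_measure k) A = hausdorff_outer k A"
  using measure_space_hausdorff[of k, where ?'a = 'a]
  unfolding hausdorff_measure_def
  by (intro emeasure_measure_of_sigma) (auto simp: measure_space_def)

section \<open>Uniqueness of translation-invariant measures\<close>

lemma ennreal_mult_right_cancel: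
  fixes a b c :: ennreal
  shows "a * c = b * c \<Longrightarrow> c \<noteq> 0 \<Longrightarrow> c \<noteq> \<infinity> \<Longrightarrow> a = b"
  using ennreal_mult_cancel_left[of c a b] by (auto simp: mult.commute)

text \<open>
  The uniqueness argument for Haar measure, for measures that live on a subspace. Fubini's
  theorem is applied to \<open>(x, y) \<mapsto> indicator A x * indicator C (x + y)\<close>:
  integrating over \<open>y\<close> first gives the left-hand side, and after the substitution
  \<open>x \<mapsto> x - y\<close> the inner integral over \<open>y\<close> is the measure of a
  translate of \<open>- A\<close>.
\<close>

lemma translation_invariant_measures_proportional:
  fixes M N :: "'a::euclidean_space measure"
  assumes sets_M [measurable_cong]: "sets M = sets borel" and sets_N [measurable_cong]: "sets N = sets borel"
    and "sigma_finite_measure M" "sigma_finite_measure N"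
    and Y: "subspace Y" "AE x in M. x \<in> Y" "AE x in N. x \<in> Y"
    and inv_M: "\<And>y. y \<in> Y \<Longrightarrow> distr M borel ((+) y) = M"
    and inv_N: "\<And>y. y \<in> Y \<Longrightarrow> distr N borel ((+) y) = N"
    and A [measurable]: "A \<in> sets borel" and C [measurable]: "C \<in> sets borel"
  shows "emeasure M A * emeasure N C = emeasure N (uminus -` A) * emeasure M C"
proof -
  interpret pair_sigma_finite M N
    using assms by (simp add: pair_sigma_finite_def)
  have sub: "(\<integral>\<^sup>+x. g (y + x) \<partial>M) = (\<integral>\<^sup>+x. g x \<partial>M)"
    if "y \<in> Y" "g \<in> borel_measurable borel" for g :: "'a \<Rightarrow> ennreal" and y
  proof -
    have "(\<integral>\<^sup>+x. g x \<partial>M) = (\<integral>\<^sup>+x. g x \<partial>distr M borel ((+) y))"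
      by (simp only: inv_M[OF that(1)])
    also have "\<dots> = (\<integral>\<^sup>+x. g (y + x) \<partial>M)"
      by (rule nn_integral_distr) (use that(2) in measurable)
    finally show ?thesis by (rule sym)
  qed
  have subN: "(\<integral>\<^sup>+x. g (y + x) \<partial>N) = (\<integral>\<^sup>+x. g x \<partial>N)"
    if "y \<in> Y" "g \<in> borel_measurable borel" for g :: "'a \<Rightarrow> ennreal" and y
  proof -
    have "(\<integral>\<^sup>+x. g x \<partial>N) = (\<integral>\<^sup>+x. g x \<partial>distr N borel ((+) y))"
      by (simp only: inv_N[OF that(1)])
    also have "\<dots> = (\<integral>\<^sup>+x. g (y + x) \<partial>N)"
      by (rule nn_integral_distr) (use that(2) in measurable)
    finally show ?thesis by (rule sym)
  qed
  have mA: "uminus -` A \<in> sets borel"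
    using measurable_sets[of uminus borel borel A] by simp
  have "emeasure M A * emeasure N C = (\<integral>\<^sup>+x. indicator A x * emeasure N C \<partial>M)"
    by (subst nn_integral_multc) measurable
  also have "\<dots> = (\<integral>\<^sup>+x. (\<integral>\<^sup>+y. indicator A x * indicator C (x + y) \<partial>N) \<partial>M)"
  proof (rule nn_integral_cong_AE, use Y(2) in eventually_elim)
    case (elim x)
    have "(\<integral>\<^sup>+y. indicator C (x + y) \<partial>N) = emeasure N C"
      using subN[OF elim, of "indicator C"] C by (simp add: sets_N)
    then show ?case by (subst nn_integral_cmult) simp_all
  qed
  also have "\<dots> = (\<integral>\<^sup>+y. (\<integral>\<^sup>+x. indicator A x * indicator C (x + y) \<partial>M) \<partial>N)"
    by (rule Fubini'[symmetric]) measurable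
  also have "\<dots> = (\<integral>\<^sup>+y. (\<integral>\<^sup>+x. indicator A (x - y) * indicator C x \<partial>M) \<partial>N)"
  proof (rule nn_integral_cong_AE, use Y(3) in eventually_elim)
    case (elim y)
    show ?case
      using sub[OF elim, of "\<lambda>x. indicator A (x - y) * indicator C x"] by (simp add: add.commute)
  qed
  also have "\<dots> = (\<integral>\<^sup>+x. (\<integral>\<^sup>+y. indicator A (x - y) * indicator C x \<partial>N) \<partial>M)"
    by (rule Fubini') measurable
  also have "\<dots> = (\<integral>\<^sup>+x. emeasure N (uminus -` A) * indicator C x \<partial>M)"
  proof (rule nn_integral_cong_AE, use Y(2) in eventually_elim)
    case (elim x)
    have "(\<integral>\<^sup>+y. indicator A (x - y) \<partial>N) = (\<integral>\<^sup>+y. indicator (uminus -` A) (- x + y) \<partial>N)"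
      by (intro nn_integral_cong) (simp add: indicator_def)
    also have "\<dots> = emeasure N (uminus -` A)"
      using subN[of "- x" "indicator (uminus -` A)"] elim Y(1) mA
      by (simp add: sets_N subspace_neg)
    finally show ?case
      by (subst nn_integral_multc) simp_all
  qed
  also have "\<dots> = emeasure N (uminus -` A) * emeasure M C"
    by (subst nn_integral_cmult) measurable
  finally show ?thesis .
qed

text \<open>
  The preceding identity for the pair \<open>N\<close>, \<open>N\<close> shows that
  \<open>N\<close> is invariant under reflection; this turns the identity for \<open>M\<close>,
  \<open>N\<close> into proportionality.
\<close>

lemma translation_invariant_measure_unique:
  fixes M N :: "'a::euclidean_space measure"
  assumes "sets M = sets borel" "sets N = sets borel"
    and "sigma_finite_measure M" "sigma_finite_measure N"
    and "subspace Y" "AE x in M. x \<in> Y" "AE x in N. x \<in> Y"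
    and "\<And>y. y \<in> Y \<Longrightarrow> distr M borel ((+) y) = M"
    and "\<And>y. y \<in> Y \<Longrightarrow> distr N borel ((+) y) = N"
    and "A \<in> sets borel" "C \<in> sets borel"
    and C: "emeasure N C \<noteq> 0" "emeasure N C \<noteq> \<infinity>"
  shows "emeasure M A * emeasure N C = emeasure N A * emeasure M C"
proof -
  have "emeasure N A * emeasure N C = emeasure N (uminus -` A) * emeasure N C"
    by (rule translation_invariant_measures_proportional[where Y = Y]) (use assms in auto)
  then have "emeasure N A = emeasure N (uminus -` A)"
    using C by (rule ennreal_mult_right_cancel)
  moreover have "emeasure M A * emeasure N C = emeasure N (uminus -` A) * emeasure M C"
    by (rule translation_invariant_measures_proportional[where Y = Y]) (use assms in auto)
  ultimately show ?thesis by simp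
qed

text \<open>
  The image measure is again translation invariant, so it is a multiple of Lebesgue measure, and
  the unit ball, which is mapped to itself, shows that the factor is 1.
\<close>

lemma distr_lborel_orthogonal:
  fixes T :: "'a::euclidean_space \<Rightarrow> 'a"
  assumes T: "orthogonal_transformation T"
  shows "distr lborel borel T = lborel"
proof (rule measure_eqI)
  have lin: "linear T" and nrm: "\<And>x. norm (T x) = norm x"
    using T by (auto simp: orthogonal_transformation)
  then have [measurable]: "T \<in> borel_measurable borel"
    by (intro borel_measurable_continuous_onI linear_continuous_on) (simp add: linear_linear)
  fix A assume "A \<in> sets (distr lborel borel T)"
  then have A: "A \<in> sets borel" by simp
  let ?C = "cball 0 1 :: 'a set"
  have C: "emeasure lborel ?C \<noteq> 0" "emeasure lborel ?C \<noteq> \<infinity>"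
    using emeasure_lborel_cball_finite[of "0::'a" 1] content_cball_pos[of 1 "0::'a"]
    by (auto simp: measure_def)
  have "emeasure (distr lborel borel T) A * emeasure lborel ?C
      = emeasure lborel A * emeasure (distr lborel borel T) ?C"
  proof (rule translation_invariant_measure_unique[where Y = UNIV])
    show "sigma_finite_measure (distr lborel borel T)"
    proof
      show "\<exists>S. countable S \<and> S \<subseteq> sets (distr lborel borel T) \<and> \<Union> S = space (distr lborel borel T) \<and>
          (\<forall>a\<in>S. emeasure (distr lborel borel T) a \<noteq> \<infinity>)"
      proof (intro exI conjI ballI)
        show "\<Union> (range (\<lambda>n::nat. cball 0 (real n))) = space (distr lborel borel T)"
          using real_arch_simple by (auto simp: dist_norm)
        fix a assume "a \<in> range (\<lambda>n::nat. cball (0::'a) (real n))"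
        then obtain n :: nat where n: "a = cball 0 (real n)" by auto
        have "T -` a = a" by (auto simp: n nrm)
        then show "emeasure (distr lborel borel T) a \<noteq> \<infinity>"
          using emeasure_lborel_cball_finite[of "0::'a" "real n"] by (simp add: emeasure_distr n)
      qed auto
    qed
    fix y :: 'a
    obtain z where z: "y = T z"
      using orthogonal_transformation_surj[OF T] by (metis surjD)
    have "distr (distr lborel borel T) borel ((+) y) = distr (distr lborel borel ((+) z)) borel T"
      using lin by (simp add: distr_distr comp_def z linear_add)
    then show "distr (distr lborel borel T) borel ((+) y) = distr lborel borel T"
      by (simp add: lborel_distr_plus)
  qed (use A C in \<open>auto simp: lborel_distr_plus sigma_finite_lborel subspace_UNIV\<close>)
  moreover have "emeasure (distr lborel borel T) ?C = emeasure lborel ?C"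
  proof -
    have "T -` ?C = ?C" by (auto simp: nrm)
    then show ?thesis by (simp add: emeasure_distr)
  qed
  ultimately show "emeasure (distr lborel borel T) A = emeasure lborel A"
    using C ennreal_mult_right_cancel by metis
qed auto

section \<open>Bricks and Lebesgue measure on coordinate subspaces\<close>

text \<open>
  Boxes, slabs and coordinate subspaces are taken with respect to an arbitrary orthonormal
  basis, since the box that encloses a given convex body is not parallel to the standard axes.
\<close>

locale orthonormal_basis =
  fixes B :: "'a::euclidean_space set"
  assumes inner_basis: "b \<in> B \<Longrightarrow> c \<in> B \<Longrightarrow> b \<bullet> c = (if b = c then 1 else 0)"
    and card_basis: "card B = DIM('a)"
begin

lemma finite_basis [simp]: "finite B"
  using card_basis DIM_positive[where 'a = 'a] card.infinite by fastforce

lemma inner_sum_basis: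
  assumes "J \<subseteq> B" "b \<in> B"
  shows "(\<Sum>c\<in>J. f c *\<^sub>R c) \<bullet> b = (if b \<in> J then f b else 0)"
proof -
  have "finite J" using assms(1) finite_basis finite_subset by blast
  have "(\<Sum>c\<in>J. f c *\<^sub>R c) \<bullet> b = (\<Sum>c\<in>J. if c = b then f c else 0)"
    using assms by (simp add: inner_sum_left inner_basis subset_iff if_distrib cong: if_cong)
  then show ?thesis using \<open>finite J\<close> by simp
qed

lemma span_basis: "span B = UNIV"
proof -
  have "pairwise orthogonal B" by (auto simp: pairwise_def orthogonal_def inner_basis)
  moreover have "0 \<notin> B" using inner_basis by fastforce
  ultimately have "independent B" by (rule pairwise_orthogonal_independent)
  then show ?thesis
    using card_basis card_ge_dim_independent[of B UNIV] by auto
qed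

lemma eq_basisI:
  assumes "\<And>b. b \<in> B \<Longrightarrow> x \<bullet> b = y \<bullet> b"
  shows "x = y"
proof -
  have "orthogonal (x - y) b" if "b \<in> B" for b
    using assms[OF that] by (simp add: orthogonal_def inner_diff_left)
  then have "orthogonal (x - y) (x - y)"
    using orthogonal_to_span[of "x - y" B "x - y"] by (simp add: span_basis)
  then show ?thesis by (simp add: orthogonal_def)
qed

lemma basis_representation: "(\<Sum>b\<in>B. (x \<bullet> b) *\<^sub>R b) = x"
  by (rule eq_basisI) (simp add: inner_sum_basis)

lemma inner_eq_sum: "x \<bullet> y = (\<Sum>b\<in>B. (x \<bullet> b) * (y \<bullet> b))"
proof -
  have "x \<bullet> y = x \<bullet> (\<Sum>b\<in>B. (y \<bullet> b) *\<^sub>R b)" by (simp only: basis_representation)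
  then show ?thesis by (simp add: inner_sum_right mult.commute)
qed

lemma norm_le_sum: "norm x \<le> (\<Sum>b\<in>B. \<bar>x \<bullet> b\<bar>)"
proof -
  have "norm x = norm (\<Sum>b\<in>B. (x \<bullet> b) *\<^sub>R b)" by (simp only: basis_representation)
  also have "\<dots> \<le> (\<Sum>b\<in>B. norm ((x \<bullet> b) *\<^sub>R b))" by (rule norm_sum)
  also have "\<dots> = (\<Sum>b\<in>B. \<bar>x \<bullet> b\<bar>)"
    by (intro sum.cong) (auto simp: norm_eq_sqrt_inner inner_basis)
  finally show ?thesis .
qed

lemma norm_basis: "b \<in> B \<Longrightarrow> norm b = 1"
  by (simp add: norm_eq_sqrt_inner inner_basis)

lemma abs_inner_le: "b \<in> B \<Longrightarrow> \<bar>x \<bullet> b\<bar> \<le> norm x"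
  using Cauchy_Schwarz_ineq2[of x b] by (simp add: norm_basis)

definition brick :: "('a \<Rightarrow> real) \<Rightarrow> ('a \<Rightarrow> real) \<Rightarrow> 'a set" where
  "brick l u = {x. \<forall>b\<in>B. l b \<le> x \<bullet> b \<and> x \<bullet> b \<le> u b}"

lemma closed_brick: "closed (brick l u)"
proof -
  have "brick l u = (\<Inter>b\<in>B. {x. l b \<le> x \<bullet> b} \<inter> {x. x \<bullet> b \<le> u b})" by (auto simp: brick_def)
  then show ?thesis
    by (auto intro!: closed_INT closed_Int closed_Collect_le continuous_intros)
qed

lemma bounded_brick: "bounded (brick l u)"
proof -
  have "norm x \<le> (\<Sum>b\<in>B. \<bar>l b\<bar> + \<bar>u b\<bar>)" if "x \<in> brick l u" for x
    using that by (intro order_trans[OF norm_le_sum] sum_mono) (force simp: brick_def)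
  then show ?thesis by (auto simp: bounded_iff)
qed

text \<open>
  Transports statements about the standard basis to the basis \<open>B\<close>.
\<close>

lemma ex_orthogonal_transformation:
  "\<exists>T :: 'a \<Rightarrow> 'a. orthogonal_transformation T \<and> bij_betw T Basis B"
proof -
  obtain g where g: "bij_betw g (Basis :: 'a set) B"
    using card_basis finite_same_card_bij[of "Basis :: 'a set" B] by auto
  define T where "T x = (\<Sum>e\<in>Basis. (x \<bullet> e) *\<^sub>R g e)" for x :: 'a
  have lin: "linear T"
    by (rule linearI) (simp_all add: T_def inner_left_distrib scaleR_left_distrib sum.distrib scaleR_sum_right)
  have "T x \<bullet> T y = x \<bullet> y" for x y
  proof -
    have "T x \<bullet> g e = x \<bullet> e" if "e \<in> Basis" for e
    proof -
      have "T x \<bullet> g e = (\<Sum>c\<in>Basis. if c = e then x \<bullet> c else 0)"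
        unfolding T_def inner_sum_left using g that
        by (intro sum.cong) (auto simp: inner_basis bij_betw_def inj_on_def split: if_splits)
      then show ?thesis using that by simp
    qed
    then have "T x \<bullet> T y = (\<Sum>e\<in>Basis. (y \<bullet> e) * (x \<bullet> e))"
      unfolding T_def[of y] by (simp add: inner_sum_right)
    then show ?thesis by (simp add: euclidean_inner[of x y] mult.commute)
  qed
  then have "orthogonal_transformation T" using lin by (simp add: orthogonal_transformation_def)
  moreover have "T e = g e" if "e \<in> Basis" for e
    using that by (simp add: T_def inner_Basis if_distrib[of "\<lambda>c. c *\<^sub>R _"] cong: if_cong)
  then have "bij_betw T Basis B" using g by (simp cong: bij_betw_cong)
  ultimately show ?thesis by blast
qed

lemma emeasure_brick:
  assumes lu: "\<And>b. b \<in> B \<Longrightarrow> l b \<le> u b"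
  shows "emeasure lborel (brick l u) = ennreal (\<Prod>b\<in>B. u b - l b)"
proof -
  obtain T :: "'a \<Rightarrow> 'a" where T: "orthogonal_transformation T" "bij_betw T Basis B"
    using ex_orthogonal_transformation by blast
  have [measurable]: "T \<in> borel_measurable borel"
    using T(1) by (intro borel_measurable_continuous_onI linear_continuous_on)
      (simp add: linear_linear orthogonal_transformation_linear)
  let ?l = "\<Sum>e\<in>Basis. l (T e) *\<^sub>R e" and ?u = "\<Sum>e\<in>Basis. u (T e) *\<^sub>R e"
  have "T -` brick l u = cbox ?l ?u"
  proof -
    have "x \<in> T -` brick l u \<longleftrightarrow> (\<forall>e\<in>Basis. l (T e) \<le> T x \<bullet> T e \<and> T x \<bullet> T e \<le> u (T e))" for x
      using T(2) by (auto simp: brick_def bij_betw_def)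
    then show ?thesis
      using T(1) by (auto simp: orthogonal_transformation_def mem_box)
  qed
  then have "emeasure lborel (brick l u) = emeasure lborel (cbox ?l ?u)"
    using emeasure_distr[of T lborel borel "brick l u"] distr_lborel_orthogonal[OF T(1)] closed_brick
    by simp
  also have "\<dots> = (\<Prod>e\<in>Basis. (?u - ?l) \<bullet> e)"
    using T(2) lu by (intro emeasure_lborel_cbox) (auto simp: bij_betw_def)
  also have "(\<Prod>e\<in>Basis. (?u - ?l) \<bullet> e) = (\<Prod>e\<in>Basis. u (T e) - l (T e))"
    by (intro prod.cong) (auto simp: inner_diff_left)
  also have "\<dots> = (\<Prod>b\<in>B. u b - l b)"
    by (rule prod.reindex_bij_betw[OF T(2)])
  finally show ?thesis .
qed

definition coord_space :: "'a set \<Rightarrow> 'a set" where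
  "coord_space J = {x. \<forall>b\<in>B - J. x \<bullet> b = 0}"

definition coord_proj :: "'a set \<Rightarrow> 'a \<Rightarrow> 'a" where
  "coord_proj J x = (\<Sum>b\<in>J. (x \<bullet> b) *\<^sub>R b)"

definition slab :: "'a set \<Rightarrow> 'a set" where
  "slab J = {x. \<forall>b\<in>B - J. 0 \<le> x \<bullet> b \<and> x \<bullet> b \<le> 1}"

text \<open>
  Lebesgue measure on the subspace spanned by \<open>J\<close>, realised as the shadow of the
  part of the ambient Lebesgue measure that lies in a slab of thickness 1 orthogonal to the
  subspace.
\<close>

definition coord_measure :: "'a set \<Rightarrow> 'a measure" where
  "coord_measure J = distr (restrict_space lborel (slab J)) borel (coord_proj J)"

text \<open>
  For \<open>J \<subseteq> B\<close> this is the unit cube of the subspace spanned by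
  \<open>J\<close>, with all coordinates outside \<open>J\<close> equal to 0.
\<close>

definition unit_brick :: "'a set \<Rightarrow> 'a set" where
  "unit_brick J = brick (\<lambda>_. 0) (\<lambda>b. if b \<in> J then 1 else 0)"

lemma subspace_coord_space: "subspace (coord_space J)"
  by (auto simp: subspace_def coord_space_def inner_left_distrib)

lemma closed_coord_space: "closed (coord_space J)"
  by (rule closed_subspace[OF subspace_coord_space])

lemma closed_slab: "closed (slab J)"
proof -
  have "slab J = (\<Inter>b\<in>B - J. {x. 0 \<le> x \<bullet> b} \<inter> {x. x \<bullet> b \<le> 1})" by (auto simp: slab_def)
  then show ?thesis
    by (auto intro!: closed_INT closed_Int closed_Collect_le continuous_intros)
qed

lemma measurable_slab [measurable]: "slab J \<in> sets borel"
  using closed_slab by (rule borel_closed)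

lemma continuous_on_coord_proj: "continuous_on S (coord_proj J)"
  unfolding coord_proj_def by (intro continuous_intros)

lemma measurable_coord_proj [measurable]: "coord_proj J \<in> borel_measurable borel"
  by (intro borel_measurable_continuous_onI continuous_on_coord_proj)

lemma inner_coord_proj:
  "J \<subseteq> B \<Longrightarrow> b \<in> B \<Longrightarrow> coord_proj J x \<bullet> b = (if b \<in> J then x \<bullet> b else 0)"
  by (simp add: coord_proj_def inner_sum_basis)

lemma coord_proj_in_space: "J \<subseteq> B \<Longrightarrow> coord_proj J x \<in> coord_space J"
  by (auto simp: coord_space_def inner_coord_proj)

lemma sets_coord_measure [simp, measurable_cong]: "sets (coord_measure J) = sets borel"
  by (simp add: coord_measure_def)

lemma emeasure_coord_measure:
  assumes "A \<in> sets borel"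
  shows "emeasure (coord_measure J) A = emeasure lborel (coord_proj J -` A \<inter> slab J)"
proof -
  have "coord_proj J \<in> borel_measurable (restrict_space lborel (slab J))"
    by (rule measurable_restrict_space1) simp
  then show ?thesis
    unfolding coord_measure_def using assms
    by (subst emeasure_distr) (auto simp: emeasure_restrict_space space_restrict_space)
qed

lemma nn_integral_coord_measure:
  assumes [measurable]: "g \<in> borel_measurable borel"
  shows "(\<integral>\<^sup>+x. g x \<partial>coord_measure J) = (\<integral>\<^sup>+x. g (coord_proj J x) * indicator (slab J) x \<partial>lborel)"
proof -
  have "coord_proj J \<in> borel_measurable (restrict_space lborel (slab J))"
    by (rule measurable_restrict_space1) simp
  then show ?thesis
    unfolding coord_measure_def
    by (subst nn_integral_distr) (auto simp: nn_integral_restrict_space)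
qed

lemma emeasure_coord_measure_brick:
  assumes J: "J \<subseteq> B" and lu: "\<And>b. b \<in> J \<Longrightarrow> l b \<le> u b"
    and z: "\<And>b. b \<in> B - J \<Longrightarrow> l b \<le> 0 \<and> 0 \<le> u b"
  shows "emeasure (coord_measure J) (brick l u) = ennreal (\<Prod>b\<in>J. u b - l b)"
proof -
  have "coord_proj J -` brick l u \<inter> slab J
      = brick (\<lambda>b. if b \<in> J then l b else 0) (\<lambda>b. if b \<in> J then u b else 1)"
    using J z by (auto simp: brick_def slab_def inner_coord_proj)
  then have "emeasure (coord_measure J) (brick l u)
      = emeasure lborel (brick (\<lambda>b. if b \<in> J then l b else 0) (\<lambda>b. if b \<in> J then u b else 1))"
    using closed_brick by (simp add: emeasure_coord_measure)
  also have "\<dots> = ennreal (\<Prod>b\<in>B. (if b \<in> J then u b else 1) - (if b \<in> J then l b else 0))"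
    using lu by (intro emeasure_brick) auto
  also have "(\<Prod>b\<in>B. (if b \<in> J then u b else 1) - (if b \<in> J then l b else 0)) = (\<Prod>b\<in>J. u b - l b)"
    using J by (intro prod.mono_neutral_cong_right) auto
  finally show ?thesis .
qed

lemma AE_coord_measure: 
  assumes J: "J \<subseteq> B"
  shows "AE x in coord_measure J. x \<in> coord_space J"
proof -
  have "{x. x \<notin> coord_space J} = - coord_space J" by auto
  moreover have "emeasure (coord_measure J) (- coord_space J) = 0"
    using closed_coord_space[of J] coord_proj_in_space[OF J]
    by (simp add: emeasure_coord_measure vimage_def)
  ultimately show ?thesis
    using closed_coord_space[of J]
    by (intro AE_I[where N = "- coord_space J"]) (auto simp: coord_measure_def)
qed

lemma UN_brick: "(\<Union>n::nat. brick (\<lambda>_. - real n) (\<lambda>_. real n)) = UNIV"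
proof -
  have "\<exists>n::nat. x \<in> brick (\<lambda>_. - real n) (\<lambda>_. real n)" for x
  proof -
    obtain n :: nat where "norm x \<le> real n" using real_arch_simple by blast
    then have "x \<in> brick (\<lambda>_. - real n) (\<lambda>_. real n)"
      using abs_inner_le[of _ x] by (force simp: brick_def abs_le_iff)
    then show ?thesis ..
  qed
  then show ?thesis by auto
qed

lemma sigma_finite_measureI_brick:
  assumes "sets M = sets borel"
    and "\<And>n::nat. emeasure M (brick (\<lambda>_. - real n) (\<lambda>_. real n)) \<noteq> \<infinity>"
  shows "sigma_finite_measure M"
proof
  show "\<exists>S. countable S \<and> S \<subseteq> sets M \<and> \<Union> S = space M \<and> (\<forall>a\<in>S. emeasure M a \<noteq> \<infinity>)"
    using assms UN_brick closed_brick
    by (intro exI[of _ "range (\<lambda>n::nat. brick (\<lambda>_. - real n) (\<lambda>_. real n))"])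
       (auto simp: sets_eq_imp_space_eq[OF assms(1)])
qed

lemma sigma_finite_coord_measure: "J \<subseteq> B \<Longrightarrow> sigma_finite_measure (coord_measure J)"
  by (rule sigma_finite_measureI_brick) (auto simp: emeasure_coord_measure_brick)

lemma coord_proj_add: "coord_proj J (x + y) = coord_proj J x + coord_proj J y"
  by (simp add: coord_proj_def inner_left_distrib scaleR_left_distrib sum.distrib)

lemma coord_proj_id:
  assumes "J \<subseteq> B" "x \<in> coord_space J"
  shows "coord_proj J x = x"
  by (rule eq_basisI) (use assms in \<open>auto simp: inner_coord_proj coord_space_def\<close>)

text \<open>
  A translation along the subspace preserves both the slab and Lebesgue measure.
\<close>

lemma coord_measure_translation:
  assumes J: "J \<subseteq> B" and y: "y \<in> coord_space J"
  shows "distr (coord_measure J) borel ((+) y) = coord_measure J"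
proof (rule measure_eqI)
  fix A assume "A \<in> sets (distr (coord_measure J) borel ((+) y))"
  then have A [measurable]: "A \<in> sets borel" by simp
  have shA: "(+) y -` A \<in> sets borel" using measurable_sets[of "(+) y" borel borel A] by simp
  let ?S = "coord_proj J -` A \<inter> slab J"
  have S: "?S \<in> sets borel" using measurable_sets[of "coord_proj J" borel borel A] by auto
  have "emeasure (distr (coord_measure J) borel ((+) y)) A = emeasure (coord_measure J) ((+) y -` A)"
    by (subst emeasure_distr) (auto simp: coord_measure_def)
  also have "\<dots> = emeasure lborel (coord_proj J -` ((+) y -` A) \<inter> slab J)"
    using shA by (rule emeasure_coord_measure)
  also have "coord_proj J -` ((+) y -` A) \<inter> slab J = (+) y -` ?S"
    using y J coord_proj_id[OF J y] by (auto simp: slab_def coord_space_def inner_left_distrib coord_proj_add)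
  also have "emeasure lborel ((+) y -` ?S) = emeasure (distr lborel borel ((+) y)) ?S"
    using S by (simp add: emeasure_distr)
  also have "\<dots> = emeasure (coord_measure J) A"
    by (simp add: lborel_distr_plus emeasure_coord_measure)
  finally show "emeasure (distr (coord_measure J) borel ((+) y)) A = emeasure (coord_measure J) A" .
qed simp

end

section \<open>Hausdorff measure on coordinate subspaces\<close>

lemma hausdorff_pre_finite_cover:
  assumes F: "finite F" "A \<subseteq> \<Union>F" and S: "\<And>S. S \<in> F \<Longrightarrow> bounded S \<and> diameter S \<le> \<delta>" and "0 \<le> \<delta>"
  shows "hausdorff_pre k \<delta> A \<le> (\<Sum>S\<in>F. hausdorff_weight k S)"
proof -
  obtain h where h: "bij_betw h {0..<card F} F" using ex_bij_betw_nat_finite[OF F(1)] by blast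
  define U where "U i = (if i < card F then h i else {})" for i
  have cov: "\<exists>i. x \<in> U i" if xA: "x \<in> A" for x
  proof -
    obtain S where S: "S \<in> F" "x \<in> S" using xA F(2) by blast
    have "S \<in> h ` {0..<card F}" using S(1) bij_betw_imp_surj_on[OF h] by simp
    then obtain i where "i < card F" "S = h i" by (elim imageE) simp
    then have "i < card F" "x \<in> h i" using S(2) by simp_all
    then show ?thesis by (intro exI[of _ i]) (simp add: U_def)
  qed
  have "bounded (U i) \<and> diameter (U i) \<le> \<delta>" for i
  proof (cases "i < card F")
    case True
    then have "h i \<in> F" using h by (auto simp: bij_betw_def)
    then show ?thesis using S True by (simp add: U_def)
  next
    case False
    then show ?thesis using \<open>0 \<le> \<delta>\<close> by (simp add: U_def diameter_def)
  qed
  then have "U \<in> hausdorff_covers \<delta> A" using cov by (auto simp: hausdorff_covers_def)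
  then have "hausdorff_pre k \<delta> A \<le> (\<Sum>i. hausdorff_weight k (U i))" by (rule hausdorff_pre_le_cover)
  also have "\<dots> = (\<Sum>i\<in>{0..<card F}. hausdorff_weight k (U i))"
    by (rule suminf_finite) (auto simp: U_def)
  also have "\<dots> = (\<Sum>i\<in>{0..<card F}. hausdorff_weight k (h i))"
    by (intro sum.cong) (auto simp: U_def)
  also have "\<dots> = (\<Sum>S\<in>F. hausdorff_weight k S)" by (rule sum.reindex_bij_betw[OF h])
  finally show ?thesis .
qed

lemma ex_nat_unit_interval:
  assumes "0 \<le> t" "t \<le> real N" "0 < N"
  shows "\<exists>m<N. real m \<le> t \<and> t \<le> real m + 1"
proof (cases "t = real N")
  case True
  then show ?thesis using assms by (intro exI[of _ "N - 1"]) auto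
next
  case False
  have "real (nat \<lfloor>t\<rfloor>) \<le> t" "t < real (nat \<lfloor>t\<rfloor>) + 1" using assms(1) by linarith+
  moreover have "nat \<lfloor>t\<rfloor> < N" using assms False by linarith
  ultimately show ?thesis by (intro exI[of _ "nat \<lfloor>t\<rfloor>"]) auto
qed

context orthonormal_basis
begin

text \<open>
  A cube with edge \<open>2 * R\<close> is cut into \<open>N ^ card J\<close> cells of edge
  \<open>s = 2 * R / N\<close>. A cell has diameter at most \<open>card J * s\<close>, so the
  powers of \<open>N\<close> cancel in the sum of the weights.
\<close>

lemma hausdorff_outer_cube_le:
  assumes J: "J \<subseteq> B" and R: "0 < R"
  shows "hausdorff_outer (card J) (brick (\<lambda>_. - R) (\<lambda>_. R) \<inter> coord_space J)
    \<le> ennreal (unit_ball_vol (real (card J)) * (real (card J) * R) ^ card J)"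
proof (rule hausdorff_outer_leI)
  fix \<delta> :: real assume "0 < \<delta>"
  define k where "k = card J"
  have fJ: "finite J" using J finite_basis by (rule finite_subset)
  obtain N0 :: nat where N0: "real k * 2 * R / \<delta> \<le> real N0" using real_arch_simple by blast
  define N where "N = Suc N0"
  define s where "s = 2 * R / real N"
  have s: "0 < s" "real N * s = 2 * R" "real k * s \<le> \<delta>"
  proof -
    have "real k * 2 * R \<le> real N * \<delta>" using N0 \<open>0 < \<delta>\<close> by (simp add: N_def divide_le_eq algebra_simps)
    then show "real k * s \<le> \<delta>" by (simp add: s_def N_def divide_le_eq algebra_simps)
  qed (use R in \<open>auto simp: s_def N_def\<close>)
  define cell where "cell g = {x \<in> coord_space J. \<forall>b\<in>J. s * real (g b) \<le> x \<bullet> b + R \<and> x \<bullet> b + R \<le> s * (real (g b) + 1)}" for g :: "'a \<Rightarrow> nat"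
  define F where "F = cell ` (J \<rightarrow>\<^sub>E {..<N})"
  have dist: "norm (x - y) \<le> real k * s" if xy: "x \<in> cell g" "y \<in> cell g" for x y g
  proof -
    have "norm (x - y) \<le> (\<Sum>b\<in>B. \<bar>(x - y) \<bullet> b\<bar>)" by (rule norm_le_sum)
    also have "\<dots> = (\<Sum>b\<in>J. \<bar>(x - y) \<bullet> b\<bar>)"
      using xy J by (intro sum.mono_neutral_right) (auto simp: cell_def coord_space_def inner_diff_left)
    also have "\<dots> \<le> (\<Sum>b\<in>J. s)"
    proof (rule sum_mono)
      fix b assume "b \<in> J"
      then have "s * real (g b) \<le> x \<bullet> b + R \<and> x \<bullet> b + R \<le> s * real (g b) + s"
        "s * real (g b) \<le> y \<bullet> b + R \<and> y \<bullet> b + R \<le> s * real (g b) + s"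
        using xy by (auto simp: cell_def algebra_simps)
      then show "\<bar>(x - y) \<bullet> b\<bar> \<le> s" by (simp add: inner_diff_left abs_le_iff)
    qed
    finally show ?thesis by (simp add: k_def)
  qed
  have cell: "bounded (cell g) \<and> diameter (cell g) \<le> real k * s" for g
  proof
    show "bounded (cell g)"
    proof (cases "cell g = {}")
      case False
      then obtain x where "x \<in> cell g" by blast
      then show ?thesis using dist unfolding bounded_def dist_norm by blast
    qed simp
    show "diameter (cell g) \<le> real k * s"
      using dist s by (intro diameter_le) auto
  qed
  have cov: "brick (\<lambda>_. - R) (\<lambda>_. R) \<inter> coord_space J \<subseteq> \<Union>F"
  proof
    fix x assume x: "x \<in> brick (\<lambda>_. - R) (\<lambda>_. R) \<inter> coord_space J"
    have "\<exists>m<N. real m \<le> (x \<bullet> b + R) / s \<and> (x \<bullet> b + R) / s \<le> real m + 1" if "b \<in> J" for b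
    proof (rule ex_nat_unit_interval)
      have "- R \<le> x \<bullet> b \<and> x \<bullet> b \<le> R" using x that J by (auto simp: brick_def)
      then show "0 \<le> (x \<bullet> b + R) / s" "(x \<bullet> b + R) / s \<le> real N" 
        using s by (auto simp: divide_le_eq)
    qed (simp add: N_def)
    then obtain g where g: "\<And>b. b \<in> J \<Longrightarrow> g b < N \<and> real (g b) \<le> (x \<bullet> b + R) / s \<and> (x \<bullet> b + R) / s \<le> real (g b) + 1"
      by metis
    have "x \<in> cell (restrict g J)"
      using x g s(1) by (auto simp: cell_def pos_le_divide_eq pos_divide_le_eq mult.commute)
    moreover have "restrict g J \<in> J \<rightarrow>\<^sub>E {..<N}" using g by auto
    ultimately show "x \<in> \<Union>F" unfolding F_def by blast
  qed
  have finF: "finite F" unfolding F_def using fJ by (intro finite_imageI finite_PiE) auto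
  let ?w = "unit_ball_vol (real k) * (real k * s / 2) ^ k"
  have "hausdorff_pre k \<delta> (brick (\<lambda>_. - R) (\<lambda>_. R) \<inter> coord_space J) \<le> (\<Sum>S\<in>F. hausdorff_weight k S)"
  proof (rule hausdorff_pre_finite_cover[OF finF cov])
    show "bounded S \<and> diameter S \<le> \<delta>" if SF: "S \<in> F" for S
    proof -
      obtain g where "S = cell g" using SF by (auto simp: F_def)
      then show ?thesis using cell[of g] s(3) by simp
    qed
  qed (use \<open>0 < \<delta>\<close> in simp)
  also have "\<dots> \<le> of_nat (card F) * ennreal ?w"
  proof (rule sum_bounded_above)
    fix S assume "S \<in> F"
    then obtain g where "S = cell g" by (auto simp: F_def)
    then have "0 \<le> diameter S" "diameter S \<le> real k * s"
      using cell[of g] diameter_ge_0[of "cell g"] by simp_all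
    then have "unit_ball_vol (real k) * (diameter S / 2) ^ k \<le> ?w"
      by (intro mult_left_mono power_mono) simp_all
    then show "hausdorff_weight k S \<le> ennreal ?w"
      by (simp add: hausdorff_weight_def ennreal_leI)
  qed
  also have "\<dots> \<le> of_nat (N ^ k) * ennreal ?w"
  proof -
    have "card F \<le> card (J \<rightarrow>\<^sub>E {..<N})" unfolding F_def using fJ by (intro card_image_le finite_PiE) auto
    also have "\<dots> = N ^ k" using fJ by (simp add: card_PiE k_def)
    finally show ?thesis by (intro mult_right_mono of_nat_mono) auto
  qed
  also have "\<dots> = ennreal (real (N ^ k) * ?w)"
    unfolding ennreal_of_nat_eq_real_of_nat using s(1) by (intro ennreal_mult[symmetric]) auto
  also have "real (N ^ k) * ?w = unit_ball_vol (real k) * (real N * (real k * s / 2)) ^ k"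
    by (simp only: power_mult_distrib of_nat_power mult_ac)
  also have "real N * (real k * s / 2) = real k * (real N * s) / 2" by simp
  also have "\<dots> = real k * R" by (simp add: s(2))
  finally show "hausdorff_pre (card J) \<delta> (brick (\<lambda>_. - R) (\<lambda>_. R) \<inter> coord_space J)
    \<le> ennreal (unit_ball_vol (real (card J)) * (real (card J) * R) ^ card J)" by (simp add: k_def)
qed

lemma measurable_unit_brick: "unit_brick J \<in> sets borel"
  unfolding unit_brick_def by (intro borel_closed closed_brick)

lemma unit_brick_subset_coord_space: "J \<subseteq> B \<Longrightarrow> unit_brick J \<subseteq> coord_space J"
  by (auto simp: unit_brick_def brick_def coord_space_def)

lemma emeasure_coord_measure_unit_brick: "J \<subseteq> B \<Longrightarrow> emeasure (coord_measure J) (unit_brick J) = 1"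
  unfolding unit_brick_def by (subst emeasure_coord_measure_brick) auto

lemma hausdorff_outer_unit_brick_finite:
  assumes J: "J \<subseteq> B"
  shows "hausdorff_outer (card J) (unit_brick J) < \<infinity>"
proof -
  have "unit_brick J \<subseteq> brick (\<lambda>_. - 1) (\<lambda>_. 1) \<inter> coord_space J"
  proof
    fix x assume x: "x \<in> unit_brick J"
    have "- 1 \<le> x \<bullet> b \<and> x \<bullet> b \<le> 1" if "b \<in> B" for b
    proof -
      have "0 \<le> x \<bullet> b \<and> x \<bullet> b \<le> (if b \<in> J then 1 else 0)"
        using x that by (auto simp: unit_brick_def brick_def)
      then show ?thesis by (auto split: if_splits)
    qed
    then show "x \<in> brick (\<lambda>_. - 1) (\<lambda>_. 1) \<inter> coord_space J"
      using x unit_brick_subset_coord_space[OF J] by (auto simp: brick_def)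
  qed
  then have "hausdorff_outer (card J) (unit_brick J)
      \<le> ennreal (unit_ball_vol (real (card J)) * (real (card J) * 1) ^ card J)"
    using hausdorff_outer_cube_le[OF J, of 1] hausdorff_outer_mono order_trans zero_less_one by blast
  also have "\<dots> < \<infinity>" by simp
  finally show ?thesis .
qed

text \<open>
  The part in the subspace of a set of diameter \<open>d\<close> lies in a cube of edge \<open>2
  * d\<close>, whose Lebesgue measure is a fixed multiple of the Hausdorff weight of the set. So
  the weights of a cover sum up to at least a multiple of the Lebesgue measure of what is
  covered.
\<close>

lemma hausdorff_outer_unit_brick_pos:
  assumes J: "J \<subseteq> B"
  shows "0 < hausdorff_outer (card J) (unit_brick J)"
proof -
  define k where "k = card J"
  define c where "c = unit_ball_vol (real k) / 4 ^ k"
  have c: "0 < c" by (simp add: c_def)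
  have "ennreal c \<le> hausdorff_pre k 1 (unit_brick J)"
    unfolding hausdorff_pre_def
  proof (rule INF_greatest)
    fix U assume U: "U \<in> hausdorff_covers 1 (unit_brick J)"
    define p where "p i = (SOME x. x \<in> U i)" for i
    define V where "V i = (if U i = {} then {} else
      brick (\<lambda>b. if b \<in> J then p i \<bullet> b - diameter (U i) else 0)
            (\<lambda>b. if b \<in> J then p i \<bullet> b + diameter (U i) else 0))" for i
    have bd: "bounded (U i)" for i using U by (simp add: hausdorff_covers_def)
    have V: "ennreal c * emeasure (coord_measure J) (V i) = hausdorff_weight k (U i)" for i
    proof (cases "U i = {}")
      case False
      have d: "0 \<le> diameter (U i)" using bd by (rule diameter_ge_0)
      have "emeasure (coord_measure J) (V i)
          = ennreal (\<Prod>b\<in>J. (if b \<in> J then p i \<bullet> b + diameter (U i) else 0)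
              - (if b \<in> J then p i \<bullet> b - diameter (U i) else 0))"
        using False d by (simp only: V_def if_False) (intro emeasure_coord_measure_brick[OF J], auto)
      also have "(\<Prod>b\<in>J. (if b \<in> J then p i \<bullet> b + diameter (U i) else 0)
              - (if b \<in> J then p i \<bullet> b - diameter (U i) else 0)) = (2 * diameter (U i)) ^ k"
        by (simp add: k_def)
      finally have "ennreal c * emeasure (coord_measure J) (V i)
          = ennreal (c * (2 * diameter (U i)) ^ k)"
        using c d by (simp only: ennreal_mult zero_le_power mult_nonneg_nonneg zero_le_numeral less_imp_le)
      also have "c * (2 * diameter (U i)) ^ k = unit_ball_vol (real k) * ((2 * diameter (U i)) ^ k / 4 ^ k)"
        by (simp add: c_def)
      also have "(2 * diameter (U i)) ^ k / 4 ^ k = (2 * diameter (U i) / 4) ^ k"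
        by (rule power_divide[symmetric])
      also have "2 * diameter (U i) / 4 = diameter (U i) / 2" by simp
      finally show ?thesis using False by (simp only: hausdorff_weight_def if_False)
    qed (simp add: V_def)
    have sub: "unit_brick J \<subseteq> (\<Union>i. V i)"
    proof
      fix x assume x: "x \<in> unit_brick J"
      then obtain i where i: "x \<in> U i" using hausdorff_coversD[OF U] by blast
      then have "p i \<in> U i" unfolding p_def by (rule someI)
      then have "dist x (p i) \<le> diameter (U i)" using i bd by (intro diameter_bounded_bound)
      then have "\<bar>x \<bullet> b - p i \<bullet> b\<bar> \<le> diameter (U i)" if "b \<in> B" for b
        using abs_inner_le[OF that, of "x - p i"] by (simp add: dist_norm inner_diff_left)
      moreover have "x \<bullet> b = 0" if "b \<in> B" "b \<notin> J" for b
        using that x unit_brick_subset_coord_space[OF J] by (auto simp: coord_space_def)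
      ultimately have "x \<in> V i" using i by (auto simp: V_def brick_def abs_le_iff algebra_simps)
      then show "x \<in> (\<Union>i. V i)" by blast
    qed
    have Vs: "range V \<subseteq> sets (coord_measure J)" using closed_brick by (auto simp: V_def)
    have "1 \<le> emeasure (coord_measure J) (\<Union>i. V i)"
      using sub emeasure_coord_measure_unit_brick[OF J] Vs by (metis emeasure_mono sets.countable_UN)
    also have "\<dots> \<le> (\<Sum>i. emeasure (coord_measure J) (V i))"
      using Vs by (rule emeasure_subadditive_countably)
    finally have "ennreal c * 1 \<le> ennreal c * (\<Sum>i. emeasure (coord_measure J) (V i))"
      by (rule mult_left_mono) simp
    also have "\<dots> = (\<Sum>i. hausdorff_weight k (U i))"
      by (simp add: V flip: ennreal_suminf_cmult)
    finally show "ennreal c \<le> (\<Sum>i. hausdorff_weight k (U i))" by simp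
  qed
  also have "\<dots> \<le> hausdorff_outer k (unit_brick J)" by (rule hausdorff_pre_le_outer) simp
  finally show ?thesis using c by (simp add: k_def less_le_trans[of 0 "ennreal c"] ennreal_less_zero_iff)
qed

text \<open>
  Hausdorff measure restricted to the subspace is translation invariant along the subspace and
  finite on bounded sets, hence a multiple of Lebesgue measure.
\<close>

theorem hausdorff_outer_eq_coord_measure:
  assumes J: "J \<subseteq> B" and A: "A \<in> sets borel" "A \<subseteq> coord_space J"
  shows "hausdorff_outer (card J) A
    = hausdorff_outer (card J) (unit_brick J) * emeasure (coord_measure J) A"
proof -
  define k where "k = card J"
  let ?Y = "coord_space J"
  define H where "H = density (hausdorff_measure k) (indicator ?Y)"
  have Y: "?Y \<in> sets borel" using closed_coord_space by (rule borel_closed)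
  have sets_H: "sets H = sets borel" by (simp add: H_def)
  have em: "emeasure H S = hausdorff_outer k (?Y \<inter> S)" if "S \<in> sets borel" for S
    using that Y by (simp add: H_def emeasure_restricted emeasure_hausdorff_measure)
  have "emeasure H A * emeasure (coord_measure J) (unit_brick J)
      = emeasure (coord_measure J) A * emeasure H (unit_brick J)"
  proof (rule translation_invariant_measure_unique[where Y = ?Y])
    show "sigma_finite_measure H"
    proof (rule sigma_finite_measureI_brick[OF sets_H])
      fix n :: nat
      have "?Y \<inter> brick (\<lambda>_. - real n) (\<lambda>_. real n) \<subseteq> brick (\<lambda>_. - real (Suc n)) (\<lambda>_. real (Suc n)) \<inter> ?Y"
      proof
        fix x assume x: "x \<in> ?Y \<inter> brick (\<lambda>_. - real n) (\<lambda>_. real n)"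
        have "- real (Suc n) \<le> x \<bullet> b \<and> x \<bullet> b \<le> real (Suc n)" if "b \<in> B" for b
        proof -
          have "- real n \<le> x \<bullet> b \<and> x \<bullet> b \<le> real n" using x that by (auto simp: brick_def)
          then show ?thesis by simp
        qed
        then show "x \<in> brick (\<lambda>_. - real (Suc n)) (\<lambda>_. real (Suc n)) \<inter> ?Y"
          using x by (auto simp: brick_def)
      qed
      then have "hausdorff_outer k (?Y \<inter> brick (\<lambda>_. - real n) (\<lambda>_. real n)) < \<infinity>"
        using hausdorff_outer_cube_le[OF J, of "real (Suc n)"] hausdorff_outer_mono
        unfolding k_def by (metis ennreal_less_top infinity_ennreal_def le_less_trans of_nat_0_less_iff zero_less_Suc)
      then show "emeasure H (brick (\<lambda>_. - real n) (\<lambda>_. real n)) \<noteq> \<infinity>"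
        using closed_brick by (simp add: em)
    qed
    show "AE x in H. x \<in> ?Y"
      unfolding H_def using Y by (subst AE_density) (auto intro!: AE_I2 split: split_indicator_asm)
    show "distr H borel ((+) y) = H" if y: "y \<in> ?Y" for y
    proof (rule measure_eqI)
      fix S assume "S \<in> sets (distr H borel ((+) y))"
      then have S: "S \<in> sets borel" by simp
      have shS: "(+) y -` S \<in> sets borel" using measurable_sets[of "(+) y" borel borel S] S by simp
      have "emeasure (distr H borel ((+) y)) S = emeasure H ((+) y -` S)"
        using S sets_eq_imp_space_eq[OF sets_H] 
        by (subst emeasure_distr) (auto simp: measurable_cong_sets[OF sets_H refl])
      also have "\<dots> = hausdorff_outer k (?Y \<inter> (+) y -` S)" using shS by (rule em)
      also have "\<dots> = hausdorff_outer k ((+) y ` (?Y \<inter> (+) y -` S))"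
        by (rule hausdorff_outer_isometry_image[symmetric]) (simp add: dist_norm)
      also have "(+) y ` (?Y \<inter> (+) y -` S) = ?Y \<inter> S"
      proof
        show "(+) y ` (?Y \<inter> (+) y -` S) \<subseteq> ?Y \<inter> S"
          using y subspace_add[OF subspace_coord_space] by auto
        show "?Y \<inter> S \<subseteq> (+) y ` (?Y \<inter> (+) y -` S)"
        proof
          fix x assume "x \<in> ?Y \<inter> S"
          then have "x - y \<in> ?Y \<inter> (+) y -` S" using y subspace_diff[OF subspace_coord_space] by auto
          then show "x \<in> (+) y ` (?Y \<inter> (+) y -` S)" by (metis add_diff_cancel_left' diff_add_cancel add.commute image_eqI)
        qed
      qed
      finally show "emeasure (distr H borel ((+) y)) S = emeasure H S" using S by (simp add: em)
    qed (simp add: sets_H)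
  qed (use J A closed_brick in \<open>auto simp: sets_H subspace_coord_space AE_coord_measure
        sigma_finite_coord_measure coord_measure_translation emeasure_coord_measure_unit_brick
        measurable_unit_brick\<close>)
  moreover have "emeasure H (unit_brick J) = hausdorff_outer k (unit_brick J)"
    using unit_brick_subset_coord_space[OF J] closed_brick by (simp add: em Int_absorb1 unit_brick_def)
  moreover have "emeasure H A = hausdorff_outer k A" using A by (simp add: em Int_absorb1)
  ultimately show ?thesis using J by (simp add: emeasure_coord_measure_unit_brick k_def mult.commute)
qed

text \<open>
  A bijection between the two sets of basis vectors extends to an isometry of the cubes. So the
  proportionality factor is the same for all coordinate hyperplanes.
\<close>

lemma hausdorff_outer_unit_brick_cong:
  assumes J: "J \<subseteq> B" "J' \<subseteq> B" and card: "card J = card J'"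
  shows "hausdorff_outer k (unit_brick J) = hausdorff_outer k (unit_brick J')"
proof -
  have "finite J" "finite J'" using J finite_subset[OF _ finite_basis] by auto
  then obtain \<sigma> where \<sigma>: "bij_betw \<sigma> J J'" using card finite_same_card_bij by blast
  define f where "f x = (\<Sum>b\<in>J. (x \<bullet> b) *\<^sub>R \<sigma> b)" for x
  have f\<sigma>: "f x \<bullet> \<sigma> b = x \<bullet> b" if "b \<in> J" for x b
  proof -
    have "f x \<bullet> \<sigma> b = (\<Sum>c\<in>J. if c = b then x \<bullet> c else 0)"
      unfolding f_def inner_sum_left using \<sigma> that J
      by (intro sum.cong) (auto simp: inner_basis bij_betw_def inj_on_def subset_iff split: if_splits)
    then show ?thesis using that \<open>finite J\<close> by simp
  qed
  have f0: "f x \<bullet> b = 0" if "b \<in> B - J'" for x b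
    unfolding f_def inner_sum_left using \<sigma> that J
    by (intro sum.neutral) (auto simp: inner_basis bij_betw_def subset_iff split: if_splits)
  have iso: "dist (f x) (f y) = dist x y" if xy: "x \<in> coord_space J" "y \<in> coord_space J" for x y
  proof -
    have d: "f x - f y = f (x - y)"
      by (simp add: f_def inner_diff_left scaleR_left_diff_distrib sum_subtractf)
    have "f z \<bullet> f z = z \<bullet> z" if "z \<in> coord_space J" for z
    proof -
      have "f z \<bullet> f z = (\<Sum>b\<in>J. (z \<bullet> b) * (f z \<bullet> \<sigma> b))"
        by (subst (2) f_def) (simp add: inner_sum_right)
      also have "\<dots> = (\<Sum>b\<in>J. (z \<bullet> b) * (z \<bullet> b))" by (simp add: f\<sigma>)
      also have "\<dots> = (\<Sum>b\<in>B. (z \<bullet> b) * (z \<bullet> b))"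
        using that J by (intro sum.mono_neutral_left) (auto simp: coord_space_def)
      finally show ?thesis by (simp only: inner_eq_sum[of z z])
    qed
    then show ?thesis
      using subspace_diff[OF subspace_coord_space xy] by (simp add: dist_norm d norm_eq_sqrt_inner)
  qed
  have "f ` unit_brick J = unit_brick J'"
  proof
    show "f ` unit_brick J \<subseteq> unit_brick J'"
    proof
      fix y assume "y \<in> f ` unit_brick J"
      then obtain x where x: "x \<in> unit_brick J" "y = f x" by blast
      have "0 \<le> y \<bullet> b \<and> y \<bullet> b \<le> 1" if bJ: "b \<in> J'" for b
      proof -
        obtain c where c: "c \<in> J" "b = \<sigma> c" using \<sigma> bJ by (auto simp: bij_betw_def)
        then have "c \<in> B" using J by blast
        then have "0 \<le> x \<bullet> c \<and> x \<bullet> c \<le> (if c \<in> J then 1 else 0)"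
          using x(1) by (simp add: unit_brick_def brick_def)
        then have "0 \<le> x \<bullet> c \<and> x \<bullet> c \<le> 1" using c by simp
        then show ?thesis using c x(2) f\<sigma> by simp
      qed
      then show "y \<in> unit_brick J'" using f0 x by (auto simp: unit_brick_def brick_def)
    qed
    show "unit_brick J' \<subseteq> f ` unit_brick J"
    proof
      fix y assume y: "y \<in> unit_brick J'"
      define x where "x = (\<Sum>b\<in>J. (y \<bullet> \<sigma> b) *\<^sub>R b)"
      have x: "x \<bullet> b = (if b \<in> J then y \<bullet> \<sigma> b else 0)" if "b \<in> B" for b
        unfolding x_def by (rule inner_sum_basis[OF J(1) that])
      have "x \<in> unit_brick J"
        unfolding unit_brick_def brick_def
      proof (intro CollectI ballI)
        fix b assume b: "b \<in> B"
        show "0 \<le> x \<bullet> b \<and> x \<bullet> b \<le> (if b \<in> J then 1 else 0)"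
        proof (cases "b \<in> J")
          case True
          then have "\<sigma> b \<in> J'" using \<sigma> by (auto simp: bij_betw_def)
          moreover from this have "\<sigma> b \<in> B" using J by blast
          then have "0 \<le> y \<bullet> \<sigma> b \<and> y \<bullet> \<sigma> b \<le> (if \<sigma> b \<in> J' then 1 else 0)"
            using y by (simp add: unit_brick_def brick_def)
          ultimately show ?thesis using True x[OF b] by simp
        qed (simp add: x[OF b])
      qed
      moreover have "f x = y"
      proof (rule eq_basisI)
        fix b assume b: "b \<in> B"
        show "f x \<bullet> b = y \<bullet> b"
        proof (cases "b \<in> J'")
          case True
          then obtain c where c: "c \<in> J" "b = \<sigma> c" using \<sigma> by (auto simp: bij_betw_def)
          then have "c \<in> B" using J by blast
          then show ?thesis using c by (simp add: x f\<sigma>)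
        next
          case False
          then have "y \<bullet> b = 0" using b y by (force simp: unit_brick_def brick_def)
          then show ?thesis using False b by (simp add: f0)
        qed
      qed
      ultimately show "y \<in> f ` unit_brick J" by blast
    qed
  qed
  then have "hausdorff_outer k (unit_brick J') = hausdorff_outer k (f ` unit_brick J)" by simp
  also have "\<dots> = hausdorff_outer k (unit_brick J)"
    using unit_brick_subset_coord_space[OF J(1)] iso by (intro hausdorff_outer_isometry_image) auto
  finally show ?thesis ..
qed

end

section \<open>Slicing along a direction\<close>

text \<open>
  The one-dimensional Hermite-Hadamard inequality. Averaging the integral with its reflection
  replaces \<open>\<phi> t\<close> by half of \<open>\<phi> t + \<phi> (a + b - t)\<close>, and
  this sum is at most \<open>\<phi> a + \<phi> b\<close> by convexity.
\<close>

lemma nn_integral_convex_le_endpoints: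
  fixes \<phi> :: "real \<Rightarrow> real"
  assumes ab: "a < b" and conv: "convex_on {a..b} \<phi>" and nonneg: "\<And>t. t \<in> {a..b} \<Longrightarrow> 0 \<le> \<phi> t"
    and meas [measurable]: "(\<lambda>t. ennreal (\<phi> t) * indicator {a<..<b} t) \<in> borel_measurable borel"
  shows "(\<integral>\<^sup>+t. ennreal (\<phi> t) * indicator {a<..<b} t \<partial>lborel) \<le> ennreal ((b - a) / 2 * (\<phi> a + \<phi> b))"
proof -
  let ?I = "\<integral>\<^sup>+t. ennreal (\<phi> t) * indicator {a<..<b} t \<partial>lborel"
  have refl: "?I = (\<integral>\<^sup>+t. ennreal (\<phi> (a + b - t)) * indicator {a<..<b} t \<partial>lborel)"
  proof -
    have "?I = (\<integral>\<^sup>+t. ennreal (\<phi> (a + b + (-1) * t)) * indicator {a<..<b} (a + b + (-1) * t) \<partial>lborel)"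
      using nn_integral_real_affine[OF meas, of "-1" "a + b"] by simp
    also have "\<dots> = (\<integral>\<^sup>+t. ennreal (\<phi> (a + b - t)) * indicator {a<..<b} t \<partial>lborel)"
      by (intro nn_integral_cong) (auto simp: indicator_def)
    finally show ?thesis .
  qed
  have meas': "(\<lambda>t. ennreal (\<phi> (a + b - t)) * indicator {a<..<b} t) \<in> borel_measurable lborel"
  proof -
    have "(\<lambda>t. ennreal (\<phi> (a + b - t)) * indicator {a<..<b} (a + b - t)) \<in> borel_measurable borel"
      by (rule measurable_compose[OF _ meas, of "\<lambda>t. a + b - t"]) simp
    moreover have "indicator {a<..<b} (a + b - t) = (indicator {a<..<b} t :: ennreal)" for t
      by (auto simp: indicator_def)
    ultimately show ?thesis by simp
  qed
  have "?I + ?I = (\<integral>\<^sup>+t. ennreal (\<phi> t) * indicator {a<..<b} t + ennreal (\<phi> (a + b - t)) * indicator {a<..<b} t \<partial>lborel)"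
    using meas meas' by (subst (2) refl) (simp add: nn_integral_add)
  also have "\<dots> \<le> (\<integral>\<^sup>+t. ennreal (\<phi> a + \<phi> b) * indicator {a<..<b} t \<partial>lborel)"
  proof (rule nn_integral_mono)
    fix t
    show "ennreal (\<phi> t) * indicator {a<..<b} t + ennreal (\<phi> (a + b - t)) * indicator {a<..<b} t
        \<le> ennreal (\<phi> a + \<phi> b) * indicator {a<..<b} t"
    proof (cases "t \<in> {a<..<b}")
      case True
      define s where "s = (t - a) / (b - a)"
      have s: "0 \<le> s" "s \<le> 1" using True by (auto simp: s_def)
      have "s * (b - a) = t - a" using ab by (simp add: s_def)
      then have t: "(1 - s) * a + s * b = t" "(1 - (1 - s)) * a + (1 - s) * b = a + b - t"
        by (simp_all add: algebra_simps)
      have "\<phi> t \<le> (1 - s) * \<phi> a + s * \<phi> b" "\<phi> (a + b - t) \<le> (1 - (1 - s)) * \<phi> a + (1 - s) * \<phi> b"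
        using convex_onD[OF conv, of s a b] convex_onD[OF conv, of "1 - s" a b] s ab
        by (simp_all only: t real_scaleR_def) simp_all
      then have "\<phi> t + \<phi> (a + b - t) \<le> \<phi> a + \<phi> b" by (simp add: algebra_simps)
      then have "ennreal (\<phi> t + \<phi> (a + b - t)) \<le> ennreal (\<phi> a + \<phi> b)" by (rule ennreal_leI)
      moreover have "ennreal (\<phi> t + \<phi> (a + b - t)) = ennreal (\<phi> t) + ennreal (\<phi> (a + b - t))"
        using True by (intro ennreal_plus nonneg) auto
      ultimately show ?thesis using True by simp
    qed simp
  qed
  also have "\<dots> = ennreal (\<phi> a + \<phi> b) * ennreal (b - a)"
    using ab by (subst nn_integral_cmult_indicator) auto
  also have "\<dots> = ennreal ((\<phi> a + \<phi> b) * (b - a))"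
    using ab nonneg[of a] nonneg[of b] by (intro ennreal_mult[symmetric]) auto
  also have "(\<phi> a + \<phi> b) * (b - a) = (b - a) / 2 * (\<phi> a + \<phi> b) + (b - a) / 2 * (\<phi> a + \<phi> b)"
    by (simp add: field_simps)
  also have "ennreal \<dots> = ennreal ((b - a) / 2 * (\<phi> a + \<phi> b)) + ennreal ((b - a) / 2 * (\<phi> a + \<phi> b))"
    using ab nonneg[of a] nonneg[of b] by (intro ennreal_plus) auto
  finally have "2 * ?I \<le> 2 * ennreal ((b - a) / 2 * (\<phi> a + \<phi> b))" by (simp only: mult_2)
  then show ?thesis by (subst (asm) ennreal_mult_le_mult_iff) auto
qed

lemma open_convex_bounded_real:
  fixes S :: "real set"
  assumes S: "open S" "convex S" "bounded S" "S \<noteq> {}"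
  shows "Inf S < Sup S" "S = {Inf S<..<Sup S}"
proof -
  have bdd: "bdd_above S" "bdd_below S"
    using S(3) by (auto intro: bounded_imp_bdd_above bounded_imp_bdd_below)
  have "x < Sup S" "Inf S < x" if x: "x \<in> S" for x
  proof -
    obtain r where r: "0 < r" "ball x r \<subseteq> S" using S(1) x by (auto simp: open_contains_ball)
    then have "x + r / 2 \<in> S" "x - r / 2 \<in> S" by (auto simp: subset_iff dist_real_def)
    then have "x + r / 2 \<le> Sup S" "Inf S \<le> x - r / 2"
      using bdd by (auto intro: cSup_upper cInf_lower)
    then show "x < Sup S" "Inf S < x" using r(1) by linarith+
  qed
  moreover have "x \<in> S" if x: "Inf S < x" "x < Sup S" for x
  proof -
    obtain p where "p \<in> S" "p < x" using cInf_lessD[OF S(4)] x(1) by blast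
    moreover obtain q where "q \<in> S" "x < q" using less_cSupD[OF S(4)] x(2) by blast
    ultimately have pq: "p \<in> S" "p \<le> x" "q \<in> S" "x \<le> q" by simp_all
    have "is_interval S" using S(2) by (simp add: is_interval_convex_1)
    then show ?thesis using pq unfolding is_interval_1 by blast
  qed
  ultimately show "S = {Inf S<..<Sup S}" "Inf S < Sup S"
    using S(4) by (auto intro: less_trans)
qed

context orthonormal_basis
begin

lemma slab_hyperplane: "e \<in> B \<Longrightarrow> slab (B - {e}) = {x. 0 \<le> x \<bullet> e \<and> x \<bullet> e \<le> 1}"
  by (auto simp: slab_def)

lemma coord_proj_hyperplane:
  assumes "e \<in> B" shows "coord_proj (B - {e}) x = x - (x \<bullet> e) *\<^sub>R e"
  by (rule eq_basisI) (use assms in \<open>auto simp: inner_coord_proj inner_diff_left inner_basis\<close>)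

lemma coord_space_hyperplane: "e \<in> B \<Longrightarrow> coord_space (B - {e}) = {x. x \<bullet> e = 0}"
  by (auto simp: coord_space_def)

text \<open>
  Fubini's theorem for lines in the direction \<open>e\<close>. A point of the slab \<open>0
  \<le> x \<bullet> e \<le> 1\<close> may be used in place of its projection, because the
  integral over the line through it is the same. After exchanging the integrals and shifting by
  \<open>t *\<^sub>R e\<close>, the point \<open>x\<close> is counted for all \<open>t\<close>
  in an interval of length 1.
\<close>

theorem nn_integral_lborel_slices:
  assumes e: "e \<in> B" and g [measurable]: "g \<in> borel_measurable borel"
  shows "(\<integral>\<^sup>+x. g x \<partial>lborel) = (\<integral>\<^sup>+y. (\<integral>\<^sup>+t. g (y + t *\<^sub>R e) \<partial>(lborel :: real measure)) \<partial>coord_measure (B - {e}))"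
proof -
  let ?S = "slab (B - {e})"
  have inner_meas: "(\<lambda>y. \<integral>\<^sup>+t. g (y + t *\<^sub>R e) \<partial>(lborel :: real measure)) \<in> borel_measurable borel"
    by measurable
  have "(\<integral>\<^sup>+y. (\<integral>\<^sup>+t. g (y + t *\<^sub>R e) \<partial>(lborel :: real measure)) \<partial>coord_measure (B - {e}))
      = (\<integral>\<^sup>+x. (\<integral>\<^sup>+t. g (coord_proj (B - {e}) x + t *\<^sub>R e) \<partial>(lborel :: real measure)) * indicator ?S x \<partial>lborel)"
    by (rule nn_integral_coord_measure[OF inner_meas])
  also have "\<dots> = (\<integral>\<^sup>+x. (\<integral>\<^sup>+t. g (t *\<^sub>R e + x) * indicator ?S x \<partial>(lborel :: real measure)) \<partial>lborel)"
  proof (rule nn_integral_cong)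
    fix x :: 'a
    have "(\<integral>\<^sup>+t. g (coord_proj (B - {e}) x + t *\<^sub>R e) \<partial>(lborel :: real measure))
        = (\<integral>\<^sup>+t. g (coord_proj (B - {e}) x + ((x \<bullet> e) + 1 * t) *\<^sub>R e) \<partial>(lborel :: real measure))"
      by (subst nn_integral_real_affine[of _ 1 "x \<bullet> e"]) auto
    also have "\<dots> = (\<integral>\<^sup>+t. g (t *\<^sub>R e + x) \<partial>(lborel :: real measure))"
      using e by (intro nn_integral_cong arg_cong[where f = g]) (simp add: coord_proj_hyperplane algebra_simps)
    finally show "(\<integral>\<^sup>+t. g (coord_proj (B - {e}) x + t *\<^sub>R e) \<partial>(lborel :: real measure)) * indicator ?S x
      = (\<integral>\<^sup>+t. g (t *\<^sub>R e + x) * indicator ?S x \<partial>(lborel :: real measure))"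
      by (simp add: nn_integral_multc)
  qed
  also have "\<dots> = (\<integral>\<^sup>+t. (\<integral>\<^sup>+x. g (t *\<^sub>R e + x) * indicator ?S x \<partial>lborel) \<partial>(lborel :: real measure))"
    by (rule lborel_pair.Fubini'[symmetric]) measurable
  also have "\<dots> = (\<integral>\<^sup>+t. (\<integral>\<^sup>+x. g x * indicator {x \<bullet> e - 1..x \<bullet> e} t \<partial>lborel) \<partial>(lborel :: real measure))"
  proof (rule nn_integral_cong)
    fix t :: real
    define h where "h x = g x * indicator ?S (x - t *\<^sub>R e)" for x
    have [measurable]: "h \<in> borel_measurable borel" unfolding h_def by measurable
    have "(\<integral>\<^sup>+x. g (t *\<^sub>R e + x) * indicator ?S x \<partial>lborel) = (\<integral>\<^sup>+x. h (t *\<^sub>R e + x) \<partial>lborel)"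
      by (simp add: h_def)
    also have "\<dots> = (\<integral>\<^sup>+x. h x \<partial>distr lborel borel ((+) (t *\<^sub>R e)))"
      by (simp add: nn_integral_distr)
    also have "\<dots> = (\<integral>\<^sup>+x. h x \<partial>lborel)" by (simp add: lborel_distr_plus)
    also have "\<dots> = (\<integral>\<^sup>+x. g x * indicator {x \<bullet> e - 1..x \<bullet> e} t \<partial>lborel)"
      using e by (intro nn_integral_cong)
        (auto simp: h_def slab_hyperplane inner_diff_left inner_basis indicator_def)
    finally show "(\<integral>\<^sup>+x. g (t *\<^sub>R e + x) * indicator ?S x \<partial>lborel)
      = (\<integral>\<^sup>+x. g x * indicator {x \<bullet> e - 1..x \<bullet> e} t \<partial>lborel)" .
  qed
  also have "\<dots> = (\<integral>\<^sup>+x. (\<integral>\<^sup>+t. g x * indicator {x \<bullet> e - 1..x \<bullet> e} t \<partial>(lborel :: real measure)) \<partial>lborel)"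
  proof (rule lborel_pair.Fubini')
    have "(\<lambda>(x, t). g x * indicator {p. fst p \<bullet> e - 1 \<le> snd p \<and> snd p \<le> fst p \<bullet> e} (x, t))
        \<in> borel_measurable ((lborel :: 'a measure) \<Otimes>\<^sub>M (lborel :: real measure))"
      by measurable
    then show "(\<lambda>(x, t). g x * indicator {x \<bullet> e - 1..x \<bullet> e} t)
        \<in> borel_measurable ((lborel :: 'a measure) \<Otimes>\<^sub>M (lborel :: real measure))"
      by (simp add: indicator_def case_prod_beta')
  qed
  also have "\<dots> = (\<integral>\<^sup>+x. g x \<partial>lborel)"
    by (intro nn_integral_cong) (simp add: nn_integral_cmult_indicator)
  finally show ?thesis ..
qed

lemma nn_integral_coord_measure_translation:
  assumes J: "J \<subseteq> B" and y: "y \<in> coord_space J" and g: "g \<in> borel_measurable borel"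
  shows "(\<integral>\<^sup>+x. g (y + x) \<partial>coord_measure J) = (\<integral>\<^sup>+x. g x \<partial>coord_measure J)"
proof -
  have "(\<integral>\<^sup>+x. g x \<partial>coord_measure J) = (\<integral>\<^sup>+x. g x \<partial>distr (coord_measure J) borel ((+) y))"
    by (simp only: coord_measure_translation[OF J y])
  also have "\<dots> = (\<integral>\<^sup>+x. g (y + x) \<partial>coord_measure J)"
    by (rule nn_integral_distr) (use g in measurable)
  finally show ?thesis ..
qed

text \<open>
  The linear map that sends \<open>b\<close> to \<open>v\<close> and fixes the other basis
  vectors scales volumes by \<open>\<bar>v \<bullet> b\<bar>\<close>: on each line in the
  direction \<open>b\<close> it is a dilation by \<open>v \<bullet> b\<close>, and on each slice
  orthogonal to \<open>b\<close> it is a translation.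
\<close>

lemma emeasure_replace_basis_vector:
  assumes b: "b \<in> B" and h: "v \<bullet> b \<noteq> 0" and A [measurable]: "A \<in> sets borel"
  shows "ennreal \<bar>v \<bullet> b\<bar> * emeasure lborel ((\<lambda>x. x + (x \<bullet> b) *\<^sub>R (v - b)) -` A) = emeasure lborel A"
proof -
  let ?J = "B - {b}"
  let ?E = "\<lambda>x. x + (x \<bullet> b) *\<^sub>R (v - b)"
  define v' where "v' = v - (v \<bullet> b) *\<^sub>R b"
  have v': "t *\<^sub>R v' \<in> coord_space ?J" for t
    using b by (simp add: coord_space_hyperplane v'_def inner_diff_left inner_basis)
  interpret pair_sigma_finite "coord_measure ?J" "lborel :: real measure"
    using sigma_finite_coord_measure[of ?J] by (simp add: pair_sigma_finite_def sigma_finite_lborel)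
  have E [measurable]: "?E \<in> borel_measurable borel" by measurable
  have bor: "?E -` A \<in> sets borel" using measurable_sets[OF E A] by simp
  have "emeasure lborel (?E -` A) = (\<integral>\<^sup>+x. indicator A (?E x) \<partial>lborel)"
    using bor by (simp flip: nn_integral_indicator add: indicator_def)
  also have "\<dots> = (\<integral>\<^sup>+y. (\<integral>\<^sup>+t. indicator A (?E (y + t *\<^sub>R b)) \<partial>(lborel :: real measure)) \<partial>coord_measure ?J)"
    by (rule nn_integral_lborel_slices[OF b]) measurable
  also have "\<dots> = (\<integral>\<^sup>+y. (\<integral>\<^sup>+t. indicator A (t *\<^sub>R v' + y + (t * (v \<bullet> b)) *\<^sub>R b) \<partial>(lborel :: real measure)) \<partial>coord_measure ?J)"
  proof (rule nn_integral_cong_AE, use AE_coord_measure[of ?J, OF Diff_subset] in eventually_elim)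
    case (elim y)
    then have "y \<bullet> b = 0" using b by (simp add: coord_space_hyperplane)
    then have "?E (y + t *\<^sub>R b) = t *\<^sub>R v' + y + (t * (v \<bullet> b)) *\<^sub>R b" for t
      using b by (simp add: v'_def inner_left_distrib inner_basis algebra_simps)
    then show ?case by (simp only:)
  qed
  also have "\<dots> = (\<integral>\<^sup>+t. (\<integral>\<^sup>+y. indicator A (t *\<^sub>R v' + y + (t * (v \<bullet> b)) *\<^sub>R b) \<partial>coord_measure ?J) \<partial>(lborel :: real measure))"
    by (rule Fubini'[symmetric]) measurable
  also have "\<dots> = (\<integral>\<^sup>+t. (\<integral>\<^sup>+y. indicator A (y + (t * (v \<bullet> b)) *\<^sub>R b) \<partial>coord_measure ?J) \<partial>(lborel :: real measure))"
  proof (rule nn_integral_cong)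
    fix t :: real
    have "(\<lambda>y. indicator A (y + (t * (v \<bullet> b)) *\<^sub>R b) :: ennreal) \<in> borel_measurable borel"
      by measurable
    from nn_integral_coord_measure_translation[OF Diff_subset v' this]
    show "(\<integral>\<^sup>+y. indicator A (t *\<^sub>R v' + y + (t * (v \<bullet> b)) *\<^sub>R b) \<partial>coord_measure ?J)
      = (\<integral>\<^sup>+y. indicator A (y + (t * (v \<bullet> b)) *\<^sub>R b) \<partial>coord_measure ?J)" .
  qed
  also have "\<dots> = (\<integral>\<^sup>+y. (\<integral>\<^sup>+t. indicator A (y + (t * (v \<bullet> b)) *\<^sub>R b) \<partial>(lborel :: real measure)) \<partial>coord_measure ?J)"
    by (rule Fubini') measurable
  finally have "ennreal \<bar>v \<bullet> b\<bar> * emeasure lborel (?E -` A)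
    = (\<integral>\<^sup>+y. ennreal \<bar>v \<bullet> b\<bar> * (\<integral>\<^sup>+t. indicator A (y + (t * (v \<bullet> b)) *\<^sub>R b) \<partial>(lborel :: real measure)) \<partial>coord_measure ?J)"
    by (simp only:) (rule nn_integral_cmult[symmetric], measurable)
  also have "\<dots> = (\<integral>\<^sup>+y. (\<integral>\<^sup>+t. indicator A (y + t *\<^sub>R b) \<partial>(lborel :: real measure)) \<partial>coord_measure ?J)"
  proof (rule nn_integral_cong)
    fix y
    have "(\<integral>\<^sup>+t. indicator A (y + t *\<^sub>R b) \<partial>(lborel :: real measure))
      = ennreal \<bar>v \<bullet> b\<bar> * (\<integral>\<^sup>+t. indicator A (y + (0 + (v \<bullet> b) * t) *\<^sub>R b) \<partial>(lborel :: real measure))"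
      using h by (intro nn_integral_real_affine) measurable
    then show "ennreal \<bar>v \<bullet> b\<bar> * (\<integral>\<^sup>+t. indicator A (y + (t * (v \<bullet> b)) *\<^sub>R b) \<partial>(lborel :: real measure))
      = (\<integral>\<^sup>+t. indicator A (y + t *\<^sub>R b) \<partial>(lborel :: real measure))"
      by (simp add: mult.commute)
  qed
  also have "\<dots> = (\<integral>\<^sup>+x. indicator A x \<partial>lborel)"
    by (rule nn_integral_lborel_slices[OF b, symmetric]) measurable
  finally show ?thesis using A by simp
qed

text \<open>
  The projection along \<open>e\<close> is Lipschitz with constant 1 and maps the graph
  \<open>\<Gamma>\<close> of \<open>\<tau>\<close> onto \<open>W\<close>. So on Borel sets the
  image under the projection of the Hausdorff measure of \<open>\<Gamma>\<close> dominates the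
  Hausdorff measure of \<open>W\<close>, and integrals compare in the same way.
\<close>

lemma nn_integral_graph_le_hausdorff:
  assumes e: "e \<in> B" and [measurable]: "W \<in> sets borel" "\<tau> \<in> borel_measurable borel" "g \<in> borel_measurable borel"
  defines "J \<equiv> B - {e}"
  defines "\<Gamma> \<equiv> {x. coord_proj J x \<in> W \<and> x \<bullet> e = \<tau> (coord_proj J x)}"
  shows "hausdorff_outer (card J) (unit_brick J)
      * (\<integral>\<^sup>+y. indicator W y * g (y + \<tau> y *\<^sub>R e) \<partial>coord_measure J)
    \<le> (\<integral>\<^sup>+x. indicator \<Gamma> x * g x \<partial>hausdorff_measure (card J))"
proof -
  let ?H = "hausdorff_measure (card J) :: 'a measure"
  let ?\<kappa> = "hausdorff_outer (card J) (unit_brick J)"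
  let ?P = "coord_proj J"
  have J: "J \<subseteq> B" by (auto simp: J_def)
  have \<Gamma> [measurable]: "\<Gamma> \<in> sets borel"
  proof -
    have "Measurable.pred borel (\<lambda>x. ?P x \<in> W \<and> x \<bullet> e = \<tau> (?P x))" by measurable
    then show ?thesis by (simp add: \<Gamma>_def pred_def)
  qed
  define M where "M = density (coord_measure J) (\<lambda>y. ?\<kappa> * indicator W y)"
  define N where "N = distr (density ?H (indicator \<Gamma>)) borel ?P"
  have "M \<le> N"
  proof (subst le_measure)
    show "\<forall>S\<in>sets M. emeasure M S \<le> emeasure N S"
    proof
      fix S assume "S \<in> sets M"
      then have S [measurable]: "S \<in> sets borel" by (simp add: M_def)
      let ?Y = "coord_space J"
      have Y [measurable]: "?Y \<in> sets borel" using closed_coord_space by (rule borel_closed)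
      have "emeasure M S = ?\<kappa> * emeasure (coord_measure J) (W \<inter> S)"
        unfolding M_def by (subst emeasure_density)
          (auto simp: mult.assoc indicator_inter_arith[symmetric] nn_integral_cmult)
      also have "emeasure (coord_measure J) (W \<inter> S) = emeasure (coord_measure J) (W \<inter> S \<inter> ?Y)"
        by (rule emeasure_eq_AE) (use AE_coord_measure[OF J] in auto)
      also have "?\<kappa> * \<dots> = hausdorff_outer (card J) (W \<inter> S \<inter> ?Y)"
        by (rule hausdorff_outer_eq_coord_measure[OF J, symmetric]) auto
      also have "\<dots> \<le> hausdorff_outer (card J) (?P ` (\<Gamma> \<inter> ?P -` S))"
      proof (rule hausdorff_outer_mono, rule subsetI)
        fix y assume y: "y \<in> W \<inter> S \<inter> ?Y"
        then have "?P (y + \<tau> y *\<^sub>R e) = y" "(y + \<tau> y *\<^sub>R e) \<bullet> e = \<tau> y"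
          using e by (auto simp: J_def coord_proj_hyperplane coord_space_hyperplane inner_left_distrib inner_basis)
        then show "y \<in> ?P ` (\<Gamma> \<inter> ?P -` S)"
          using y by (intro image_eqI[of _ _ "y + \<tau> y *\<^sub>R e"]) (auto simp: \<Gamma>_def)
      qed
      also have "\<dots> \<le> hausdorff_outer (card J) (\<Gamma> \<inter> ?P -` S)"
      proof (rule hausdorff_outer_lipschitz_image)
        fix x y
        have d: "?P x - ?P y = ?P (x - y)"
          by (simp add: coord_proj_def inner_diff_left scaleR_left_diff_distrib sum_subtractf)
        have "?P z \<bullet> ?P z \<le> z \<bullet> z" for z
          using e by (simp add: J_def coord_proj_hyperplane inner_diff_left inner_diff_right inner_basis inner_commute)
        then show "dist (?P x) (?P y) \<le> dist x y"
          by (simp add: dist_norm d norm_eq_sqrt_inner)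
      qed
      also have "\<dots> = emeasure N S"
        unfolding N_def using measurable_sets[OF measurable_coord_proj S, of J]
        by (subst emeasure_distr) (auto simp: emeasure_restricted emeasure_hausdorff_measure)
      finally show "emeasure M S \<le> emeasure N S" .
    qed
  qed (simp_all add: M_def N_def)
  let ?g = "\<lambda>y. g (y + \<tau> y *\<^sub>R e)"
  have "?\<kappa> * (\<integral>\<^sup>+y. indicator W y * ?g y \<partial>coord_measure J) = (\<integral>\<^sup>+y. ?g y \<partial>M)"
    unfolding M_def by (subst nn_integral_density) (auto simp: mult.assoc nn_integral_cmult)
  also have "\<dots> \<le> (\<integral>\<^sup>+y. ?g y \<partial>N)"
    by (rule nn_integral_mono_measure) (use \<open>M \<le> N\<close> in \<open>auto simp: M_def N_def\<close>)
  also have "\<dots> = (\<integral>\<^sup>+x. indicator \<Gamma> x * ?g (?P x) \<partial>?H)"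
    unfolding N_def by (simp add: nn_integral_distr nn_integral_density)
  also have "\<dots> = (\<integral>\<^sup>+x. indicator \<Gamma> x * g x \<partial>?H)"
  proof (rule nn_integral_cong)
    fix x
    have "?P x + \<tau> (?P x) *\<^sub>R e = x" if "x \<in> \<Gamma>"
      using that coord_proj_hyperplane[OF e, of x] by (simp add: \<Gamma>_def J_def)
    then show "indicator \<Gamma> x * ?g (?P x) = indicator \<Gamma> x * g x" by (simp add: indicator_def)
  qed
  finally show ?thesis .
qed

end

section \<open>The chord estimate and the surface area of convex bodies\<close>

context orthonormal_basis
begin

text \<open>
  Over a point \<open>y\<close> of the shadow \<open>W\<close>, the chord of
  \<open>\<Omega>\<close> is \<open>{lo y<..<hi y}\<close> and its endpoints lie on the
  boundary. The Hermite-Hadamard inequality bounds the integral over the chord by \<open>w /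
  2\<close> times the sum of the two boundary values, and the graphs of \<open>hi\<close> and
  \<open>lo\<close> are disjoint parts of the boundary.
\<close>

lemma nn_integral_convex_le_frontier:
  fixes \<Omega> :: "'a set"
  assumes e: "e \<in> B" and \<Omega>: "open \<Omega>" "convex \<Omega>" "bounded \<Omega>"
    and f: "continuous_on (closure \<Omega>) f" "convex_on (closure \<Omega>) f" "\<And>x. x \<in> closure \<Omega> \<Longrightarrow> 0 \<le> f x"
    and w: "\<And>x y. x \<in> closure \<Omega> \<Longrightarrow> y \<in> closure \<Omega> \<Longrightarrow> (x - y) \<bullet> e \<le> w"
  shows "hausdorff_outer (card (B - {e})) (unit_brick (B - {e})) * (\<integral>\<^sup>+x\<in>\<Omega>. ennreal (f x) \<partial>lborel)
    \<le> ennreal (w / 2) * (\<integral>\<^sup>+x\<in>frontier \<Omega>. ennreal (f x) \<partial>hausdorff_measure (card (B - {e})))"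
proof -
  define J where "J = B - {e}"
  let ?\<kappa> = "hausdorff_outer (card J) (unit_brick J)"
  let ?H = "hausdorff_measure (card J) :: 'a measure"
  have J: "J \<subseteq> B" by (auto simp: J_def)
  define T where "T y = {t. y + t *\<^sub>R e \<in> \<Omega>}" for y
  define W where "W = {y. T y \<noteq> {}}"
  define hi where "hi y = (if y \<in> W then Sup (T y) else 0)" for y
  define lo where "lo y = (if y \<in> W then Inf (T y) else 0)" for y
  have T_vimage: "T y = (\<lambda>t. y + t *\<^sub>R e) -` \<Omega>" for y by (auto simp: T_def)
  have T_open: "open (T y)" for y
    unfolding T_vimage by (intro open_vimage \<Omega>(1) continuous_intros)
  have T_convex: "convex (T y)" for y
  proof (rule convexI)
    fix s t u v :: real assume st: "s \<in> T y" "t \<in> T y" and uv: "0 \<le> u" "0 \<le> v" "u + v = 1"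
    have "u *\<^sub>R (y + s *\<^sub>R e) + v *\<^sub>R (y + t *\<^sub>R e) \<in> \<Omega>"
      using \<Omega>(2) st uv by (intro convexD) (auto simp: T_def)
    moreover have "u *\<^sub>R (y + s *\<^sub>R e) + v *\<^sub>R (y + t *\<^sub>R e) = (u + v) *\<^sub>R y + (u * s + v * t) *\<^sub>R e"
      by (simp add: algebra_simps)
    ultimately show "u *\<^sub>R s + v *\<^sub>R t \<in> T y" using uv by (simp add: T_def)
  qed
  obtain R where R: "\<And>x. x \<in> \<Omega> \<Longrightarrow> norm x \<le> R" using \<Omega>(3) by (auto simp: bounded_iff)
  have T_bounded: "bounded (T y)" for y
  proof -
    have "\<bar>t\<bar> \<le> R + \<bar>y \<bullet> e\<bar>" if "t \<in> T y" for t
    proof -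
      have "\<bar>(y + t *\<^sub>R e) \<bullet> e\<bar> \<le> R"
        using that R abs_inner_le[OF e, of "y + t *\<^sub>R e"] by (force simp: T_def)
      then show ?thesis using e by (simp add: inner_left_distrib inner_basis)
    qed
    then show ?thesis by (auto simp: bounded_iff)
  qed
  have T_eq: "lo y < hi y" "T y = {lo y<..<hi y}" if "y \<in> W" for y
    using open_convex_bounded_real[OF T_open T_convex T_bounded, of y] that
    by (auto simp: W_def hi_def lo_def)
  have W_UN: "W = (\<Union>t. (\<lambda>y. y + t *\<^sub>R e) -` \<Omega>)" by (auto simp: W_def T_def)
  have shift_open: "open ((\<lambda>y. y + t *\<^sub>R e) -` \<Omega>)" for t
    by (intro open_vimage \<Omega>(1) continuous_intros)
  have W_open: "open W" unfolding W_UN by (intro open_UN ballI shift_open)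
  then have W [measurable]: "W \<in> sets borel" by (rule borel_open)
  (* Over W, hi is lower semicontinuous and lo is upper semicontinuous; outside W both are 0. *)
  have hi [measurable]: "hi \<in> borel_measurable borel"
  proof (rule borel_measurableI_greater)
    fix c
    have "{y. c < hi y} = (if c < 0 then - W else {}) \<union> (\<Union>t\<in>{c<..}. (\<lambda>y. y + t *\<^sub>R e) -` \<Omega>)"
    proof -
      have "c < hi y \<longleftrightarrow> (\<exists>t\<in>{c<..}. y + t *\<^sub>R e \<in> \<Omega>)" if "y \<in> W" for y
        using that less_cSup_iff[of "T y" c] bounded_imp_bdd_above[OF T_bounded[of y]]
        by (auto simp: hi_def W_def T_def)
      moreover have "y \<in> W" if "y + t *\<^sub>R e \<in> \<Omega>" for y t using that by (auto simp: W_def T_def)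
      ultimately show ?thesis by (auto simp: hi_def[of "_"])
    qed
    moreover have "open (\<Union>t\<in>{c<..}. (\<lambda>y. y + t *\<^sub>R e) -` \<Omega>)" by (intro open_UN ballI shift_open)
    ultimately show "{y \<in> space borel. c < hi y} \<in> sets borel" using W by auto
  qed
  have lo [measurable]: "lo \<in> borel_measurable borel"
  proof (rule borel_measurableI_less)
    fix c
    have "{y. lo y < c} = (if 0 < c then - W else {}) \<union> (\<Union>t\<in>{..<c}. (\<lambda>y. y + t *\<^sub>R e) -` \<Omega>)"
    proof -
      have "lo y < c \<longleftrightarrow> (\<exists>t\<in>{..<c}. y + t *\<^sub>R e \<in> \<Omega>)" if "y \<in> W" for y
        using that cInf_less_iff[of "T y" c] bounded_imp_bdd_below[OF T_bounded[of y]]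
        by (auto simp: lo_def W_def T_def)
      moreover have "y \<in> W" if "y + t *\<^sub>R e \<in> \<Omega>" for y t using that by (auto simp: W_def T_def)
      ultimately show ?thesis by (auto simp: lo_def[of "_"])
    qed
    moreover have "open (\<Union>t\<in>{..<c}. (\<lambda>y. y + t *\<^sub>R e) -` \<Omega>)" by (intro open_UN ballI shift_open)
    ultimately show "{y \<in> space borel. lo y < c} \<in> sets borel" using W by auto
  qed
  have chord: "y + t *\<^sub>R e \<in> closure \<Omega>" if "y \<in> W" "t \<in> {lo y..hi y}" for y t
  proof -
    have "closed ((\<lambda>t. y + t *\<^sub>R e) -` closure \<Omega>)"
      by (intro closed_vimage closed_closure continuous_intros)
    moreover have "{lo y<..<hi y} \<subseteq> (\<lambda>t. y + t *\<^sub>R e) -` closure \<Omega>"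
      using T_eq[OF that(1)] closure_subset by (auto simp: T_def)
    ultimately have "closure {lo y<..<hi y} \<subseteq> (\<lambda>t. y + t *\<^sub>R e) -` closure \<Omega>"
      by (rule closure_minimal[rotated])
    then show ?thesis using T_eq(1)[OF that(1)] that(2) by auto
  qed
  have ends: "y + hi y *\<^sub>R e \<in> frontier \<Omega>" "y + lo y *\<^sub>R e \<in> frontier \<Omega>" if "y \<in> W" for y
  proof -
    have "hi y \<notin> T y" "lo y \<notin> T y" using T_eq(2)[OF that] by auto
    then show "y + hi y *\<^sub>R e \<in> frontier \<Omega>" "y + lo y *\<^sub>R e \<in> frontier \<Omega>"
      using chord[OF that] T_eq(1)[OF that] \<Omega>(1) by (auto simp: frontier_def interior_open T_def)
  qed
  have f_meas: "(\<lambda>x. ennreal (f x) * indicator S x) \<in> borel_measurable borel"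
    if "S \<in> sets borel" "S \<subseteq> closure \<Omega>" for S
  proof -
    have "(\<lambda>x. ennreal (indicator S x *\<^sub>R f x)) \<in> borel_measurable borel"
      using that continuous_on_subset[OF f(1)]
      by (intro measurable_compose[OF _ measurable_ennreal] borel_measurable_continuous_on_indicator)
    then show ?thesis by (rule measurable_cong[THEN iffD1, rotated]) (auto simp: indicator_def)
  qed
  have fr_sub: "frontier \<Omega> \<subseteq> closure \<Omega>" by (auto simp: frontier_def)
  (* Only the values on the boundary enter the bound for a chord. *)
  define g where "g x = ennreal (f x) * indicator (frontier \<Omega>) x" for x
  have g [measurable]: "g \<in> borel_measurable borel"
    unfolding g_def by (rule f_meas[OF _ fr_sub]) simp
  have f\<Omega> [measurable]: "(\<lambda>x. ennreal (f x) * indicator \<Omega> x) \<in> borel_measurable borel"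
    using \<Omega>(1) closure_subset by (intro f_meas) auto
  let ?t = "\<lambda>y. indicator W y * g (y + hi y *\<^sub>R e)" and ?b = "\<lambda>y. indicator W y * g (y + lo y *\<^sub>R e)"
  have chord_le: "(\<integral>\<^sup>+t. ennreal (f (y + t *\<^sub>R e)) * indicator \<Omega> (y + t *\<^sub>R e) \<partial>(lborel :: real measure))
      \<le> ennreal (w / 2) * (?t y + ?b y)" for y
  proof (cases "y \<in> W")
    case False
    then have "indicator \<Omega> (y + t *\<^sub>R e) = (0 :: ennreal)" for t by (auto simp: W_def T_def)
    then show ?thesis by simp
  next
    case True
    let ?\<phi> = "\<lambda>t. f (y + t *\<^sub>R e)"
    have nonneg: "0 \<le> ?\<phi> t" if "t \<in> {lo y..hi y}" for t using chord[OF True that] f(3) by blast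
    have ind: "indicator \<Omega> (y + t *\<^sub>R e) = (indicator {lo y<..<hi y} t :: ennreal)" for t
    proof -
      have "t \<in> T y \<longleftrightarrow> t \<in> {lo y<..<hi y}" by (simp only: T_eq(2)[OF True])
      then show ?thesis by (simp add: T_def indicator_def)
    qed
    have "convex_on {lo y..hi y} ?\<phi>"
    proof (rule convex_onI)
      fix u s t :: real assume u: "0 < u" "u < 1" and st: "s \<in> {lo y..hi y}" "t \<in> {lo y..hi y}"
      have "y + ((1 - u) *\<^sub>R s + u *\<^sub>R t) *\<^sub>R e = (1 - u) *\<^sub>R (y + s *\<^sub>R e) + u *\<^sub>R (y + t *\<^sub>R e)"
        by (simp add: algebra_simps)
      then show "?\<phi> ((1 - u) *\<^sub>R s + u *\<^sub>R t) \<le> (1 - u) * ?\<phi> s + u * ?\<phi> t"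
        using convex_onD[OF f(2), of u "y + s *\<^sub>R e" "y + t *\<^sub>R e"] u chord[OF True] st by simp
    qed simp
    moreover have "(\<lambda>t. ennreal (?\<phi> t) * indicator {lo y<..<hi y} t) \<in> borel_measurable borel"
    proof -
      have "(\<lambda>t. ennreal (f (y + t *\<^sub>R e)) * indicator \<Omega> (y + t *\<^sub>R e)) \<in> borel_measurable borel"
        by (rule measurable_compose[OF _ f\<Omega>]) simp
      then show ?thesis by (simp only: ind)
    qed
    ultimately have "(\<integral>\<^sup>+t. ennreal (?\<phi> t) * indicator {lo y<..<hi y} t \<partial>lborel)
        \<le> ennreal ((hi y - lo y) / 2 * (?\<phi> (lo y) + ?\<phi> (hi y)))"
      by (intro nn_integral_convex_le_endpoints T_eq[OF True] nonneg)
    also have "\<dots> \<le> ennreal (w / 2 * (?\<phi> (hi y) + ?\<phi> (lo y)))"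
    proof (intro ennreal_leI)
      have "hi y - lo y \<le> w"
        using w[of "y + hi y *\<^sub>R e" "y + lo y *\<^sub>R e"] ends[OF True] fr_sub e
        by (auto simp: inner_diff_left inner_left_distrib inner_basis)
      then have "(hi y - lo y) / 2 * (?\<phi> (lo y) + ?\<phi> (hi y)) \<le> w / 2 * (?\<phi> (lo y) + ?\<phi> (hi y))"
        using nonneg T_eq(1)[OF True] by (intro mult_right_mono add_nonneg_nonneg) auto
      then show "(hi y - lo y) / 2 * (?\<phi> (lo y) + ?\<phi> (hi y)) \<le> w / 2 * (?\<phi> (hi y) + ?\<phi> (lo y))"
        by (simp add: add.commute)
    qed
    also have "\<dots> = ennreal (w / 2) * (ennreal (?\<phi> (hi y)) + ennreal (?\<phi> (lo y)))"
      using nonneg[of "hi y"] nonneg[of "lo y"] T_eq(1)[OF True]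
      by (simp only: ennreal_mult'' ennreal_plus add_nonneg_nonneg atLeastAtMost_iff less_imp_le order_refl simp_thms)
    also have "\<dots> = ennreal (w / 2) * (?t y + ?b y)" using True ends[OF True] by (simp add: g_def)
    finally show ?thesis by (simp only: ind)
  qed
  define \<Gamma> where "\<Gamma> \<tau> = {x. coord_proj J x \<in> W \<and> x \<bullet> e = \<tau> (coord_proj J x)}" for \<tau>
  have \<Gamma>_meas [measurable]: "\<Gamma> \<tau> \<in> sets borel" if [measurable]: "\<tau> \<in> borel_measurable borel" for \<tau>
  proof -
    have "Measurable.pred borel (\<lambda>x. coord_proj J x \<in> W \<and> x \<bullet> e = \<tau> (coord_proj J x))" by measurable
    then show ?thesis by (simp add: \<Gamma>_def pred_def)
  qed
  have disj: "\<Gamma> hi \<inter> \<Gamma> lo = {}" using T_eq(1) by (force simp: \<Gamma>_def)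
  have "(\<integral>\<^sup>+x\<in>\<Omega>. ennreal (f x) \<partial>lborel)
      = (\<integral>\<^sup>+y. (\<integral>\<^sup>+t. ennreal (f (y + t *\<^sub>R e)) * indicator \<Omega> (y + t *\<^sub>R e) \<partial>(lborel :: real measure)) \<partial>coord_measure J)"
    unfolding J_def by (rule nn_integral_lborel_slices[OF e f\<Omega>])
  also have "\<dots> \<le> (\<integral>\<^sup>+y. ennreal (w / 2) * (?t y + ?b y) \<partial>coord_measure J)"
    by (intro nn_integral_mono chord_le)
  also have "\<dots> = ennreal (w / 2) * (\<integral>\<^sup>+y. ?t y + ?b y \<partial>coord_measure J)"
    by (rule nn_integral_cmult) measurable
  also have "(\<integral>\<^sup>+y. ?t y + ?b y \<partial>coord_measure J)
      = (\<integral>\<^sup>+y. ?t y \<partial>coord_measure J) + (\<integral>\<^sup>+y. ?b y \<partial>coord_measure J)"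
    by (rule nn_integral_add) measurable
  finally have "?\<kappa> * (\<integral>\<^sup>+x\<in>\<Omega>. ennreal (f x) \<partial>lborel)
      \<le> ?\<kappa> * (ennreal (w / 2) * ((\<integral>\<^sup>+y. ?t y \<partial>coord_measure J) + (\<integral>\<^sup>+y. ?b y \<partial>coord_measure J)))"
    by (rule mult_left_mono) simp
  also have "\<dots> = ennreal (w / 2) * (?\<kappa> * (\<integral>\<^sup>+y. ?t y \<partial>coord_measure J) + ?\<kappa> * (\<integral>\<^sup>+y. ?b y \<partial>coord_measure J))"
    by (simp only: distrib_left mult.left_commute)
  also have "\<dots> \<le> ennreal (w / 2) * ((\<integral>\<^sup>+x. indicator (\<Gamma> hi) x * g x \<partial>?H) + (\<integral>\<^sup>+x. indicator (\<Gamma> lo) x * g x \<partial>?H))"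
    unfolding \<Gamma>_def J_def
    by (intro mult_left_mono add_mono nn_integral_graph_le_hausdorff e W hi lo g) simp
  also have "(\<integral>\<^sup>+x. indicator (\<Gamma> hi) x * g x \<partial>?H) + (\<integral>\<^sup>+x. indicator (\<Gamma> lo) x * g x \<partial>?H)
      = (\<integral>\<^sup>+x. indicator (\<Gamma> hi) x * g x + indicator (\<Gamma> lo) x * g x \<partial>?H)"
    by (rule nn_integral_add[symmetric]) measurable
  also have "\<dots> \<le> (\<integral>\<^sup>+x. g x \<partial>?H)"
    using disj by (intro nn_integral_mono) (auto simp: indicator_def)
  finally have "?\<kappa> * (\<integral>\<^sup>+x\<in>\<Omega>. ennreal (f x) \<partial>lborel) \<le> ennreal (w / 2) * (\<integral>\<^sup>+x. g x \<partial>?H)"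
    by (simp add: mult_left_mono)
  then show ?thesis by (simp only: g_def J_def)
qed

lemma frontier_brick_subset:
  "frontier (brick l u) \<subseteq> (\<Union>b\<in>B. {x \<in> brick l u. x \<bullet> b = l b} \<union> {x \<in> brick l u. x \<bullet> b = u b})"
proof
  fix x assume x: "x \<in> frontier (brick l u)"
  then have xb: "x \<in> brick l u" using closed_brick[of l u] by (auto simp: frontier_def)
  show "x \<in> (\<Union>b\<in>B. {x \<in> brick l u. x \<bullet> b = l b} \<union> {x \<in> brick l u. x \<bullet> b = u b})"
  proof (rule ccontr)
    assume "\<not> ?thesis"
    then have "\<forall>b\<in>B. l b < x \<bullet> b \<and> x \<bullet> b < u b"
      using xb by (auto simp: brick_def less_le)
    moreover have "open (\<Inter>b\<in>B. {x. l b < x \<bullet> b} \<inter> {x. x \<bullet> b < u b})"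
      by (intro open_INT finite_basis ballI open_Int open_Collect_less continuous_intros)
    moreover have "(\<Inter>b\<in>B. {x. l b < x \<bullet> b} \<inter> {x. x \<bullet> b < u b}) \<subseteq> brick l u"
      by (auto simp: brick_def less_imp_le)
    ultimately have "x \<in> interior (brick l u)" by (intro interiorI) auto
    then show False using x by (simp add: frontier_def)
  qed
qed

lemma hausdorff_outer_brick_face:
  assumes b: "b \<in> B" and lu: "\<And>c. c \<in> B \<Longrightarrow> l c \<le> u c"
  shows "hausdorff_outer (card (B - {b})) {x \<in> brick l u. x \<bullet> b = a}
    \<le> hausdorff_outer (card (B - {b})) (unit_brick (B - {b})) * ennreal (\<Prod>c\<in>B - {b}. u c - l c)"
proof -
  let ?J = "B - {b}"
  define l' where "l' c = (if c = b then 0 else l c)" for c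
  define u' where "u' c = (if c = b then 0 else u c)" for c
  have "hausdorff_outer (card ?J) {x \<in> brick l u. x \<bullet> b = a}
      = hausdorff_outer (card ?J) ((\<lambda>x. x - a *\<^sub>R b) ` {x \<in> brick l u. x \<bullet> b = a})"
    by (rule hausdorff_outer_isometry_image[symmetric]) (simp add: dist_norm)
  also have "\<dots> \<le> hausdorff_outer (card ?J) (brick l' u')"
    using b by (intro hausdorff_outer_mono)
      (auto simp: brick_def l'_def u'_def inner_diff_left inner_basis)
  also have "\<dots> = hausdorff_outer (card ?J) (unit_brick ?J) * emeasure (coord_measure ?J) (brick l' u')"
    using b closed_brick by (intro hausdorff_outer_eq_coord_measure)
      (auto simp: brick_def coord_space_hyperplane l'_def u'_def borel_closed)
  also have "emeasure (coord_measure ?J) (brick l' u') = ennreal (\<Prod>c\<in>?J. u' c - l' c)"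
    using lu by (intro emeasure_coord_measure_brick) (auto simp: l'_def u'_def)
  also have "(\<Prod>c\<in>?J. u' c - l' c) = (\<Prod>c\<in>?J. u c - l c)"
    by (intro prod.cong) (auto simp: l'_def u'_def)
  finally show ?thesis .
qed

end

text \<open>
  An outer normal at a boundary point \<open>p\<close> of \<open>\<Omega>\<close> spans a ray
  all of whose points have \<open>p\<close> as their nearest point in \<open>\<Omega>\<close>;
  the ray has to leave the bounded set \<open>Q\<close>.
\<close>

lemma frontier_subset_closest_point_image:
  fixes \<Omega> Q :: "'a::euclidean_space set"
  assumes \<Omega>: "open \<Omega>" "convex \<Omega>" "\<Omega> \<noteq> {}" and Q: "closure \<Omega> \<subseteq> Q" "bounded Q"
  shows "frontier \<Omega> \<subseteq> closest_point (closure \<Omega>) ` frontier Q"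
proof
  fix p assume p: "p \<in> frontier \<Omega>"
  then have "p \<in> closure \<Omega>" "p \<notin> rel_interior \<Omega>"
    using \<Omega> by (auto simp: frontier_def rel_interior_open interior_open)
  then obtain a where a: "a \<noteq> 0" "\<And>y. y \<in> closure \<Omega> \<Longrightarrow> a \<bullet> p \<le> a \<bullet> y"
    using supporting_hyperplane_relative_frontier[OF \<Omega>(2)] by metis
  obtain R where R: "\<And>x. x \<in> Q \<Longrightarrow> norm x \<le> R" using Q(2) by (auto simp: bounded_iff)
  define ray where "ray = (\<lambda>t. p - t *\<^sub>R a) ` {0..}"
  have "connected ray" unfolding ray_def
    by (intro connected_continuous_image continuous_intros) simp
  moreover have "p \<in> ray \<inter> Q"
    using \<open>p \<in> closure \<Omega>\<close> Q(1) by (auto simp: ray_def intro!: image_eqI[of _ _ 0])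
  moreover have "ray - Q \<noteq> {}"
  proof -
    define t where "t = (R + norm p + 1) / norm a"
    have "0 \<le> R" using R[OF subsetD[OF Q(1) \<open>p \<in> closure \<Omega>\<close>]] norm_ge_zero[of p] by (rule order_trans[rotated])
    then have t: "0 \<le> t" "norm (t *\<^sub>R a) = R + norm p + 1" using a(1) by (auto simp: t_def)
    have "norm (t *\<^sub>R a) \<le> norm (p - t *\<^sub>R a) + norm p"
      using norm_triangle_ineq4[of p "p - t *\<^sub>R a"] by simp
    then have "\<not> norm (p - t *\<^sub>R a) \<le> R" using t(2) by simp
    then have "p - t *\<^sub>R a \<in> ray - Q" using R t(1) by (auto simp: ray_def)
    then show ?thesis by blast
  qed
  ultimately have "ray \<inter> frontier Q \<noteq> {}" by (intro connected_Int_frontier) auto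
  then obtain t where t: "0 \<le> t" "p - t *\<^sub>R a \<in> frontier Q" by (auto simp: ray_def)
  have "p = closest_point (closure \<Omega>) (p - t *\<^sub>R a)"
  proof (rule closest_point_unique)
    show "\<forall>z\<in>closure \<Omega>. dist (p - t *\<^sub>R a) p \<le> dist (p - t *\<^sub>R a) z"
    proof
      fix z assume z: "z \<in> closure \<Omega>"
      have "(norm (p - t *\<^sub>R a - z))\<^sup>2 = (norm (t *\<^sub>R a))\<^sup>2 + (norm (p - z))\<^sup>2 + 2 * t * (a \<bullet> z - a \<bullet> p)"
        by (simp add: power2_norm_eq_inner inner_diff_left inner_diff_right inner_commute algebra_simps power2_eq_square[of t])
      moreover have "0 \<le> 2 * t * (a \<bullet> z - a \<bullet> p)" using t(1) a(2)[OF z] by simp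
      ultimately have "(norm (t *\<^sub>R a))\<^sup>2 \<le> (norm (p - t *\<^sub>R a - z))\<^sup>2" by simp
      then have "norm (t *\<^sub>R a) \<le> norm (p - t *\<^sub>R a - z)" by (rule power2_le_imp_le) simp
      then show "dist (p - t *\<^sub>R a) p \<le> dist (p - t *\<^sub>R a) z" by (simp add: dist_norm)
    qed
  qed (use \<Omega> \<open>p \<in> closure \<Omega>\<close> in \<open>auto simp: convex_closure\<close>)
  then show "p \<in> closest_point (closure \<Omega>) ` frontier Q" using t(2) by blast
qed

context orthonormal_basis
begin

text \<open>
  Monotonicity of the surface area of convex bodies, for a box as the larger body: the
  nearest-point map does not increase distances. The right-hand side is the sum of the areas of
  the faces of the box.
\<close>

theorem hausdorff_outer_frontier_le_brick:
  assumes \<Omega>: "open \<Omega>" "convex \<Omega>" "\<Omega> \<noteq> {}" and sub: "closure \<Omega> \<subseteq> brick l u" and k: "k = DIM('a) - 1"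
  shows "hausdorff_outer k (frontier \<Omega>)
    \<le> (\<Sum>b\<in>B. 2 * (hausdorff_outer k (unit_brick (B - {b})) * ennreal (\<Prod>c\<in>B - {b}. u c - l c)))"
proof -
  have card: "card (B - {b}) = k" if "b \<in> B" for b using that card_basis k by simp
  obtain p where "p \<in> brick l u" using sub \<Omega>(3) closure_subset by blast
  then have lu: "l c \<le> u c" if "c \<in> B" for c using that by (force simp: brick_def)
  let ?F = "\<lambda>b a. {x \<in> brick l u. x \<bullet> b = a}"
  have "hausdorff_outer k (frontier \<Omega>) \<le> hausdorff_outer k (closest_point (closure \<Omega>) ` frontier (brick l u))"
    by (intro hausdorff_outer_mono frontier_subset_closest_point_image \<Omega> sub bounded_brick)
  also have "\<dots> \<le> hausdorff_outer k (frontier (brick l u))"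
    using \<Omega> by (intro hausdorff_outer_lipschitz_image closest_point_lipschitz) (auto simp: convex_closure)
  also have "\<dots> \<le> hausdorff_outer k (\<Union>b\<in>B. ?F b (l b) \<union> ?F b (u b))"
    by (intro hausdorff_outer_mono frontier_brick_subset)
  also have "\<dots> \<le> (\<Sum>b\<in>B. hausdorff_outer k (?F b (l b) \<union> ?F b (u b)))"
    by (intro hausdorff_outer_UN_finite_le finite_basis)
  also have "\<dots> \<le> (\<Sum>b\<in>B. 2 * (hausdorff_outer k (unit_brick (B - {b})) * ennreal (\<Prod>c\<in>B - {b}. u c - l c)))"
  proof (rule sum_mono)
    fix b assume b: "b \<in> B"
    have "hausdorff_outer k (?F b (l b) \<union> ?F b (u b)) \<le> hausdorff_outer k (?F b (l b)) + hausdorff_outer k (?F b (u b))"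
      by (rule hausdorff_outer_Un_le)
    also have "\<dots> \<le> 2 * (hausdorff_outer k (unit_brick (B - {b})) * ennreal (\<Prod>c\<in>B - {b}. u c - l c))"
      unfolding mult_2 using hausdorff_outer_brick_face[OF b lu] card[OF b] by (intro add_mono) simp_all
    finally show "hausdorff_outer k (?F b (l b) \<union> ?F b (u b))
      \<le> 2 * (hausdorff_outer k (unit_brick (B - {b})) * ennreal (\<Prod>c\<in>B - {b}. u c - l c))" .
  qed
  finally show ?thesis .
qed

end

section \<open>A small box around a convex body\<close>

text \<open>
  The state after \<open>m\<close> steps of the choice of an inscribed simplex with vertices
  \<open>p 0, p 1, \<dots>\<close>: the next vertex \<open>p (i + 1)\<close> has the largest
  possible distance \<open>h i\<close> from the affine hull of \<open>p 0, \<dots>, p i\<close>,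
  and \<open>u i\<close> is the unit vector of that distance, so that \<open>u 0, u 1,
  \<dots>\<close> is the Gram-Schmidt basis. The last condition holds because the first edge is
  a diameter of \<open>K\<close>.
\<close>

definition greedy_frame :: "'a::euclidean_space set \<Rightarrow> nat \<Rightarrow> (nat \<Rightarrow> 'a) \<Rightarrow> (nat \<Rightarrow> 'a) \<Rightarrow> (nat \<Rightarrow> real) \<Rightarrow> bool" where
  "greedy_frame K m u p h \<longleftrightarrow>
    (\<forall>i<m. \<forall>j<m. u i \<bullet> u j = (if i = j then 1 else 0)) \<and>
    (\<forall>i\<le>m. p i \<in> K \<and> p i - p 0 \<in> span (u ` {..<i})) \<and>
    (\<forall>i<m. 0 < h i \<and> (p (Suc i) - p 0) \<bullet> u i = h i) \<and>
    (\<forall>i<m. \<forall>x\<in>K. \<bar>(x - p 0) \<bullet> u i\<bar> \<le> h i) \<and>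
    (\<forall>x\<in>K. 0 \<le> (x - p 0) \<bullet> u 0)"

text \<open>
  If the segment from \<open>a\<close> to \<open>b\<close> is a diameter, then \<open>K\<close>
  lies in the slab bounded by the two hyperplanes orthogonal to the segment at its ends. This
  makes the width in the first direction \<open>h 0\<close> rather than \<open>2 * h 0\<close>,
  which for small dimensions is needed for the bound \<open>n ^ n\<close>.
\<close>

lemma ex_greedy_frame_Suc_0:
  fixes K :: "'a::euclidean_space set"
  assumes K: "compact K" "interior K \<noteq> {}"
  shows "\<exists>u p h. greedy_frame K (Suc 0) u p h"
proof -
  have "K \<noteq> {}" using K(2) interior_subset by blast
  then obtain a b where ab: "a \<in> K" "b \<in> K" "\<And>x y. x \<in> K \<Longrightarrow> y \<in> K \<Longrightarrow> dist x y \<le> dist a b"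
    using compact_sup_maxdistance[OF K(1)] by (metis dist_norm)
  have "a \<noteq> b"
  proof
    assume "a = b"
    then have "K \<subseteq> {a}" using ab by force
    then have "interior K \<subseteq> interior {a}" by (rule interior_mono)
    then show False using K(2) by simp
  qed
  define d where "d = norm (b - a)"
  have d: "0 < d" "\<And>x y. x \<in> K \<Longrightarrow> y \<in> K \<Longrightarrow> norm (x - y) \<le> d"
    using ab(3) \<open>a \<noteq> b\<close> by (auto simp: d_def dist_norm norm_minus_commute)
  define e where "e = (b - a) /\<^sub>R d"
  have e: "norm e = 1" "b - a = d *\<^sub>R e" using d(1) by (auto simp: e_def d_def)
  then have ee: "e \<bullet> e = 1" by (simp add: norm_eq_1)
  have inn: "(x - y) \<bullet> e \<le> d" if "x \<in> K" "y \<in> K" for x y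
    using norm_cauchy_schwarz[of "x - y" e] d(2)[OF that] e(1) by simp
  have pos: "0 \<le> (x - a) \<bullet> e" if "x \<in> K" for x
  proof -
    have "(b - a) \<bullet> e = (b - x) \<bullet> e + (x - a) \<bullet> e" by (simp add: inner_diff_left)
    then show ?thesis using inn[OF ab(2) that] e(2) ee by simp
  qed
  have "greedy_frame K (Suc 0) (\<lambda>_. e) (\<lambda>i. if i = 0 then a else b) (\<lambda>_. d)"
    unfolding greedy_frame_def using d(1) ab(1,2) e(2) ee inn[OF _ ab(1)] pos
    by (auto simp: le_Suc_eq lessThan_Suc span_base span_mul span_zero)
  then show ?thesis by blast
qed

text \<open>
  The new direction is that of the longest residual \<open>r q\<close> of the Gram-Schmidt
  process. The residual does not vanish on all of \<open>K\<close>, for \<open>K\<close> would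
  then lie in a proper affine subspace.
\<close>

lemma ex_greedy_frame_Suc:
  fixes K :: "'a::euclidean_space set"
  assumes K: "compact K" "interior K \<noteq> {}" and m: "0 < m" "m < DIM('a)" and gf: "greedy_frame K m u p h"
  shows "\<exists>u p h. greedy_frame K (Suc m) u p h"
proof -
  have orth: "u i \<bullet> u j = (if i = j then 1 else 0)" if "i < m" "j < m" for i j
    using gf that by (simp add: greedy_frame_def)
  (* s x is the component of x - p 0 in the span of the directions found so far. *)
  define s where "s x = (\<Sum>i<m. ((x - p 0) \<bullet> u i) *\<^sub>R u i)" for x
  define r where "r x = (x - p 0) - s x" for x
  have s_span: "s x \<in> span (u ` {..<m})" for x
    unfolding s_def by (intro span_sum span_mul span_base) auto
  have s_inner: "s x \<bullet> u j = (x - p 0) \<bullet> u j" if "j < m" for x j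
  proof -
    have "s x \<bullet> u j = (\<Sum>i<m. if i = j then (x - p 0) \<bullet> u i else 0)"
      unfolding s_def inner_sum_left using orth that by (intro sum.cong) auto
    then show ?thesis using that by simp
  qed
  then have r_orth: "r x \<bullet> u j = 0" if "j < m" for x j
    using that by (simp add: r_def inner_diff_left)
  have "K \<noteq> {}" using K(2) interior_subset by blast
  moreover have "continuous_on K (\<lambda>x. norm (r x))"
    unfolding r_def s_def by (intro continuous_intros)
  ultimately obtain q where q: "q \<in> K" "\<And>x. x \<in> K \<Longrightarrow> norm (r x) \<le> norm (r q)"
    using continuous_attains_sup[OF K(1)] by metis
  have "r q \<noteq> 0"
  proof
    assume "r q = 0"
    then have "r x = 0" if "x \<in> K" for x using q(2)[OF that] by simp
    then have eq: "- p 0 + x = s x" if "x \<in> K" for x using that by (simp add: r_def)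
    have sub: "(+) (- p 0) ` K \<subseteq> span (u ` {..<m})"
      using s_span by (intro image_subsetI) (simp only: eq)
    have "dim (span (u ` {..<m})) \<le> card (u ` {..<m})" by (simp add: dim_span dim_le_card')
    also have "\<dots> \<le> m" using card_image_le[of "{..<m}" u] by simp
    also have "m < DIM('a)" by (rule m(2))
    finally have "interior (span (u ` {..<m})) = {}" by (rule empty_interior_lowdim)
    then have "interior ((+) (- p 0) ` K) = {}" using interior_mono[OF sub] by simp
    then show False using K(2) interior_translation[of "- p 0" K] by (metis image_is_empty)
  qed
  define d where "d = norm (r q)"
  define e where "e = r q /\<^sub>R d"
  have d: "0 < d" using \<open>r q \<noteq> 0\<close> by (simp add: d_def)
  then have e: "norm e = 1" "r q = d *\<^sub>R e" by (auto simp: e_def d_def)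
  then have ee: "e \<bullet> e = 1" by (simp add: norm_eq_1)
  have eu: "e \<bullet> u j = 0" "u j \<bullet> e = 0" if "j < m" for j
    using r_orth[OF that, of q] by (simp_all add: e_def inner_commute)
  have se: "s x \<bullet> e = 0" for x
    unfolding s_def inner_sum_left using eu by (intro sum.neutral) auto
  then have re: "(x - p 0) \<bullet> e = r x \<bullet> e" for x by (simp add: r_def inner_diff_left)
  have bound: "\<bar>(x - p 0) \<bullet> e\<bar> \<le> d" if "x \<in> K" for x
    using Cauchy_Schwarz_ineq2[of "r x" e] q(2)[OF that] e(1) by (simp add: re d_def)
  have height: "(q - p 0) \<bullet> e = d" using ee by (simp add: re e(2))
  define u' where "u' = u(m := e)"
  define p' where "p' = p(Suc m := q)"
  define h' where "h' = h(m := d)"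
  have u': "u' ` {..<i} = u ` {..<i}" if "i \<le> m" for i
    using that by (intro image_cong) (auto simp: u'_def)
  have qs: "q - p 0 \<in> span (u' ` {..<Suc m})"
  proof -
    have "q - p 0 = d *\<^sub>R e + s q" using e(2) by (simp add: r_def algebra_simps)
    moreover have "u' ` {..<Suc m} = insert e (u ` {..<m})"
      using u'[of m] by (simp add: lessThan_Suc) (simp add: u'_def)
    moreover have "s q \<in> span (insert e (u ` {..<m}))"
      using s_span[of q] span_mono[of "u ` {..<m}" "insert e (u ` {..<m})"] by blast
    ultimately show ?thesis by (simp add: span_add span_base span_mul)
  qed
  have p0: "p' 0 = p 0" by (simp add: p'_def)
  have "greedy_frame K (Suc m) u' p' h'"
    unfolding greedy_frame_def p0
  proof (intro conjI allI impI ballI)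
    fix i j assume "i < Suc m" "j < Suc m"
    then show "u' i \<bullet> u' j = (if i = j then 1 else 0)" using orth eu ee by (auto simp: u'_def less_Suc_eq)
  next
    fix i assume i: "i \<le> Suc m"
    show "p' i \<in> K" using i gf q(1) by (auto simp: p'_def greedy_frame_def le_Suc_eq)
    show "p' i - p 0 \<in> span (u' ` {..<i})"
    proof (cases "i = Suc m")
      case True then show ?thesis using qs by (simp add: p'_def)
    next
      case False
      then show ?thesis using i gf u'[of i] by (simp add: p'_def greedy_frame_def)
    qed
  next
    fix i assume i: "i < Suc m"
    show "0 < h' i" using i gf d by (auto simp: h'_def greedy_frame_def less_Suc_eq)
    show "(p' (Suc i) - p 0) \<bullet> u' i = h' i"
      using i gf height by (auto simp: h'_def p'_def u'_def greedy_frame_def less_Suc_eq)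
    fix x assume "x \<in> K"
    then show "\<bar>(x - p 0) \<bullet> u' i\<bar> \<le> h' i"
      using i gf bound by (auto simp: h'_def u'_def greedy_frame_def less_Suc_eq)
  next
    fix x assume "x \<in> K"
    then show "0 \<le> (x - p 0) \<bullet> u' 0" using gf m(1) by (auto simp: u'_def greedy_frame_def)
  qed
  then show ?thesis by blast
qed

lemma ex_greedy_frame:
  fixes K :: "'a::euclidean_space set"
  assumes K: "compact K" "interior K \<noteq> {}"
  shows "0 < m \<Longrightarrow> m \<le> DIM('a) \<Longrightarrow> \<exists>u p h. greedy_frame K m u p h"
proof (induction m)
  case (Suc m)
  show ?case
  proof (cases "m = 0")
    case True
    then show ?thesis using ex_greedy_frame_Suc_0[OF K] by simp
  next
    case False
    then show ?thesis using Suc ex_greedy_frame_Suc[OF K, of m] by auto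
  qed
qed simp

context orthonormal_basis
begin

lemma emeasure_simplex_basis:
  "emeasure lborel (convex hull (insert 0 B)) = ennreal (1 / fact DIM('a))"
proof -
  obtain T :: "'a \<Rightarrow> 'a" where T: "orthogonal_transformation T" "bij_betw T Basis B"
    using ex_orthogonal_transformation by blast
  have lin: "linear T" using T(1) by (rule orthogonal_transformation_linear)
  then have [measurable]: "T \<in> borel_measurable borel"
    by (intro borel_measurable_continuous_onI linear_continuous_on) (simp add: linear_linear)
  have comp: "compact (convex hull (insert 0 B))" by (intro finite_imp_compact_convex_hull) simp
  have "T ` insert 0 Basis = insert 0 B"
    using T(2) linear_0[OF lin] by (simp add: bij_betw_def)
  then have "convex hull (insert 0 B) = T ` (convex hull (insert 0 Basis))"
    using convex_hull_linear_image[OF lin, of "insert 0 Basis"] by simp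
  moreover have "inj T" using T(1) by (rule orthogonal_transformation_inj)
  ultimately have "T -` (convex hull (insert 0 B)) = convex hull (insert 0 Basis)"
    by (simp add: inj_vimage_image_eq)
  then have "emeasure lborel (convex hull (insert 0 B)) = emeasure lborel (convex hull (insert 0 Basis) :: 'a set)"
    using emeasure_distr[of T lborel borel "convex hull (insert 0 B)"] distr_lborel_orthogonal[OF T(1)]
      compact_imp_closed[OF comp] by simp
  then show ?thesis by (simp add: emeasure_std_simplex)
qed

end

lemma greedy_frame_basis:
  fixes K :: "'a::euclidean_space set"
  assumes gf: "greedy_frame K DIM('a) u p h"
  shows "inj_on u {..<DIM('a)}" "orthonormal_basis (u ` {..<DIM('a)})"
proof -
  show inj: "inj_on u {..<DIM('a)}"
  proof (rule inj_onI)
    fix i j assume ij: "i \<in> {..<DIM('a)}" "j \<in> {..<DIM('a)}" "u i = u j"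
    then have "u i \<bullet> u j = 1" using gf unfolding greedy_frame_def by (metis lessThan_iff)
    then show "i = j" using ij gf unfolding greedy_frame_def by (metis lessThan_iff zero_neq_one)
  qed
  show "orthonormal_basis (u ` {..<DIM('a)})"
  proof
    show "b \<bullet> c = (if b = c then 1 else 0)" if "b \<in> u ` {..<DIM('a)}" "c \<in> u ` {..<DIM('a)}" for b c
      using that gf inj by (auto simp: greedy_frame_def inj_on_def)
  qed (simp add: card_image[OF inj])
qed

text \<open>
  The edge vectors of the simplex are triangular with respect to the basis \<open>u\<close>.
  Replacing the basis vectors one after the other by edge vectors, starting with the standard
  simplex, multiplies the volume by \<open>h m\<close> in each step.
\<close>

lemma emeasure_greedy_simplex:
  fixes K :: "'a::euclidean_space set"
  assumes gf: "greedy_frame K DIM('a) u p h"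
  shows "m \<le> DIM('a) \<Longrightarrow>
    emeasure lborel (convex hull (insert 0 ((\<lambda>i. p (Suc i) - p 0) ` {..<m} \<union> u ` {m..<DIM('a)})))
      = ennreal ((\<Prod>i<m. h i) / fact DIM('a))"
proof (induction m)
  case 0
  interpret orthonormal_basis "u ` {..<DIM('a)}" by (rule greedy_frame_basis(2)[OF gf])
  show ?case using emeasure_simplex_basis by (simp add: lessThan_atLeast0)
next
  case (Suc m)
  let ?v = "\<lambda>i. p (Suc i) - p 0" and ?n = "DIM('a)"
  let ?S = "\<lambda>m. insert 0 (?v ` {..<m} \<union> u ` {m..<?n})"
  have m: "m < ?n" using Suc.prems by simp
  interpret orthonormal_basis "u ` {..<?n}" by (rule greedy_frame_basis(2)[OF gf])
  have orth: "u i \<bullet> u j = (if i = j then 1 else 0)" if "i < ?n" "j < ?n" for i j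
    using gf that by (simp add: greedy_frame_def)
  have h: "0 < h m" "?v m \<bullet> u m = h m" using gf m by (auto simp: greedy_frame_def)
  define E where "E x = x + (x \<bullet> u m) *\<^sub>R (?v m - u m)" for x
  have lin: "linear E"
    by (rule linearI) (simp_all add: E_def inner_left_distrib scaleR_left_distrib algebra_simps)
  have v0: "?v i \<bullet> u m = 0" if "i < m" for i
  proof -
    have "?v i \<in> span (u ` {..<Suc i})" using gf that m by (simp add: greedy_frame_def)
    moreover have "orthogonal (u m) y" if "y \<in> u ` {..<Suc i}" for y
      using that \<open>i < m\<close> m orth by (auto simp: orthogonal_def)
    ultimately have "orthogonal (u m) (?v i)" using orthogonal_to_span by blast
    then show ?thesis by (simp add: orthogonal_def inner_commute)
  qed
  have "E ` ?S m = ?S (Suc m)"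
  proof -
    have "E ` (?v ` {..<m}) = ?v ` {..<m}"
      unfolding image_image by (intro image_cong) (auto simp: E_def v0)
    moreover have "{m..<?n} = insert m {Suc m..<?n}" using m by auto
    moreover have "E (u m) = ?v m" using orth[OF m m] by (simp add: E_def)
    moreover have "E ` (u ` {Suc m..<?n}) = u ` {Suc m..<?n}"
      unfolding image_image using orth m by (intro image_cong) (auto simp: E_def)
    ultimately show ?thesis by (simp add: image_Un lessThan_Suc linear_0[OF lin])
  qed
  then have hull: "convex hull (?S (Suc m)) = E ` (convex hull (?S m))"
    using convex_hull_linear_image[OF lin, of "?S m"] by simp
  have "inj E"
  proof (rule injI)
    fix x y assume xy: "E x = E y"
    have "E z \<bullet> u m = (z \<bullet> u m) * h m" for z
      using h(2) orth[OF m m] by (simp add: E_def inner_left_distrib inner_diff_left algebra_simps)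
    then have "(x \<bullet> u m) * h m = (y \<bullet> u m) * h m" using xy by metis
    then have "x \<bullet> u m = y \<bullet> u m" using h(1) by simp
    then show "x = y" using xy by (simp add: E_def)
  qed
  then have vim: "E -` (convex hull (?S (Suc m))) = convex hull (?S m)"
    by (simp add: hull inj_vimage_image_eq)
  have "compact (convex hull (?S (Suc m)))" by (intro finite_imp_compact_convex_hull) simp
  then have "ennreal \<bar>?v m \<bullet> u m\<bar> * emeasure lborel (E -` (convex hull (?S (Suc m))))
      = emeasure lborel (convex hull (?S (Suc m)))"
    unfolding E_def using m h by (intro emeasure_replace_basis_vector) (auto simp: compact_imp_closed)
  then have "emeasure lborel (convex hull (?S (Suc m))) = ennreal (h m) * ennreal ((\<Prod>i<m. h i) / fact ?n)"
    using Suc h by (simp add: vim)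
  also have "\<dots> = ennreal (h m * ((\<Prod>i<m. h i) / fact ?n))"
    using h(1) by (intro ennreal_mult'[symmetric]) simp
  finally show ?case by (simp add: mult.commute)
qed

text \<open>
  In the induction step the right-hand side grows by the factor \<open>(n + 1) * (1 + 1 / n) ^
  n\<close>, and the left-hand side by \<open>2 * (n + 1)\<close>, which is smaller by
  Bernoulli's inequality.
\<close>

lemma two_power_fact_le: "0 < n \<Longrightarrow> 2 ^ (n - 1) * fact n \<le> (real n ^ n)"
proof (induction n)
  case (Suc n)
  show ?case
  proof (cases "n = 0")
    case False
    have "2 = 1 + real n * (1 / real n)" using False by simp
    also have "\<dots> \<le> (1 + 1 / real n) ^ n" by (intro Bernoulli_inequality) (simp add: order_trans[of _ 0])
    also have "1 + 1 / real n = real (Suc n) / real n" using False by (simp add: field_simps)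
    finally have "2 * real n ^ n \<le> real (Suc n) ^ n"
      using False by (simp add: power_divide pos_le_divide_eq)
    moreover have "(2::real) ^ n = 2 * 2 ^ (n - 1)" using False by (cases n) auto
    moreover have "2 ^ (n - 1) * fact n \<le> real n ^ n" using Suc.IH False by simp
    ultimately have "2 ^ n * fact n \<le> real (Suc n) ^ n" by simp
    then have "real (Suc n) * (2 ^ n * fact n) \<le> real (Suc n) * real (Suc n) ^ n"
      by (rule mult_left_mono) simp
    then show ?thesis by (simp add: mult_ac)
  qed simp
qed simp

text \<open>
  The box with edges parallel to the Gram-Schmidt basis of the greedy simplex has edge lengths
  \<open>h 0\<close> and \<open>2 * h i\<close> for \<open>i > 0\<close>, while the simplex
  inside \<open>K\<close> has volume \<open>(\<Prod>i. h i) / n!\<close>.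
\<close>

theorem ex_enclosing_brick:
  fixes K :: "'a::euclidean_space set"
  assumes K: "compact K" "convex K" "interior K \<noteq> {}"
  shows "\<exists>B l u. orthonormal_basis B \<and> K \<subseteq> orthonormal_basis.brick B l u \<and> (\<forall>b\<in>B. l b < u b) \<and>
    ennreal (\<Prod>b\<in>B. u b - l b) \<le> ennreal (real DIM('a) ^ DIM('a)) * emeasure lborel K"
proof -
  let ?n = "DIM('a)"
  obtain u p h where gf: "greedy_frame K ?n u p h"
    using ex_greedy_frame[OF K(1,3), of ?n] by auto
  have n: "0 < ?n" by simp
  have h: "0 < h i" if "i < ?n" for i using gf that by (simp add: greedy_frame_def)
  note inj = greedy_frame_basis(1)[OF gf]
  define B where "B = u ` {..<?n}"
  interpret orthonormal_basis B unfolding B_def by (rule greedy_frame_basis(2)[OF gf])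
  define ix where "ix = inv_into {..<?n} u"
  have ix: "ix (u i) = i" if "i < ?n" for i using that inj by (simp add: ix_def)
  (* The first edge is a diameter, so K does not extend below p 0 in the direction u 0. *)
  define l where "l b = p 0 \<bullet> b - (if ix b = 0 then 0 else h (ix b))" for b
  define r where "r b = p 0 \<bullet> b + h (ix b)" for b
  have sub: "K \<subseteq> brick l r"
  proof
    fix x assume x: "x \<in> K"
    have "l (u i) \<le> x \<bullet> u i \<and> x \<bullet> u i \<le> r (u i)" if i: "i < ?n" for i
    proof -
      have "\<bar>(x - p 0) \<bullet> u i\<bar> \<le> h i" "0 \<le> (x - p 0) \<bullet> u 0"
        using gf x i by (auto simp: greedy_frame_def)
      then show ?thesis using i by (auto simp: l_def r_def ix inner_diff_left abs_le_iff)
    qed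
    then show "x \<in> brick l r" unfolding brick_def by (auto simp: B_def)
  qed
  have lt: "l b < r b" if "b \<in> B" for b
    using that h by (auto simp: B_def l_def r_def ix)
  have "(\<Prod>b\<in>B. r b - l b) = (\<Prod>i<?n. r (u i) - l (u i))"
    unfolding B_def using inj by (rule prod.reindex[unfolded comp_def])
  also have "\<dots> = (\<Prod>i<?n. (if i = 0 then 1 else 2) * h i)"
    by (intro prod.cong) (auto simp: l_def r_def ix)
  also have "\<dots> = (\<Prod>i<?n. if i = 0 then 1 else 2) * (\<Prod>i<?n. h i)" by (rule prod.distrib)
  also have "(\<Prod>i<?n. if i = 0 then 1 else 2 :: real) = 2 ^ (?n - 1)"
  proof -
    have "{..<?n} = insert 0 {1..<?n}" using n by auto
    then show ?thesis by simp
  qed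
  finally have prod: "(\<Prod>b\<in>B. r b - l b) = 2 ^ (?n - 1) * (\<Prod>i<?n. h i)" .
  let ?S = "insert 0 ((\<lambda>i. p (Suc i) - p 0) ` {..<?n})"
  have vol: "emeasure lborel (convex hull ?S) = ennreal ((\<Prod>i<?n. h i) / fact ?n)"
    using emeasure_greedy_simplex[OF gf, of ?n] by simp
  have "convex hull ?S \<subseteq> (+) (p 0) -` K"
  proof (rule hull_minimal)
    have "p i \<in> K" if "i \<le> ?n" for i using gf that by (simp add: greedy_frame_def)
    then show "?S \<subseteq> (+) (p 0) -` K" by auto
    show "convex ((+) (p 0) -` K)"
    proof -
      have "(+) (p 0) -` K = (+) (- p 0) ` K" by (auto intro: image_eqI[of _ _ "p 0 + _"])
      then show ?thesis using K(2) by (simp add: convex_translation)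
    qed
  qed
  moreover have "K \<in> sets borel" using K(1) by (simp add: compact_imp_closed)
  ultimately have "emeasure lborel (convex hull ?S) \<le> emeasure lborel ((+) (p 0) -` K)"
    using measurable_sets[of "(+) (p 0)" borel borel K] by (intro emeasure_mono) auto
  also have "\<dots> = emeasure (distr lborel borel ((+) (p 0))) K"
    using \<open>K \<in> sets borel\<close> by (simp add: emeasure_distr)
  also have "\<dots> = emeasure lborel K" by (simp add: lborel_distr_plus)
  finally have volK: "ennreal ((\<Prod>i<?n. h i) / fact ?n) \<le> emeasure lborel K" by (simp add: vol)
  have hp: "0 \<le> (\<Prod>i<?n. h i)" using h by (intro prod_nonneg) (auto intro: less_imp_le)
  have "ennreal (\<Prod>b\<in>B. r b - l b) = ennreal (2 ^ (?n - 1) * fact ?n * ((\<Prod>i<?n. h i) / fact ?n))"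
    by (simp add: prod)
  also have "\<dots> \<le> ennreal (real ?n ^ ?n * ((\<Prod>i<?n. h i) / fact ?n))"
    using two_power_fact_le[OF n] hp by (intro ennreal_leI mult_right_mono) auto
  also have "\<dots> = ennreal (real ?n ^ ?n) * ennreal ((\<Prod>i<?n. h i) / fact ?n)"
    using hp by (intro ennreal_mult) auto
  also have "\<dots> \<le> ennreal (real ?n ^ ?n) * emeasure lborel K" by (intro mult_left_mono volK) simp
  finally show ?thesis using orthonormal_basis_axioms sub lt by blast
qed

section \<open>Comparison of the means\<close>

text \<open>
  The case of the full basis, where the coordinate measure is Lebesgue measure itself.
\<close>

lemma hausdorff_measure_full:
  "\<exists>c. 0 < c \<and> c < \<infinity> \<and> hausdorff_measure DIM('a) = density (lborel :: 'a::euclidean_space measure) (\<lambda>_. c)"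
proof -
  interpret orthonormal_basis "Basis :: 'a set"
    by standard (auto simp: inner_Basis)
  let ?c = "hausdorff_outer DIM('a) (unit_brick Basis)"
  have lb: "emeasure (coord_measure Basis) A = emeasure lborel A" if "A \<in> sets borel" for A
  proof -
    have "coord_proj Basis x = x" for x by (rule coord_proj_id) (auto simp: coord_space_def)
    moreover have "slab Basis = UNIV" by (simp add: slab_def)
    ultimately show ?thesis using that by (simp add: emeasure_coord_measure vimage_def)
  qed
  have "hausdorff_measure DIM('a) = density (lborel :: 'a measure) (\<lambda>_. ?c)"
  proof (rule measure_eqI)
    fix A assume "A \<in> sets (hausdorff_measure DIM('a) :: 'a measure)"
    then have A: "A \<in> sets borel" by simp
    then have "emeasure (hausdorff_measure DIM('a)) A = ?c * emeasure lborel A"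
      using hausdorff_outer_eq_coord_measure[of Basis A] lb[OF A]
      by (simp add: emeasure_hausdorff_measure coord_space_def)
    then show "emeasure (hausdorff_measure DIM('a)) A = emeasure (density lborel (\<lambda>_. ?c)) A"
      using A by (simp add: emeasure_density nn_integral_cmult)
  qed simp
  then show ?thesis
    using hausdorff_outer_unit_brick_pos[of Basis] hausdorff_outer_unit_brick_finite[of Basis] by auto
qed

lemma emeasure_closure_convex:
  fixes \<Omega> :: "'a::euclidean_space set"
  assumes "open \<Omega>" "convex \<Omega>"
  shows "emeasure lborel (closure \<Omega>) = emeasure lborel \<Omega>"
proof -
  have "negligible (frontier \<Omega>)" using assms(2) by (rule negligible_convex_frontier)
  then have "frontier \<Omega> \<in> null_sets lebesgue" by (simp only: negligible_iff_null_sets)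
  then have "frontier \<Omega> \<in> null_sets lborel"
    using null_sets_completion_iff[of "frontier \<Omega>" lborel] by (simp add: borel_closed)
  moreover have "closure \<Omega> = \<Omega> \<union> frontier \<Omega>"
    using assms(1) closure_subset by (auto simp: frontier_def interior_open)
  ultimately show ?thesis using assms(1) by (simp add: emeasure_Un_null_set)
qed

text \<open>
  In an enclosing box of volume at most \<open>n ^ n\<close> times that of
  \<open>\<Omega>\<close>, the direction \<open>e\<close> of the shortest edge, of length
  \<open>w\<close>, is chosen. Every face has area at most \<open>\<kappa>\<close> times the
  volume of the box divided by \<open>w\<close>, which bounds the area \<open>S\<close> of the
  boundary of \<open>\<Omega>\<close>; the factors \<open>\<kappa>\<close> and \<open>w\<close>
  cancel against those in the estimate along the chords. Positivity of \<open>S\<close> follows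
  from the estimate along the chords for the constant function 1.
\<close>

lemma frontier_positive_finite_and_mean_bound:
  fixes \<Omega> :: "'a::euclidean_space set"
  assumes \<Omega>: "open \<Omega>" "convex \<Omega>" "bounded \<Omega>" "\<Omega> \<noteq> {}"
  defines "n \<equiv> DIM('a)"
  defines "S \<equiv> hausdorff_outer (n - 1) (frontier \<Omega>)"
  shows "0 < S" "S < \<infinity>"
    and "continuous_on (closure \<Omega>) f \<Longrightarrow> convex_on (closure \<Omega>) f \<Longrightarrow> (\<And>x. x \<in> closure \<Omega> \<Longrightarrow> 0 \<le> f x) \<Longrightarrow>
      S * (\<integral>\<^sup>+x\<in>\<Omega>. ennreal (f x) \<partial>lborel)
      \<le> ennreal (real n ^ (n + 1)) * emeasure lborel \<Omega>
         * (\<integral>\<^sup>+x\<in>frontier \<Omega>. ennreal (f x) \<partial>hausdorff_measure (n - 1))"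
proof -
  let ?K = "closure \<Omega>"
  have n: "0 < n" by (simp add: n_def)
  have K: "compact ?K" "convex ?K" "interior ?K \<noteq> {}"
    using \<Omega> interior_maximal[OF closure_subset \<Omega>(1)] by (auto simp: compact_closure convex_closure)
  obtain B l u where B: "orthonormal_basis B" "?K \<subseteq> orthonormal_basis.brick B l u"
    and lu: "\<And>b. b \<in> B \<Longrightarrow> l b < u b"
    and vol: "ennreal (\<Prod>b\<in>B. u b - l b) \<le> ennreal (real n ^ n) * emeasure lborel ?K"
    using ex_enclosing_brick[OF K] unfolding n_def by metis
  interpret orthonormal_basis B by (rule B(1))
  have "B \<noteq> {}" using card_basis n by (auto simp: n_def)
  then obtain e where e: "e \<in> B" "\<And>b. b \<in> B \<Longrightarrow> u e - l e \<le> u b - l b"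
    using ex_min_if_finite[of "(\<lambda>b. u b - l b) ` B"] finite_basis by (auto simp: not_less) 
  define w where "w = u e - l e"
  have w: "0 < w" using lu[OF e(1)] by (simp add: w_def)
  define \<kappa> where "\<kappa> = hausdorff_outer (n - 1) (unit_brick (B - {e}))"
  have card: "card (B - {b}) = n - 1" if "b \<in> B" for b using that card_basis by (simp add: n_def)
  have \<kappa>: "0 < \<kappa>" "\<kappa> < \<infinity>"
    using hausdorff_outer_unit_brick_pos[of "B - {e}"] hausdorff_outer_unit_brick_finite[of "B - {e}"]
      card[OF e(1)] by (auto simp: \<kappa>_def)
  define V where "V = emeasure lborel \<Omega>"
  have V: "V < \<infinity>" using \<Omega>(3) unfolding V_def by (rule emeasure_bounded_finite)
  have chord: "\<kappa> * (\<integral>\<^sup>+x\<in>\<Omega>. ennreal (g x) \<partial>lborel)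
      \<le> ennreal (w / 2) * (\<integral>\<^sup>+x\<in>frontier \<Omega>. ennreal (g x) \<partial>hausdorff_measure (n - 1))"
    if "continuous_on ?K g" "convex_on ?K g" "\<And>x. x \<in> ?K \<Longrightarrow> 0 \<le> g x" for g
  proof -
    have wid: "(x - y) \<bullet> e \<le> w" if "x \<in> ?K" "y \<in> ?K" for x y
    proof -
      have "x \<bullet> e \<le> u e" "l e \<le> y \<bullet> e" using B(2) that e(1) by (auto simp: brick_def)
      then show ?thesis by (simp add: w_def inner_diff_left)
    qed
    show ?thesis
      using nn_integral_convex_le_frontier[OF e(1) \<Omega>(1-3) that wid] card[OF e(1)] by (simp add: \<kappa>_def)
  qed
  have face: "ennreal (\<Prod>c\<in>B - {b}. u c - l c) \<le> ennreal (real n ^ n / w) * V" if b: "b \<in> B" for b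
  proof -
    let ?P = "\<Prod>c\<in>B - {b}. u c - l c"
    have P: "0 \<le> ?P" using lu by (intro prod_nonneg) (auto intro: less_imp_le)
    have "w * ?P \<le> (u b - l b) * ?P" using e(2)[OF b] P by (intro mult_right_mono) (auto simp: w_def)
    also have "\<dots> = (\<Prod>c\<in>B. u c - l c)" using b by (simp add: prod.remove)
    finally have "ennreal (w * ?P) \<le> ennreal (\<Prod>c\<in>B. u c - l c)" by (rule ennreal_leI)
    also have "\<dots> \<le> ennreal (real n ^ n) * V"
      using vol \<Omega> by (simp add: emeasure_closure_convex V_def)
    finally have "ennreal (1 / w) * ennreal (w * ?P) \<le> ennreal (1 / w) * (ennreal (real n ^ n) * V)"
      by (rule mult_left_mono) simp
    moreover have "ennreal (1 / w) * ennreal (w * ?P) = ennreal ?P"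
      using w P by (simp flip: ennreal_mult)
    moreover have "ennreal (1 / w) * (ennreal (real n ^ n) * V) = ennreal (real n ^ n / w) * V"
      using w by (simp add: ennreal_mult mult_ac divide_inverse)
    ultimately show ?thesis by simp
  qed
  have "S \<le> (\<Sum>b\<in>B. 2 * (hausdorff_outer (n - 1) (unit_brick (B - {b})) * ennreal (\<Prod>c\<in>B - {b}. u c - l c)))"
    unfolding S_def using hausdorff_outer_frontier_le_brick[OF \<Omega>(1,2,4) B(2)] by (simp add: n_def)
  also have "\<dots> \<le> (\<Sum>b\<in>B. 2 * (\<kappa> * (ennreal (real n ^ n / w) * V)))"
  proof (intro sum_mono mult_left_mono mult_mono)
    fix b assume b: "b \<in> B"
    show "hausdorff_outer (n - 1) (unit_brick (B - {b})) \<le> \<kappa>"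
      unfolding \<kappa>_def
      by (intro eq_refl hausdorff_outer_unit_brick_cong Diff_subset) (simp only: card[OF b] card[OF e(1)])
  qed (use face in auto)
  also have "\<dots> = of_nat n * (2 * (\<kappa> * (ennreal (real n ^ n / w) * V)))"
    using card_basis by (simp add: n_def)
  also have "\<dots> = (\<kappa> * ennreal (2 * real n ^ (n + 1) / w)) * V"
  proof -
    have "of_nat n * (2 * ennreal (real n ^ n / w)) = ennreal (real n) * (ennreal 2 * ennreal (real n ^ n / w))"
      by (simp add: ennreal_of_nat_eq_real_of_nat)
    also have "\<dots> = ennreal (real n * (2 * (real n ^ n / w)))"
      by (simp only: ennreal_mult' of_nat_0_le_iff zero_le_numeral)
    also have "real n * (2 * (real n ^ n / w)) = 2 * real n ^ (n + 1) / w" by simp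
    finally have *: "of_nat n * (2 * ennreal (real n ^ n / w)) = ennreal (2 * real n ^ (n + 1) / w)" .
    have "of_nat n * (2 * (\<kappa> * (ennreal (real n ^ n / w) * V)))
        = \<kappa> * (of_nat n * (2 * ennreal (real n ^ n / w))) * V"
      by (simp only: mult_ac)
    then show ?thesis by (simp only: *)
  qed
  finally have S_le: "S \<le> (\<kappa> * ennreal (2 * real n ^ (n + 1) / w)) * V" .
  also have "\<dots> < \<infinity>" using \<kappa> V by (simp add: ennreal_mult_less_top)
  finally show "S < \<infinity>" .
  show "0 < S"
  proof (rule ccontr)
    assume "\<not> 0 < S"
    then have S0: "S = 0" by simp
    have "convex_on ?K (\<lambda>_. 1 :: real)" using K(2) by (simp add: convex_on_const)
    then have "\<kappa> * emeasure lborel \<Omega> \<le> ennreal (w / 2) * emeasure (hausdorff_measure (n - 1)) (frontier \<Omega>)"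
      using chord[of "\<lambda>_. 1"] \<Omega>(1) by (simp add: borel_closed)
    then have "\<kappa> * V = 0" using S0 by (simp add: emeasure_hausdorff_measure V_def S_def)
    then have "V = 0" using \<kappa>(1) by (auto simp: zero_less_iff_neq_zero)
    then have "\<Omega> \<in> null_sets lborel" using \<Omega>(1) by (simp add: V_def null_sets_def)
    then have "\<Omega> \<in> null_sets lebesgue" by (rule null_sets_completionI)
    then have "negligible \<Omega>" by (simp only: negligible_iff_null_sets)
    then show False using open_not_negligible[OF \<Omega>(1,4)] by blast
  qed
  assume f: "continuous_on ?K f" "convex_on ?K f" "\<And>x. x \<in> ?K \<Longrightarrow> 0 \<le> f x"
  let ?F = "\<integral>\<^sup>+x\<in>frontier \<Omega>. ennreal (f x) \<partial>hausdorff_measure (n - 1)"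
  have "S * (\<integral>\<^sup>+x\<in>\<Omega>. ennreal (f x) \<partial>lborel)
      \<le> (\<kappa> * ennreal (2 * real n ^ (n + 1) / w)) * V * (\<integral>\<^sup>+x\<in>\<Omega>. ennreal (f x) \<partial>lborel)"
    by (intro mult_right_mono S_le) simp
  also have "\<dots> = ennreal (2 * real n ^ (n + 1) / w) * V * (\<kappa> * (\<integral>\<^sup>+x\<in>\<Omega>. ennreal (f x) \<partial>lborel))"
    by (simp only: mult_ac)
  also have "\<dots> \<le> ennreal (2 * real n ^ (n + 1) / w) * V * (ennreal (w / 2) * ?F)"
    by (intro mult_left_mono chord f) simp_all
  also have "\<dots> = ennreal (2 * real n ^ (n + 1) / w) * ennreal (w / 2) * V * ?F"
    by (simp only: mult_ac)
  also have "ennreal (2 * real n ^ (n + 1) / w) * ennreal (w / 2) = ennreal (2 * real n ^ (n + 1) / w * (w / 2))"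
    using w by (intro ennreal_mult[symmetric]) auto
  also have "2 * real n ^ (n + 1) / w * (w / 2) = real n ^ (n + 1)" using w by simp
  finally show "S * (\<integral>\<^sup>+x\<in>\<Omega>. ennreal (f x) \<partial>lborel)
      \<le> ennreal (real n ^ (n + 1)) * emeasure lborel \<Omega> * ?F" by (simp only: V_def)
qed

text \<open>
  A convex function on the closure may jump upwards at the boundary and its boundary values need
  not be measurable, in which case the integral on the right is a lower integral. Therefore
  \<open>f\<close> is replaced by its composition with the contraction \<open>\<phi> k\<close>
  towards an interior point \<open>p\<close>. The compositions are continuous up to the
  boundary, exceed \<open>f\<close> on the boundary by at most \<open>s k * f p\<close>, and
  converge to \<open>f\<close> inside, where Fatou's lemma applies.
\<close>

lemma mean_bound_convex_nonneg:
  fixes \<Omega> :: "'a::euclidean_space set"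
  assumes \<Omega>: "open \<Omega>" "convex \<Omega>" "bounded \<Omega>" "\<Omega> \<noteq> {}"
    and f: "convex_on (closure \<Omega>) f" "\<And>x. x \<in> closure \<Omega> \<Longrightarrow> 0 \<le> f x"
  defines "n \<equiv> DIM('a)"
  defines "S \<equiv> hausdorff_outer (n - 1) (frontier \<Omega>)"
  shows "S * (\<integral>\<^sup>+x\<in>\<Omega>. ennreal (f x) \<partial>lborel)
    \<le> ennreal (real n ^ (n + 1)) * emeasure lborel \<Omega>
       * (\<integral>\<^sup>+x\<in>frontier \<Omega>. ennreal (f x) \<partial>hausdorff_measure (n - 1))"
proof -
  let ?K = "closure \<Omega>" and ?H = "hausdorff_measure (n - 1) :: 'a measure"
  let ?C = "ennreal (real n ^ (n + 1)) * emeasure lborel \<Omega>"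
  let ?F = "\<integral>\<^sup>+x\<in>frontier \<Omega>. ennreal (f x) \<partial>?H"
  have S: "0 < S" "S < \<infinity>"
    using frontier_positive_finite_and_mean_bound(1,2)[OF \<Omega>] by (simp_all add: S_def n_def)
  have C: "?C < \<infinity>" using emeasure_bounded_finite[OF \<Omega>(3)] by (simp add: ennreal_mult_less_top)
  obtain p where p: "p \<in> \<Omega>" using \<Omega>(4) by blast
  define s where "s k = 1 / real (Suc (Suc k))" for k
  have s: "0 < s k" "s k < 1" for k by (auto simp: s_def)
  have s_lim: "s \<longlonglongrightarrow> 0"
    unfolding s_def using LIMSEQ_Suc[OF LIMSEQ_inverse_real_of_nat] by (simp add: inverse_eq_divide)
  define \<phi> where "\<phi> k x = x - s k *\<^sub>R (x - p)" for k x
  define g where "g k x = f (\<phi> k x)" for k x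
  have \<phi>_in: "\<phi> k x \<in> \<Omega>" if "x \<in> ?K" for k x
    using mem_interior_closure_convex_shrink[OF \<Omega>(2), of p x "s k"] p that \<Omega>(1) s[of k]
    by (simp add: \<phi>_def interior_open)
  have cont: "continuous_on \<Omega> f"
    using convex_on_subset[OF f(1) closure_subset] \<Omega>(1,2) by (intro convex_on_continuous) auto
  have g_cont: "continuous_on ?K (g k)" for k
    unfolding g_def
  proof (rule continuous_on_compose2[OF cont])
    show "continuous_on ?K (\<phi> k)" unfolding \<phi>_def by (intro continuous_intros)
  qed (use \<phi>_in in auto)
  have g_conv: "convex_on ?K (g k)" for k
  proof (rule convex_onI)
    fix t x y assume t: "0 < t" "t < (1::real)" and xy: "x \<in> ?K" "y \<in> ?K"
    have "\<phi> k ((1 - t) *\<^sub>R x + t *\<^sub>R y) = (1 - t) *\<^sub>R \<phi> k x + t *\<^sub>R \<phi> k y"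
      by (simp add: \<phi>_def algebra_simps)
    then show "g k ((1 - t) *\<^sub>R x + t *\<^sub>R y) \<le> (1 - t) * g k x + t * g k y"
      unfolding g_def using convex_onD[OF f(1), of t "\<phi> k x" "\<phi> k y"] t xy \<phi>_in closure_subset by auto
  qed (simp add: \<Omega>(2) convex_closure)
  have g_nonneg: "0 \<le> g k x" if "x \<in> ?K" for k x
    unfolding g_def using f(2) \<phi>_in[OF that] closure_subset by blast
  have g_le: "g k x \<le> (1 - s k) * f x + s k * f p" if "x \<in> ?K" for k x
  proof -
    have "\<phi> k x = (1 - s k) *\<^sub>R x + s k *\<^sub>R p" by (simp add: \<phi>_def algebra_simps)
    then show ?thesis
      unfolding g_def using convex_onD[OF f(1), of "s k" x p] s[of k] that p closure_subset by auto
  qed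
  have fr: "frontier \<Omega> \<subseteq> ?K" by (auto simp: frontier_def)
  have g_meas: "(\<lambda>x. ennreal (g k x) * indicator T x) \<in> borel_measurable borel"
    if "T \<in> sets borel" "T \<subseteq> ?K" for T k
  proof -
    have "(\<lambda>x. ennreal (indicator T x *\<^sub>R g k x)) \<in> borel_measurable borel"
      using that continuous_on_subset[OF g_cont]
      by (intro measurable_compose[OF _ measurable_ennreal] borel_measurable_continuous_on_indicator)
    then show ?thesis by (rule measurable_cong[THEN iffD1, rotated]) (auto simp: indicator_def)
  qed
  have fp: "0 \<le> f p" using f(2) p closure_subset by blast
  (* On the boundary, g k - s k * f p is a measurable minorant of f, so its integral is at most the lower integral of f. *)
  have F_le: "(\<integral>\<^sup>+x\<in>frontier \<Omega>. ennreal (g k x) \<partial>?H) \<le> ?F + ennreal (s k * f p) * S" for k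
  proof -
    define G where "G x = ennreal (g k x) * indicator (frontier \<Omega>) x" for x
    have [measurable]: "frontier \<Omega> \<in> sets borel" by simp
    have [measurable]: "G \<in> borel_measurable borel"
      unfolding G_def by (rule g_meas) (use fr in auto)
    let ?q = "\<lambda>x. G x - ennreal (s k * f p)"
    have "(\<integral>\<^sup>+x\<in>frontier \<Omega>. ennreal (g k x) \<partial>?H)
        \<le> (\<integral>\<^sup>+x. ?q x + ennreal (s k * f p) * indicator (frontier \<Omega>) x \<partial>?H)"
    proof (rule nn_integral_mono)
      have "a \<le> (a - c) + c" for a c :: ennreal
        using ennreal_minus_le_iff[of a c "a - c"] by (simp add: add.commute)
      then show "ennreal (g k x) * indicator (frontier \<Omega>) x
          \<le> ?q x + ennreal (s k * f p) * indicator (frontier \<Omega>) x" for x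
        by (simp add: indicator_def G_def)
    qed
    also have "\<dots> = (\<integral>\<^sup>+x. ?q x \<partial>?H) + (\<integral>\<^sup>+x. ennreal (s k * f p) * indicator (frontier \<Omega>) x \<partial>?H)"
      by (rule nn_integral_add) measurable
    also have "(\<integral>\<^sup>+x. ennreal (s k * f p) * indicator (frontier \<Omega>) x \<partial>?H) = ennreal (s k * f p) * S"
      by (subst nn_integral_cmult_indicator) (auto simp: emeasure_hausdorff_measure S_def)
    also have "(\<integral>\<^sup>+x. ?q x \<partial>?H) \<le> ?F"
    proof (rule nn_integral_mono)
      fix x
      show "?q x \<le> ennreal (f x) * indicator (frontier \<Omega>) x"
      proof (cases "x \<in> frontier \<Omega>")
        case True
        then have xK: "x \<in> ?K" using fr by blast
        have "(1 - s k) * f x \<le> 1 * f x" using s[of k] f(2)[OF xK] by (intro mult_right_mono) auto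
        then have "g k x \<le> f x + s k * f p" using g_le[OF xK, of k] by simp
        then have "ennreal (g k x) \<le> ennreal (f x + s k * f p)" by (rule ennreal_leI)
        also have "\<dots> = ennreal (s k * f p) + ennreal (f x)"
          using f(2)[OF xK] fp s[of k] by (simp add: add.commute)
        finally show ?thesis using True by (simp add: ennreal_minus_le_iff G_def)
      qed (simp add: G_def)
    qed
    finally show ?thesis by (simp add: add_right_mono)
  qed
  have G_le: "(\<integral>\<^sup>+x\<in>\<Omega>. ennreal (g k x) \<partial>lborel) \<le> ?C * (?F + ennreal (s k * f p) * S) / S" for k
  proof -
    have "S * (\<integral>\<^sup>+x\<in>\<Omega>. ennreal (g k x) \<partial>lborel) \<le> ?C * (\<integral>\<^sup>+x\<in>frontier \<Omega>. ennreal (g k x) \<partial>?H)"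
      unfolding S_def n_def
      by (rule frontier_positive_finite_and_mean_bound(3)[OF \<Omega> g_cont g_conv g_nonneg])
    also have "\<dots> \<le> ?C * (?F + ennreal (s k * f p) * S)" by (intro mult_left_mono F_le) simp
    finally have "S * (\<integral>\<^sup>+x\<in>\<Omega>. ennreal (g k x) \<partial>lborel) / S \<le> ?C * (?F + ennreal (s k * f p) * S) / S"
      by (rule divide_right_mono_ennreal)
    then show ?thesis using S by (simp add: ennreal_mult_divide_eq mult.commute[of S] less_top)
  qed
  have "(\<integral>\<^sup>+x\<in>\<Omega>. ennreal (f x) \<partial>lborel) = (\<integral>\<^sup>+x. liminf (\<lambda>k. ennreal (g k x) * indicator \<Omega> x) \<partial>lborel)"
  proof (rule nn_integral_cong)
    fix x
    show "ennreal (f x) * indicator \<Omega> x = liminf (\<lambda>k. ennreal (g k x) * indicator \<Omega> x)"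
    proof (cases "x \<in> \<Omega>")
      case True
      have "(\<lambda>k. \<phi> k x) \<longlonglongrightarrow> x - 0 *\<^sub>R (x - p)" unfolding \<phi>_def by (intro tendsto_intros s_lim)
      moreover have "\<phi> k x \<in> \<Omega>" for k using \<phi>_in True closure_subset by blast
      ultimately have "(\<lambda>k. g k x) \<longlonglongrightarrow> f x"
        unfolding g_def using True by (intro continuous_on_tendsto_compose[OF cont]) auto
      then have "(\<lambda>k. ennreal (g k x)) \<longlonglongrightarrow> ennreal (f x)" by (rule tendsto_ennrealI)
      then show ?thesis using True by (simp add: lim_imp_Liminf)
    qed (simp add: Liminf_const)
  qed
  also have "\<dots> \<le> liminf (\<lambda>k. \<integral>\<^sup>+x. ennreal (g k x) * indicator \<Omega> x \<partial>lborel)"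
    by (intro nn_integral_liminf) (use g_meas[of \<Omega>] \<Omega>(1) closure_subset in auto)
  also have "\<dots> \<le> liminf (\<lambda>k. ?C * (?F + ennreal (s k * f p) * S) / S)"
    by (intro Liminf_mono always_eventually allI G_le)
  also have "\<dots> = ?C * (?F + ennreal (0 * f p) * S) / S"
  proof (intro lim_imp_Liminf)
    have fin: "S < top" "?C < top" "inverse S < top"
      using S C by (simp_all add: less_top[symmetric])
    have "(\<lambda>k. ennreal (s k * f p)) \<longlonglongrightarrow> ennreal (0 * f p)"
      by (intro tendsto_ennrealI tendsto_intros s_lim)
    then have "(\<lambda>k. inverse S * (?C * (?F + S * ennreal (s k * f p))))
        \<longlonglongrightarrow> inverse S * (?C * (?F + S * ennreal (0 * f p)))"
      by (rule ennreal_tendsto_cmult[OF fin(3) ennreal_tendsto_cmult[OF fin(2)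
            tendsto_add[OF tendsto_const ennreal_tendsto_cmult[OF fin(1)]]]])
    then show "(\<lambda>k. ?C * (?F + ennreal (s k * f p) * S) / S) \<longlonglongrightarrow> ?C * (?F + ennreal (0 * f p) * S) / S"
      by (simp add: divide_ennreal_def mult_ac)
  qed simp
  finally have "S * (\<integral>\<^sup>+x\<in>\<Omega>. ennreal (f x) \<partial>lborel) \<le> S * (?C * ?F / S)"
    by (intro mult_left_mono) simp_all
  also have "\<dots> = ?C * ?F"
    using S ennreal_mult_divide_eq[of S "?C * ?F"] by (simp add: mult.commute[of S] ennreal_times_divide less_top)
  finally show ?thesis .
qed

section \<open>The inequality\<close>

text \<open>
  Dividing by measures in extended arithmetic. The factor \<open>c\<close> is the ratio of
  Hausdorff measure to Lebesgue measure, and it cancels.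
\<close>

lemma ennreal_mean_comparison:
  fixes S I V F N c r :: ennreal
  assumes main: "S * I \<le> N * V * F" and S: "0 < S" "S < \<infinity>" and V: "0 < V" "V < \<infinity>"
    and c: "0 < c" "c < \<infinity>" and r: "1 \<le> r"
  shows "inverse (c * V) * (c * I) \<le> r * (N * inverse S) * F"
proof -
  have inv: "inverse x * x = 1" if "0 < x" "x < \<infinity>" for x :: ennreal
    using that ennreal_divide_self[of x] by (simp add: divide_ennreal_def mult.commute less_top)
  have cV: "0 < c * V" "c * V < \<infinity>" using c V by (simp_all add: ennreal_zero_less_mult_iff ennreal_mult_less_top)
  have "inverse (c * V) * (c * I) = inverse (c * V) * c * (inverse S * S) * I"
    using inv[OF S] by (simp add: mult_ac)
  also have "\<dots> = inverse (c * V) * c * inverse S * (S * I)" by (simp only: mult_ac)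
  also have "\<dots> \<le> inverse (c * V) * c * inverse S * (N * V * F)" by (intro mult_left_mono main) simp
  also have "\<dots> = inverse (c * V) * (c * V) * ((N * inverse S) * F)" by (simp only: mult_ac)
  also have "\<dots> = 1 * (N * inverse S) * F" by (subst inv[OF cV]) (simp only: mult.assoc)
  also have "\<dots> \<le> r * (N * inverse S) * F" by (intro mult_right_mono r) simp_all
  finally show ?thesis .
qed

theorem theorem1:
  fixes \<Omega> :: "(real ^ 'n) set" and f :: "real ^ 'n \<Rightarrow> real"
  assumes "open \<Omega>" and "connected \<Omega>" and "\<Omega> \<noteq> {}" and "bounded \<Omega>" and "convex \<Omega>"
    and "convex_on (closure \<Omega>) f"
    and "\<forall>x\<in>frontier \<Omega>. 0 \<le> f x"
  shows "1 / enn2ereal (emeasure (hausdorff_measure CARD('n)) \<Omega>)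
           * ext_integral (hausdorff_measure CARD('n)) \<Omega> f
         \<le> ereal (2 / sqrt pi)
           * (ereal (real CARD('n) ^ (CARD('n) + 1))
              / enn2ereal (emeasure (hausdorff_measure (CARD('n) - 1)) (frontier \<Omega>)))
           * ext_integral (hausdorff_measure (CARD('n) - 1)) (frontier \<Omega>) f"
proof -
  let ?n = "CARD('n)"
  have n: "DIM(real ^ 'n) = ?n" by simp
  let ?H = "hausdorff_measure ?n :: (real ^ 'n) measure"
  let ?S = "emeasure (hausdorff_measure (?n - 1)) (frontier \<Omega>)"
  let ?F = "\<integral>\<^sup>+x\<in>frontier \<Omega>. ennreal (f x) \<partial>hausdorff_measure (?n - 1)"
  let ?V = "emeasure lborel \<Omega>" and ?I = "\<integral>\<^sup>+x\<in>\<Omega>. ennreal (f x) \<partial>lborel"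
  (* The positive part of f is again convex, and f and its positive part agree after conversion to ennreal. *)
  define g where "g x = max 0 (f x)" for x
  have fg: "ennreal (g x) = ennreal (f x)" for x by (simp add: g_def ennreal_max_0)
  have g_conv: "convex_on (closure \<Omega>) g"
  proof (rule convex_onI)
    fix t :: real and x y assume t: "0 < t" "t < 1" and xy: "x \<in> closure \<Omega>" "y \<in> closure \<Omega>"
    have "f ((1 - t) *\<^sub>R x + t *\<^sub>R y) \<le> (1 - t) * f x + t * f y"
      using convex_onD[OF assms(6)] t xy by simp
    also have "\<dots> \<le> (1 - t) * g x + t * g y"
      using t by (intro add_mono mult_left_mono) (auto simp: g_def)
    finally have "f ((1 - t) *\<^sub>R x + t *\<^sub>R y) \<le> (1 - t) * g x + t * g y" .
    moreover have "0 \<le> (1 - t) * g x + t * g y" using t by (simp add: g_def)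
    ultimately show "g ((1 - t) *\<^sub>R x + t *\<^sub>R y) \<le> (1 - t) * g x + t * g y"
      by (simp add: g_def[of "_ + _"])
  qed (use assms(5) in \<open>simp add: convex_closure\<close>)
  have S_eq: "?S = hausdorff_outer (?n - 1) (frontier \<Omega>)" by (simp add: emeasure_hausdorff_measure)
  have S: "0 < ?S" "?S < \<infinity>"
    using frontier_positive_finite_and_mean_bound(1,2)[OF assms(1,5,4,3)] unfolding S_eq n by simp_all
  have main: "?S * ?I \<le> ennreal (real ?n ^ (?n + 1)) * ?V * ?F"
    using mean_bound_convex_nonneg[OF assms(1,5,4,3) g_conv] unfolding S_eq n fg by (simp add: g_def)
  have V: "0 < ?V" "?V < \<infinity>"
  proof -
    show "?V < \<infinity>" using assms(4) by (rule emeasure_bounded_finite)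
    have "\<not> negligible \<Omega>" using assms(1,3) by (rule open_not_negligible)
    then have "\<Omega> \<notin> null_sets lborel" using null_sets_completionI negligible_iff_null_sets by blast
    then show "0 < ?V" using assms(1) by (auto simp: null_sets_def zero_less_iff_neq_zero)
  qed
  obtain c where c: "0 < c" "c < \<infinity>" and H: "?H = density lborel (\<lambda>_. c)"
    using hausdorff_measure_full[where 'a = "real ^ 'n"] unfolding n by blast
  have HV: "emeasure ?H \<Omega> = c * ?V"
    unfolding H using assms(1) by (simp add: emeasure_density nn_integral_cmult)
  have f_meas: "(\<lambda>x. ennreal (f x) * indicator \<Omega> x) \<in> borel_measurable borel"
  proof -
    have "continuous_on \<Omega> f"
      using convex_on_subset[OF assms(6) closure_subset] assms(1,5) by (intro convex_on_continuous) auto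
    then have "(\<lambda>x. ennreal (indicator \<Omega> x *\<^sub>R f x)) \<in> borel_measurable borel"
      using assms(1) by (intro measurable_compose[OF _ measurable_ennreal]
          borel_measurable_continuous_on_indicator) auto
    then show ?thesis by (rule measurable_cong[THEN iffD1, rotated]) (auto simp: indicator_def)
  qed
  have HI: "(\<integral>\<^sup>+x\<in>\<Omega>. ennreal (f x) \<partial>?H) = c * ?I"
    unfolding H using f_meas by (simp add: nn_integral_density nn_integral_cmult)
  have "ext_integral ?H \<Omega> f \<le> enn2ereal (c * ?I)"
    unfolding ext_integral_def HI by (intro ereal_diff_le_self) simp
  then have "1 / enn2ereal (emeasure ?H \<Omega>) * ext_integral ?H \<Omega> f
      \<le> 1 / enn2ereal (c * ?V) * enn2ereal (c * ?I)"
    unfolding HV by (intro ereal_mult_left_mono) (simp_all add: divide_ereal_def flip: inverse_ennreal.rep_eq)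
  also have "\<dots> = enn2ereal (inverse (c * ?V) * (c * ?I))"
    by (simp only: divide_ereal_def mult_1 times_ennreal.rep_eq inverse_ennreal.rep_eq)
  also have "\<dots> \<le> enn2ereal (ennreal (2 / sqrt pi) * (ennreal (real ?n ^ (?n + 1)) * inverse ?S) * ?F)"
  proof -
    have "sqrt pi \<le> sqrt 4" using pi_less_4 by (intro real_sqrt_le_mono) simp
    then have "1 \<le> 2 / sqrt pi" by simp
    then have "1 \<le> ennreal (2 / sqrt pi)" using ennreal_leI by fastforce
    then show ?thesis
      unfolding less_eq_ennreal.rep_eq[symmetric] by (intro ennreal_mean_comparison main S V c)
  qed
  also have "\<dots> = ereal (2 / sqrt pi) * (ereal (real ?n ^ (?n + 1)) / enn2ereal ?S) * enn2ereal ?F"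
    by (simp only: divide_ereal_def times_ennreal.rep_eq inverse_ennreal.rep_eq)
      (simp add: enn2ereal_ennreal)
  also have "enn2ereal ?F = ext_integral (hausdorff_measure (?n - 1)) (frontier \<Omega>) f"
  proof -
    have "(\<integral>\<^sup>+x\<in>frontier \<Omega>. ennreal (- f x) \<partial>hausdorff_measure (?n - 1))
        = (\<integral>\<^sup>+x. 0 \<partial>(hausdorff_measure (?n - 1) :: (real ^ 'n) measure))"
      using assms(7) by (intro nn_integral_cong) (auto simp: indicator_def ennreal_neg)
    then show ?thesis by (simp add: ext_integral_def zero_ennreal.rep_eq)
  qed
  finally show ?thesis .
qed

end
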